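(* Let $M$ be an oriented smooth $n$-manifold, $\sigma\colon M\to\mathbb H^{n+1}$ an embedding with small principal curvatures, and $G_\sigma\colon M\to\mathcal G(\mathbb H^{n+1})$ its Gauss map, with mean curvature vector $\overline{\mathrm H}$. Then $$G_\sigma^*\big(\Omega(\overline{\mathrm H},\cdot)\big)=df_\sigma=d\left(\frac1n\sum_{i=1}^n\operatorname{arctanh}\lambda_i\right),$$ where $\lambda_1,\dots,\lambda_n$ are the principal curvatures of $\sigma$ and $f_\sigma=\frac1n\sum_{i=1}^n\operatorname{arctanh}\lambda_i$.
   Context: Hyperboloid model: $\mathbb R^{n+1,1}$ is $\mathbb R^{n+2}$ with $\langle x,y\rangle=\sum_{i=1}^{n+1}x_iy_i-x_{n+2}y_{n+2}$, and $\mathbb H^{n+1}=\{x:\langle x,x\rangle=-1,\ x_{n+2}>0\}$ with the induced metric and a fixed orientation; $T^1\mathbb H^{n+1}=\{(x,v):x\in\mathbb H^{n+1},\langle x,v\rangle=0,\langle v,v\rangle=1\}\subset\mathbb R^{n+1,1}\times\mathbb R^{n+1,1}$. $\mathcal G(\mathbb H^{n+1})$ is the $2n$-manifold of maximal oriented unparametrized geodesics of $\mathbb H^{n+1}$, and $\mathrm p\colon T^1\mathbb H^{n+1}\to\mathcal G(\mathbb H^{n+1})$ sends $(x,v)$ to the oriented geodesic through $x$ with velocity $v$. It is a principal $\mathbb R$-bundle for the geodesic flow $\varphi_t(x,v)=(\cosh(t)x+\sinh(t)v,\sinh(t)x+\cosh(t)v)$, whose infinitesimal generator is $\chi_{(x,v)}=(v,x)$.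 For $w\in T_x\mathbb H^{n+1}$ with $w\perp v$ put $w^{\mathcal H}=(w,0)$, $w^{\mathcal V}=(0,w)$. Then $T_{(x,v)}T^1\mathbb H^{n+1}=\mathrm{Span}(\chi)\oplus\{w^{\mathcal H}\}\oplus\{w^{\mathcal V}\}$. The para-Sasaki metric $g$ makes these three summands mutually orthogonal, with $g(\chi,\chi)=1$, $g(w_1^{\mathcal H},w_2^{\mathcal H})=\langle w_1,w_2\rangle$, $g(w_1^{\mathcal V},w_2^{\mathcal V})=-\langle w_1,w_2\rangle$. On $\chi^\perp$ let $J(w^{\mathcal H})=w^{\mathcal V}$, $J(w^{\mathcal V})=w^{\mathcal H}$. Since $g$ and $J$ are invariant under $\varphi_t$ and $d\mathrm p\colon\chi^\perp_{(x,v)}\to T_{\mathrm p(x,v)}\mathcal G(\mathbb H^{n+1})$ is an isomorphism, $g|_{\chi^\perp}$ and $J$ descend to a pseudo-Riemannian metric $\mathbb G$ of signature $(n,n)$ and a tensor $\mathbb J$ with $\mathbb J^2=\mathrm{id}$; $\Omega(X,Y)=\mathbb G(X,\mathbb JY)$. With $\nu$ the unit normal field of $\sigma$ compatible with the orientations (for a fixed convention), $G_\sigma(p)=\mathrm p(\sigma(p),\nu(p))$. The shape operator $B$ is defined by $d\sigma(B(W))=-D_W\nu$ ($D$ the Levi-Civita connection of $\mathbb H^{n+1}$); principal curvatures are its eigenvalues, and they are small if they all lie in $(-1,1)$ at every point. In this case $G_\sigma$ is an immersion with $\overline{\mathrm I}=G_\sigma^*\mathbb G$ positive definite. With $\mathbb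 D$ the Levi-Civita connection of $\mathbb G$, $\overline{\mathrm{II}}(V,W)=(\mathbb D_{(G_\sigma)_*V}(G_\sigma)_*W)^\perp$ (projection to the $\mathbb G$-normal bundle) and $\overline{\mathrm H}=\frac1n\mathrm{tr}_{\overline{\mathrm I}}\overline{\mathrm{II}}$. The 1-form $G_\sigma^*(\Omega(\overline{\mathrm H},\cdot))$ is $V\mapsto\Omega(\overline{\mathrm H},dG_\sigma(V))$. The function $f_\sigma$ is smooth, as $f_\sigma=\frac1{2n}\log\frac{\det(\mathrm{id}+B)}{\det(\mathrm{id}-B)}$. *)

theory Defs
  imports "HOL-Analysis.Analysis" "HOL-Library.Function_Algebras"
begin

section \<open>Smooth functions\<close>

primrec C_k_on :: "nat \<Rightarrow> ('a::real_normed_vector \<Rightarrow> 'b::real_normed_vector) \<Rightarrow> 'a set \<Rightarrow> bool" where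
  "C_k_on 0 f S \<longleftrightarrow> continuous_on S f"
| "C_k_on (Suc k) f S \<longleftrightarrow>
     (\<forall>x\<in>S. f differentiable (at x)) \<and> (\<forall>v. C_k_on k (\<lambda>x. frechet_derivative f (at x) v) S)"

text \<open>The following is meant for open \<open>S\<close>; the version for arbitrary subsets asks for local smooth
  extensions.\<close>

definition smooth_on :: "('a::real_normed_vector \<Rightarrow> 'b::real_normed_vector) \<Rightarrow> 'a set \<Rightarrow> bool" where
  "smooth_on f S \<longleftrightarrow> (\<forall>k. C_k_on k f S)"

definition smooth_within :: "('a::real_normed_vector \<Rightarrow> 'b::real_normed_vector) \<Rightarrow> 'a set \<Rightarrow> bool" where
  "smooth_within f S \<longleftrightarrow>
     (\<forall>x\<in>S. \<exists>N F. open N \<and> x \<in> N \<and> smooth_on F N \<and> (\<forall>y\<in>N \<inter> S. F y = f y))"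


section \<open>Manifolds given by atlases\<close>

text \<open>Pointwise vector space structure on functions; the additive part is in \<open>Function_Algebras\<close>.\<close>

instantiation "fun" :: (type, real_vector) real_vector
begin

definition scaleR_fun :: "real \<Rightarrow> ('a \<Rightarrow> 'b) \<Rightarrow> 'a \<Rightarrow> 'b" where
  "scaleR_fun r f = (\<lambda>x. r *\<^sub>R f x)"

instance
  by standard (auto simp: scaleR_fun_def plus_fun_def fun_eq_iff scaleR_add_right scaleR_add_left)

end

text \<open>A chart is a domain together with a coordinate map (whose values off the domain are irrelevant).\<close>

type_synonym ('a, 'e) chart = "'a set \<times> ('a \<Rightarrow> 'e)"

abbreviation chart_inv :: "('a, 'e) chart \<Rightarrow> 'e \<Rightarrow> 'a" where
  "chart_inv c \<equiv> inv_into (fst c) (snd c)"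

definition carrier :: "('a, 'e) chart set \<Rightarrow> 'a set" where
  "carrier A = (\<Union>c\<in>A. fst c)"

definition mfd_topology :: "('a, 'e::euclidean_space) chart set \<Rightarrow> 'a topology" where
  "mfd_topology A = topology (\<lambda>W. W \<subseteq> carrier A \<and> (\<forall>c\<in>A. open (snd c ` (W \<inter> fst c))))"

definition smooth_manifold :: "('a, 'e::euclidean_space) chart set \<Rightarrow> bool" where
  "smooth_manifold A \<longleftrightarrow>
     (\<forall>c\<in>A. inj_on (snd c) (fst c) \<and> open (snd c ` fst c)) \<and>
     (\<forall>c\<in>A. \<forall>d\<in>A. open (snd c ` (fst c \<inter> fst d)) \<and>
        smooth_on (snd d \<circ> chart_inv c) (snd c ` (fst c \<inter> fst d))) \<and>
     Hausdorff_space (mfd_topology A) \<and> second_countable (mfd_topology A)"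

definition oriented_manifold :: "('a, real ^ 'n) chart set \<Rightarrow> bool" where
  "oriented_manifold A \<longleftrightarrow> smooth_manifold A \<and>
     (\<forall>c\<in>A. \<forall>d\<in>A. \<forall>q\<in>fst c \<inter> fst d.
        det (matrix (frechet_derivative (snd d \<circ> chart_inv c) (at (snd c q)))) > 0)"

text \<open>A tangent vector at \<open>q\<close> is the family of its coordinate vectors in all charts around \<open>q\<close>,
  related by the derivatives of the coordinate changes; the value \<open>0\<close> at all other charts is a
  normalisation which makes the tangent space a linear subspace of a function space.\<close>

type_synonym ('a, 'e) tvec = "('a, 'e) chart \<Rightarrow> 'e"

definition tangent_space :: "('a, 'e::euclidean_space) chart set \<Rightarrow> 'a \<Rightarrow> ('a, 'e) tvec set" where
  "tangent_space A q =
     {X. (\<forall>c\<in>A. \<forall>d\<in>A. q \<in> fst c \<inter> fst d \<longrightarrow>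
            X d = frechet_derivative (snd d \<circ> chart_inv c) (at (snd c q)) (X c)) \<and>
         (\<forall>c. \<not> (c \<in> A \<and> q \<in> fst c) \<longrightarrow> X c = 0)}"

text \<open>The tangent vector at \<open>q\<close> whose coordinates in the chart \<open>c\<close> are \<open>u\<close>.\<close>

definition tvec_of ::
    "('a, 'e::euclidean_space) chart set \<Rightarrow> 'a \<Rightarrow> ('a, 'e) chart \<Rightarrow> 'e \<Rightarrow> ('a, 'e) tvec" where
  "tvec_of A q c u =
     (\<lambda>d. if d \<in> A \<and> q \<in> fst d
          then frechet_derivative (snd d \<circ> chart_inv c) (at (snd c q)) u else 0)"

text \<open>The notions below that use a chosen chart do not depend on the choice.\<close>

definition chart_at :: "('a, 'e) chart set \<Rightarrow> 'a \<Rightarrow> ('a, 'e) chart" where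
  "chart_at A q = (SOME c. c \<in> A \<and> q \<in> fst c)"

text \<open>Derivative \<open>dF\<^sub>q(X) = X(F)\<close> of a function with values in a vector space.\<close>

definition dderiv ::
    "('a, 'e::euclidean_space) chart set \<Rightarrow> ('a \<Rightarrow> 'b::real_normed_vector) \<Rightarrow> 'a \<Rightarrow> ('a, 'e) tvec \<Rightarrow> 'b" where
  "dderiv A F q X =
     (let c = chart_at A q in frechet_derivative (F \<circ> chart_inv c) (at (snd c q)) (X c))"

definition differential ::
    "('a, 'e::euclidean_space) chart set \<Rightarrow> ('b, 'f::euclidean_space) chart set \<Rightarrow>
     ('a \<Rightarrow> 'b) \<Rightarrow> 'a \<Rightarrow> ('a, 'e) tvec \<Rightarrow> ('b, 'f) tvec" where
  "differential A B F q X =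
     (let d = chart_at B (F q) in tvec_of B (F q) d (dderiv A (snd d \<circ> F) q X))"

definition smooth_map ::
    "('a, 'e::euclidean_space) chart set \<Rightarrow> ('b, 'f::euclidean_space) chart set \<Rightarrow> ('a \<Rightarrow> 'b) \<Rightarrow> bool" where
  "smooth_map A B F \<longleftrightarrow> continuous_map (mfd_topology A) (mfd_topology B) F \<and>
     (\<forall>c\<in>A. \<forall>d\<in>B. smooth_on (snd d \<circ> F \<circ> chart_inv c) (snd c ` (fst c \<inter> F -` fst d)))"

definition smooth_embedding ::
    "('a, 'e::euclidean_space) chart set \<Rightarrow> ('b, 'f::euclidean_space) chart set \<Rightarrow> ('a \<Rightarrow> 'b) \<Rightarrow> bool" where
  "smooth_embedding A B F \<longleftrightarrow> smooth_map A B F \<and>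
     (\<forall>q\<in>carrier A. inj_on (differential A B F q) (tangent_space A q)) \<and>
     embedding_map (mfd_topology A) (mfd_topology B) F"

definition smooth_fun :: "('a, 'e::euclidean_space) chart set \<Rightarrow> 'a set \<Rightarrow> ('a \<Rightarrow> real) \<Rightarrow> bool" where
  "smooth_fun A W f \<longleftrightarrow> (\<forall>c\<in>A. smooth_on (f \<circ> chart_inv c) (snd c ` (W \<inter> fst c)))"

definition smooth_vector_field ::
    "('a, 'e::euclidean_space) chart set \<Rightarrow> 'a set \<Rightarrow> ('a \<Rightarrow> ('a, 'e) tvec) \<Rightarrow> bool" where
  "smooth_vector_field A W Y \<longleftrightarrow> (\<forall>q\<in>W. Y q \<in> tangent_space A q) \<and>
     (\<forall>c\<in>A. smooth_on (\<lambda>a. Y (chart_inv c a) c) (snd c ` (W \<inter> fst c)))"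

definition smooth_field_along ::
    "('a, 'e::euclidean_space) chart set \<Rightarrow> ('b, 'f::euclidean_space) chart set \<Rightarrow>
     ('a \<Rightarrow> 'b) \<Rightarrow> ('a \<Rightarrow> ('b, 'f) tvec) \<Rightarrow> bool" where
  "smooth_field_along A B F Y \<longleftrightarrow> (\<forall>q\<in>carrier A. Y q \<in> tangent_space B (F q)) \<and>
     (\<forall>c\<in>A. \<forall>d\<in>B. smooth_on (\<lambda>a. Y (chart_inv c a) d) (snd c ` (fst c \<inter> F -` fst d)))"

text \<open>In the oriented atlas \<open>A\<close>, the frame \<open>e\<close> at \<open>q\<close> is positive. The order in which the index
  type is enumerated does not matter, as the same index type labels the coordinates.\<close>

definition positive_frame ::
    "('a, real ^ 'n) chart set \<Rightarrow> 'a \<Rightarrow> ('n \<Rightarrow> ('a, real ^ 'n) tvec) \<Rightarrow> bool" where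
  "positive_frame A q e \<longleftrightarrow> (\<forall>i. e i \<in> tangent_space A q) \<and>
     (\<forall>c\<in>A. q \<in> fst c \<longrightarrow> det (\<chi> i. e i c) > 0)"


section \<open>Levi-Civita connections and second fundamental forms\<close>

definition lie_bracket ::
    "('a, 'e::euclidean_space) chart set \<Rightarrow> ('a \<Rightarrow> ('a, 'e) tvec) \<Rightarrow> ('a \<Rightarrow> ('a, 'e) tvec) \<Rightarrow>
     'a \<Rightarrow> ('a, 'e) tvec" where
  "lie_bracket A X Y q =
     (let c = chart_at A q in
      tvec_of A q c (dderiv A (\<lambda>r. Y r c) q (X q) - dderiv A (\<lambda>r. X r c) q (Y q)))"

text \<open>A connection is given as \<open>D q v Y\<close>, the covariant derivative at \<open>q\<close>, in the direction of the
  tangent vector \<open>v\<close>, of a vector field \<open>Y\<close> which is smooth near \<open>q\<close>. Working with local vector fields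
  \<open>Y\<close> is the usual localised version of a connection on the global fields.\<close>

type_synonym ('a, 'e) conn = "'a \<Rightarrow> ('a, 'e) tvec \<Rightarrow> ('a \<Rightarrow> ('a, 'e) tvec) \<Rightarrow> ('a, 'e) tvec"

definition connection :: "('a, 'e::euclidean_space) chart set \<Rightarrow> ('a, 'e) conn \<Rightarrow> bool" where
  "connection A D \<longleftrightarrow> (\<forall>W. openin (mfd_topology A) W \<longrightarrow>
     (\<forall>X Y. smooth_vector_field A W X \<and> smooth_vector_field A W Y \<longrightarrow>
        smooth_vector_field A W (\<lambda>q. D q (X q) Y)) \<and>
     (\<forall>q\<in>W. \<forall>v\<in>tangent_space A q. \<forall>w\<in>tangent_space A q. \<forall>Y Z a f.
        smooth_vector_field A W Y \<and> smooth_vector_field A W Z \<and> smooth_fun A W f \<longrightarrow>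
          D q v Y \<in> tangent_space A q \<and>
          D q (v + w) Y = D q v Y + D q w Y \<and>
          D q (a *\<^sub>R v) Y = a *\<^sub>R D q v Y \<and>
          D q v (\<lambda>r. Y r + Z r) = D q v Y + D q v Z \<and>
          D q v (\<lambda>r. f r *\<^sub>R Y r) = dderiv A f q v *\<^sub>R Y q + f q *\<^sub>R D q v Y))"

type_synonym ('a, 'e) metric = "'a \<Rightarrow> ('a, 'e) tvec \<Rightarrow> ('a, 'e) tvec \<Rightarrow> real"

definition levi_civita ::
    "('a, 'e::euclidean_space) chart set \<Rightarrow> ('a, 'e) metric \<Rightarrow> ('a, 'e) conn \<Rightarrow> bool" where
  "levi_civita A g D \<longleftrightarrow> connection A D \<and>
     (\<forall>W X Y Z. openin (mfd_topology A) W \<and> smooth_vector_field A W X \<and>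
        smooth_vector_field A W Y \<and> smooth_vector_field A W Z \<longrightarrow>
        (\<forall>q\<in>W. D q (X q) Y - D q (Y q) X = lie_bracket A X Y q \<and>
           dderiv A (\<lambda>r. g r (Y r) (Z r)) q (X q) =
             g q (D q (X q) Y) (Z q) + g q (Y q) (D q (X q) Z)))"

text \<open>Covariant derivative, in the direction \<open>X\<close>, of a vector field \<open>Y\<close> along \<open>F\<close>: writing
  \<open>Y = \<Sum>\<^sub>i y\<^sup>i \<partial>\<^sub>i\<close> in a chart \<open>d\<close> around \<open>F q\<close>, it is
  \<open>\<Sum>\<^sub>i X(y\<^sup>i) \<partial>\<^sub>i + \<Sum>\<^sub>i y\<^sup>i(q) D\<^bsub>dF(X)\<^esub> \<partial>\<^sub>i\<close>. The second sum is the derivative of the field with constant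
  coordinates \<open>y(q)\<close>.\<close>

definition cov_along ::
    "('a, 'e::euclidean_space) chart set \<Rightarrow> ('b, 'f::euclidean_space) chart set \<Rightarrow> ('b, 'f) conn \<Rightarrow>
     ('a \<Rightarrow> 'b) \<Rightarrow> ('a \<Rightarrow> ('b, 'f) tvec) \<Rightarrow> 'a \<Rightarrow> ('a, 'e) tvec \<Rightarrow> ('b, 'f) tvec" where
  "cov_along A B D F Y q X =
     (let d = chart_at B (F q) in
      tvec_of B (F q) d (dderiv A (\<lambda>r. Y r d) q X)
      + D (F q) (differential A B F q X) (\<lambda>y. tvec_of B y d (Y q d)))"

definition pullback_metric ::
    "('a, 'e::euclidean_space) chart set \<Rightarrow> ('b, 'f::euclidean_space) chart set \<Rightarrow> ('b, 'f) metric \<Rightarrow>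
     ('a \<Rightarrow> 'b) \<Rightarrow> ('a, 'e) metric" where
  "pullback_metric A B g F q X Y = g (F q) (differential A B F q X) (differential A B F q Y)"

definition normal_part ::
    "('a, 'e::euclidean_space) chart set \<Rightarrow> ('b, 'f::euclidean_space) chart set \<Rightarrow> ('b, 'f) metric \<Rightarrow>
     ('a \<Rightarrow> 'b) \<Rightarrow> 'a \<Rightarrow> ('b, 'f) tvec \<Rightarrow> ('b, 'f) tvec" where
  "normal_part A B g F q Z =
     (THE N. N \<in> tangent_space B (F q) \<and>
        (\<forall>X\<in>tangent_space A q. g (F q) N (differential A B F q X) = 0) \<and>
        (\<exists>X\<in>tangent_space A q. Z - N = differential A B F q X))"

definition second_ff ::
    "('a, 'e::euclidean_space) chart set \<Rightarrow> ('b, 'f::euclidean_space) chart set \<Rightarrow> ('b, 'f) metric \<Rightarrow>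
     ('b, 'f) conn \<Rightarrow> ('a \<Rightarrow> 'b) \<Rightarrow> ('a \<Rightarrow> ('a, 'e) tvec) \<Rightarrow> ('a \<Rightarrow> ('a, 'e) tvec) \<Rightarrow> 'a \<Rightarrow> ('b, 'f) tvec" where
  "second_ff A B g D F V W q =
     normal_part A B g F q (cov_along A B D F (\<lambda>r. differential A B F r (W r)) q (V q))"

text \<open>The trace is computed with any local vector fields \<open>E\<^sub>1, \<dots>, E\<^sub>n\<close> that form an orthonormal basis at
  \<open>q\<close> (for the pull-back metric, supposed positive definite).\<close>

definition mean_curvature ::
    "('a, real ^ 'n) chart set \<Rightarrow> ('b, 'f::euclidean_space) chart set \<Rightarrow> ('b, 'f) metric \<Rightarrow>
     ('b, 'f) conn \<Rightarrow> ('a \<Rightarrow> 'b) \<Rightarrow> 'a \<Rightarrow> ('b, 'f) tvec" where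
  "mean_curvature A B g D F q =
     (THE H. \<forall>W. \<forall>E :: 'n \<Rightarrow> 'a \<Rightarrow> ('a, real ^ 'n) tvec.
        openin (mfd_topology A) W \<and> q \<in> W \<and> (\<forall>i. smooth_vector_field A W (E i)) \<and>
        (\<forall>i j. pullback_metric A B g F q (E i q) (E j q) = (if i = j then 1 else 0)) \<longrightarrow>
        H = (1 / real CARD('n)) *\<^sub>R (\<Sum>i\<in>UNIV. second_ff A B g D F (E i) (E i) q))"


section \<open>The hyperboloid model\<close>

text \<open>Minkowski space \<open>\<real>\<^bsup>n+1,1\<^esup>\<close>, with \<open>n = CARD('n)\<close>: the index type \<open>'n option\<close> has \<open>n + 1\<close> elements.\<close>

type_synonym 'n mink = "(real ^ ('n option)) \<times> real"

definition lor :: "'n::finite mink \<Rightarrow> 'n mink \<Rightarrow> real" where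
  "lor x y = fst x \<bullet> fst y - snd x * snd y"

definition hyp :: "'n::finite mink set" where
  "hyp = {x. lor x x = -1 \<and> snd x > 0}"

text \<open>The hyperboloid is a graph over its first \<open>n + 1\<close> coordinates, so that its smooth structure as a
  submanifold is given by one global chart. This chart also fixes the orientation.\<close>

definition hyp_atlas :: "('n::finite mink, real ^ ('n option)) chart set" where
  "hyp_atlas = {(hyp, fst)}"

type_synonym 'n hyp_tvec = "('n mink, real ^ ('n option)) tvec"

text \<open>The identification of the tangent space of the hyperboloid at \<open>x\<close> with \<open>{w. lor x w = 0}\<close>, by
  the derivative of the inclusion.\<close>

definition ambient :: "'n::finite mink \<Rightarrow> 'n hyp_tvec \<Rightarrow> 'n mink" where
  "ambient x X = dderiv hyp_atlas (\<lambda>y. y) x X"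

definition hyp_metric :: "('n::finite mink, real ^ ('n option)) metric" where
  "hyp_metric x X Y = lor (ambient x X) (ambient x Y)"

definition T1H :: "('n::finite mink \<times> 'n mink) set" where
  "T1H = {(x, v). x \<in> hyp \<and> lor x v = 0 \<and> lor v v = 1}"


section \<open>The space of oriented geodesics\<close>

definition flow :: "real \<Rightarrow> 'n::finite mink \<times> 'n mink \<Rightarrow> 'n mink \<times> 'n mink" where
  "flow t z = (cosh t *\<^sub>R fst z + sinh t *\<^sub>R snd z, sinh t *\<^sub>R fst z + cosh t *\<^sub>R snd z)"

text \<open>A maximal oriented unparametrized geodesic is encoded by the set of its unit velocity vectors,
  which is an orbit of the geodesic flow.\<close>

type_synonym 'n geodesic = "('n mink \<times> 'n mink) set"

definition geo_proj :: "'n::finite mink \<times> 'n mink \<Rightarrow> 'n geodesic" where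
  "geo_proj z = range (\<lambda>t. flow t z)"

text \<open>The maximal atlas of the smooth structure for which \<open>geo_proj\<close> is a principal bundle: in the
  charts \<open>(U, \<phi>)\<close>, \<open>geo_proj\<close> is smooth and has local smooth sections \<open>s\<close>.\<close>

definition geo_atlas :: "('n::finite geodesic, (real ^ 'n) \<times> (real ^ 'n)) chart set" where
  "geo_atlas = {(U, \<phi>). U \<subseteq> geo_proj ` T1H \<and> inj_on \<phi> U \<and> open (\<phi> ` U) \<and>
     openin (top_of_set T1H) (T1H \<inter> geo_proj -` U) \<and>
     smooth_within (\<phi> \<circ> geo_proj) (T1H \<inter> geo_proj -` U) \<and>
     (\<forall>a\<in>\<phi> ` U. \<exists>N s. open N \<and> a \<in> N \<and> N \<subseteq> \<phi> ` U \<and> smooth_on s N \<and>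
        (\<forall>b\<in>N. s b \<in> T1H \<and> geo_proj (s b) \<in> U \<and> \<phi> (geo_proj (s b)) = b))}"

type_synonym 'n geo_tvec = "('n geodesic, (real ^ 'n) \<times> (real ^ 'n)) tvec"

definition chi :: "'n::finite mink \<times> 'n mink \<Rightarrow> 'n mink \<times> 'n mink" where
  "chi z = (snd z, fst z)"

definition hv_space :: "'n::finite mink \<times> 'n mink \<Rightarrow> 'n mink set" where
  "hv_space z = {w. lor (fst z) w = 0 \<and> lor (snd z) w = 0}"

definition tangent_T1H :: "'n::finite mink \<times> 'n mink \<Rightarrow> ('n mink \<times> 'n mink) set" where
  "tangent_T1H z =
     {a *\<^sub>R chi z + (w, 0) + (0, u) | a w u. w \<in> hv_space z \<and> u \<in> hv_space z}"

text \<open>For \<open>\<xi> = a \<chi> + w\<^sup>H + u\<^sup>V\<close> at \<open>(x, v)\<close> we have \<open>\<xi> = (a v + w, a x + u)\<close>, and hence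
  \<open>a = lor (fst \<xi>) v\<close>, \<open>w = fst \<xi> - a v\<close>, \<open>u = snd \<xi> - a x\<close>.\<close>

definition para_sasaki ::
    "'n::finite mink \<times> 'n mink \<Rightarrow> 'n mink \<times> 'n mink \<Rightarrow> 'n mink \<times> 'n mink \<Rightarrow> real" where
  "para_sasaki z \<xi> \<eta> =
     (let a = lor (fst \<xi>) (snd z); b = lor (fst \<eta>) (snd z) in
      a * b + lor (fst \<xi> - a *\<^sub>R snd z) (fst \<eta> - b *\<^sub>R snd z)
            - lor (snd \<xi> - a *\<^sub>R fst z) (snd \<eta> - b *\<^sub>R fst z))"

definition chi_perp :: "'n::finite mink \<times> 'n mink \<Rightarrow> ('n mink \<times> 'n mink) set" where
  "chi_perp z = {\<xi> \<in> tangent_T1H z. para_sasaki z \<xi> (chi z) = 0}"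

text \<open>On \<open>chi_perp z\<close>, which consists of the pairs \<open>w\<^sup>H + u\<^sup>V = (w, u)\<close>, the tensor \<open>J\<close> is the swap.\<close>

definition para_J :: "'n::finite mink \<times> 'n mink \<Rightarrow> 'n mink \<times> 'n mink" where
  "para_J \<xi> = (snd \<xi>, fst \<xi>)"

text \<open>Derivatives within \<open>T1H\<close> are not unique, but their values on vectors tangent to \<open>T1H\<close> are.\<close>

definition d_geo_proj ::
    "'n::finite mink \<times> 'n mink \<Rightarrow> 'n mink \<times> 'n mink \<Rightarrow> 'n geo_tvec" where
  "d_geo_proj z \<xi> =
     (\<lambda>c. if c \<in> geo_atlas \<and> geo_proj z \<in> fst c
          then frechet_derivative (snd c \<circ> geo_proj) (at z within T1H) \<xi> else 0)"

definition horizontal_lift ::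
    "'n::finite mink \<times> 'n mink \<Rightarrow> 'n geo_tvec \<Rightarrow> 'n mink \<times> 'n mink" where
  "horizontal_lift z X = (THE \<xi>. \<xi> \<in> chi_perp z \<and> d_geo_proj z \<xi> = X)"

text \<open>By invariance under the flow, the choice of \<open>z\<close> on the geodesic does not matter.\<close>

definition geo_metric :: "('n::finite geodesic, (real ^ 'n) \<times> (real ^ 'n)) metric" where
  "geo_metric \<gamma> X Y =
     (let z = (SOME z. z \<in> \<gamma>) in para_sasaki z (horizontal_lift z X) (horizontal_lift z Y))"

definition geo_J :: "'n::finite geodesic \<Rightarrow> 'n geo_tvec \<Rightarrow> 'n geo_tvec" where
  "geo_J \<gamma> X = (let z = (SOME z. z \<in> \<gamma>) in d_geo_proj z (para_J (horizontal_lift z X)))"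

definition geo_Omega :: "'n::finite geodesic \<Rightarrow> 'n geo_tvec \<Rightarrow> 'n geo_tvec \<Rightarrow> real" where
  "geo_Omega \<gamma> X Y = geo_metric \<gamma> X (geo_J \<gamma> Y)"


section \<open>Hypersurfaces and their Gauss maps\<close>

text \<open>Orientation convention: if \<open>(e\<^sub>1, \<dots>, e\<^sub>n)\<close> is positive then so is
  \<open>(d\<sigma>(e\<^sub>1), \<dots>, d\<sigma>(e\<^sub>n), \<nu>)\<close>, where \<open>\<nu>\<close> has the index \<open>None\<close>.\<close>

definition unit_normal_field ::
    "('a, real ^ 'n::finite) chart set \<Rightarrow> ('a \<Rightarrow> 'n mink) \<Rightarrow> ('a \<Rightarrow> 'n hyp_tvec) \<Rightarrow> bool" where
  "unit_normal_field A \<sigma> \<nu> \<longleftrightarrow> smooth_field_along A hyp_atlas \<sigma> \<nu> \<and>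
     (\<forall>q\<in>carrier A. hyp_metric (\<sigma> q) (\<nu> q) (\<nu> q) = 1 \<and>
        (\<forall>X\<in>tangent_space A q. hyp_metric (\<sigma> q) (\<nu> q) (differential A hyp_atlas \<sigma> q X) = 0) \<and>
        (\<forall>e. positive_frame A q e \<longrightarrow>
           positive_frame hyp_atlas (\<sigma> q)
             (case_option (\<nu> q) (\<lambda>i. differential A hyp_atlas \<sigma> q (e i)))))"

definition gauss_map :: "('a \<Rightarrow> 'n::finite mink) \<Rightarrow> ('a \<Rightarrow> 'n hyp_tvec) \<Rightarrow> 'a \<Rightarrow> 'n geodesic" where
  "gauss_map \<sigma> \<nu> q = geo_proj (\<sigma> q, ambient (\<sigma> q) (\<nu> q))"

definition shape_operator ::
    "('a, real ^ 'n::finite) chart set \<Rightarrow> ('n mink, real ^ ('n option)) conn \<Rightarrow> ('a \<Rightarrow> 'n mink) \<Rightarrow>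
     ('a \<Rightarrow> 'n hyp_tvec) \<Rightarrow> 'a \<Rightarrow> ('a, real ^ 'n) tvec \<Rightarrow> ('a, real ^ 'n) tvec" where
  "shape_operator A D \<sigma> \<nu> q W =
     (THE U. U \<in> tangent_space A q \<and>
        differential A hyp_atlas \<sigma> q U = - cov_along A hyp_atlas D \<sigma> \<nu> q W)"

definition curvature_eigenspace ::
    "('a, real ^ 'n::finite) chart set \<Rightarrow> ('n mink, real ^ ('n option)) conn \<Rightarrow> ('a \<Rightarrow> 'n mink) \<Rightarrow>
     ('a \<Rightarrow> 'n hyp_tvec) \<Rightarrow> 'a \<Rightarrow> real \<Rightarrow> ('a, real ^ 'n) tvec set" where
  "curvature_eigenspace A D \<sigma> \<nu> q \<mu> =
     {W \<in> tangent_space A q. shape_operator A D \<sigma> \<nu> q W = \<mu> *\<^sub>R W}"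

definition principal_curvatures ::
    "('a, real ^ 'n::finite) chart set \<Rightarrow> ('n mink, real ^ ('n option)) conn \<Rightarrow> ('a \<Rightarrow> 'n mink) \<Rightarrow>
     ('a \<Rightarrow> 'n hyp_tvec) \<Rightarrow> 'a \<Rightarrow> real set" where
  "principal_curvatures A D \<sigma> \<nu> q = {\<mu>. \<exists>W\<in>curvature_eigenspace A D \<sigma> \<nu> q \<mu>. W \<noteq> 0}"

definition small_principal_curvatures ::
    "('a, real ^ 'n::finite) chart set \<Rightarrow> ('n mink, real ^ ('n option)) conn \<Rightarrow> ('a \<Rightarrow> 'n mink) \<Rightarrow>
     ('a \<Rightarrow> 'n hyp_tvec) \<Rightarrow> bool" where
  "small_principal_curvatures A D \<sigma> \<nu> \<longleftrightarrow>
     (\<forall>q\<in>carrier A. principal_curvatures A D \<sigma> \<nu> q \<subseteq> {-1<..<1})"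

text \<open>\<open>f\<^sub>\<sigma> = (artanh \<lambda>\<^sub>1 + \<dots> + artanh \<lambda>\<^sub>n) / n\<close>; each principal curvature occurs in the list
  \<open>\<lambda>\<^sub>1, \<dots>, \<lambda>\<^sub>n\<close> as often as its multiplicity says.\<close>

definition f_sigma ::
    "('a, real ^ 'n::finite) chart set \<Rightarrow> ('n mink, real ^ ('n option)) conn \<Rightarrow> ('a \<Rightarrow> 'n mink) \<Rightarrow>
     ('a \<Rightarrow> 'n hyp_tvec) \<Rightarrow> 'a \<Rightarrow> real" where
  "f_sigma A D \<sigma> \<nu> q = (1 / real CARD('n)) *
     (\<Sum>\<mu>\<in>principal_curvatures A D \<sigma> \<nu> q.
        real (dim (curvature_eigenspace A D \<sigma> \<nu> q \<mu>)) * artanh \<mu>)"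

end

theory Submission
  imports Defs
begin

text \<open>The lift \<open>\<zeta> = (\<sigma>, \<nu>)\<close> of the Gauss map to the unit tangent bundle is horizontal, and on horizontal
  vectors the para-Sasaki metric is the flat form
  \<open>Q((a, b), (c, d)) = \<langle>a, c\<rangle> - \<langle>b, d\<rangle>\<close> of the ambient space. If \<open>s\<close> is a local section of the projection
  to the space of geodesics that passes horizontally through \<open>\<zeta>(q)\<close>, the connection form of the
  geodesic flow enters the metric of the space of geodesics only quadratically, so the Koszul formula gives
  \<open>Q(D\<^sup>2s(u, w), Ds(k))\<close> for the Christoffel symbols at that point. Hence the second fundamental form of the Gauss map,
  paired with \<open>J dG(k)\<close>, is the cubic form
  \<open>C(u, w, k) = \<langle>D\<^sup>2\<sigma>(u, w), D\<nu>(k)\<rangle> - \<langle>D\<^sup>2\<nu>(u, w), D\<sigma>(k)\<rangle>\<close>. It is totally symmetric, because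
  \<open>\<langle>D\<sigma>(u), D\<nu>(w)\<rangle>\<close> is symmetric. On the other hand, \<open>f\<close> is \<open>1 / (4n)\<close> times the logarithm of the
  quotient of the Gram determinants of \<open>D(\<sigma> - \<nu>)\<close> and \<open>D(\<sigma> + \<nu>)\<close>; differentiating these at a
  point, in a basis of eigenvectors of the shape operator, yields \<open>1 / n\<close> times the trace of \<open>C\<close>.\<close>

section \<open>Smooth functions\<close>

text \<open>Principal curvatures need not be differentiable where they coincide, so
  \<open>f_sigma\<close> cannot be differentiated term by term. The Gram determinants are taken in a
  frame that stays fixed while the point moves, hence are smooth; passing to an eigenframe at the
  moving point multiplies both by the same square, which cancels in the quotient. As artanh x is
  half of ln ((1 + x) / (1 - x)) and the determinants contain the squares of 1 + \<lambda> and 1 -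
  \<lambda>, the factor is 1 / 4.

  No section of the geodesic projection is horizontal on an open set, since the curvature of the
  connection form is, up to sign, the nondegenerate form \<Omega>. One point is enough: the
  correction -2 \<alpha>(u) \<alpha>(w) to the flat form, with \<alpha> the connection form,
  vanishes there together with its first derivative.

  The second fundamental form and the mean curvature vector are definite descriptions, and a tangent
  space is trivial at a point without charts. Hence normal parts must be shown to exist uniquely,
  traces to be independent of the frame, and explicit charts to cover the space of
  geodesics.\<close>

abbreviation FD :: "('a::real_normed_vector \<Rightarrow> 'b::real_normed_vector) \<Rightarrow> 'a \<Rightarrow> 'a \<Rightarrow> 'b" where
  "FD f x \<equiv> frechet_derivative f (at x)"

abbreviation FD2 :: "('a::real_normed_vector \<Rightarrow> 'b::real_normed_vector) \<Rightarrow> 'a \<Rightarrow> 'a \<Rightarrow> 'a \<Rightarrow> 'b" where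
  "FD2 f x u w \<equiv> FD (\<lambda>y. FD f y w) x u"

lemma FD_eq: "(f has_derivative f') (at x) \<Longrightarrow> FD f x = f'"
  using frechet_derivative_at by metis

lemma FD_has_derivative: "f differentiable at x \<Longrightarrow> (f has_derivative FD f x) (at x)"
  by (simp add: frechet_derivative_works)

lemma FD_bounded_linear: "f differentiable at x \<Longrightarrow> bounded_linear (FD f x)"
  using FD_has_derivative has_derivative_bounded_linear by blast

text \<open>Differentiability is not assumed: the two functions have the same derivatives, if any,
  so the choice operator in \<open>frechet_derivative\<close> returns the same map for both.\<close>

lemma FD_cong:
  assumes "open S" "x \<in> S" "\<And>y. y \<in> S \<Longrightarrow> f y = g y"
  shows "FD f x = FD g x"
proof -
  have "(f has_derivative f') (at x) \<longleftrightarrow> (g has_derivative f') (at x)" for f'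
    using has_derivative_transform_within_open[of f f' x UNIV S g]
      has_derivative_transform_within_open[of g f' x UNIV S f] assms by auto
  then show ?thesis by (simp add: frechet_derivative_def)
qed

lemma differentiable_cong_open:
  assumes "open S" "x \<in> S" "\<And>y. y \<in> S \<Longrightarrow> f y = g y" "f differentiable at x"
  shows "g differentiable at x"
  using assms by (meson differentiable_def has_derivative_transform_within_open)

section \<open>Stability of the classes \<open>C_k_on\<close>\<close>

lemma C_k_on_cong:
  assumes "open S" "\<And>y. y \<in> S \<Longrightarrow> f y = g y" "C_k_on k f S"
  shows "C_k_on k g S"
  using assms(2,3)
proof (induction k arbitrary: f g)
  case 0
  then show ?case using continuous_on_cong by force
next
  case (Suc k)
  have "C_k_on k (\<lambda>x. FD g x v) S" for v
    by (rule Suc.IH[of "\<lambda>x. FD f x v"]) (use Suc.prems FD_cong[OF assms(1), of _ f g] in auto)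
  then show ?case
    using Suc.prems differentiable_cong_open[OF assms(1), of _ f g] by auto
qed

lemma C_k_on_subset: "C_k_on k f S \<Longrightarrow> T \<subseteq> S \<Longrightarrow> C_k_on k f T"
  by (induction k arbitrary: f) (auto intro: continuous_on_subset)

lemma C_k_on_SucD: "C_k_on (Suc k) f S \<Longrightarrow> C_k_on k f S"
proof (induction k arbitrary: f)
  case 0
  then show ?case
    by (auto intro!: continuous_at_imp_continuous_on differentiable_imp_continuous_within)
qed auto

lemma C_k_on_local:
  assumes "\<And>x. x \<in> S \<Longrightarrow> \<exists>N. open N \<and> x \<in> N \<and> C_k_on k f N"
  shows "C_k_on k f S"
  using assms
proof (induction k arbitrary: f)
  case 0
  have "continuous (at x) f" if "x \<in> S" for x
    using 0[OF that] by (auto simp: continuous_on_eq_continuous_at)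
  then show ?case by (simp add: continuous_at_imp_continuous_on)
next
  case (Suc k)
  have "C_k_on k (\<lambda>x. FD f x v) S" for v
    by (rule Suc.IH) (use Suc.prems in fastforce)
  moreover have "f differentiable at x" if "x \<in> S" for x
    using Suc.prems[OF that] by auto
  ultimately show ?case by simp
qed

lemma C_k_on_const: "C_k_on k (\<lambda>x. c) S"
  by (induction k arbitrary: c) auto

lemma C_k_on_bounded_linear: "bounded_linear f \<Longrightarrow> C_k_on k f S"
proof (cases k)
  case (Suc l)
  assume f: "bounded_linear f"
  have "(\<lambda>x. FD f x v) = (\<lambda>x. f v)" for v
    using FD_eq[OF bounded_linear_imp_has_derivative[OF f]] by auto
  then show ?thesis using f
    by (simp add: Suc C_k_on_const bounded_linear_imp_differentiable)
qed (simp add: linear_continuous_on)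

lemma C_k_on_linear_comp:
  "bounded_linear h \<Longrightarrow> C_k_on k f S \<Longrightarrow> open S \<Longrightarrow> C_k_on k (\<lambda>x. h (f x)) S"
proof (induction k arbitrary: f)
  case 0
  then show ?case
    by (simp add: bounded_linear.continuous_on)
next
  case (Suc k)
  have d: "((\<lambda>x. h (f x)) has_derivative (\<lambda>v. h (FD f x v))) (at x)" if "x \<in> S" for x
    using Suc.prems that by (auto intro!: bounded_linear.has_derivative[OF Suc.prems(1)] FD_has_derivative)
  have "C_k_on k (\<lambda>x. FD (\<lambda>x. h (f x)) x v) S" for v
    by (rule C_k_on_cong[OF Suc.prems(3), of "\<lambda>x. h (FD f x v)"])
      (use Suc d FD_eq in \<open>fastforce+\<close>)
  then show ?case using d by (auto simp: differentiable_def)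
qed

lemma C_k_on_add:
  "C_k_on k f S \<Longrightarrow> C_k_on k g S \<Longrightarrow> open S \<Longrightarrow> C_k_on k (\<lambda>x. f x + g x) S"
proof (induction k arbitrary: f g)
  case 0
  then show ?case by (simp add: continuous_on_add)
next
  case (Suc k)
  have d: "((\<lambda>x. f x + g x) has_derivative (\<lambda>v. FD f x v + FD g x v)) (at x)" if "x \<in> S" for x
    using Suc.prems that by (auto intro!: has_derivative_add FD_has_derivative)
  have "C_k_on k (\<lambda>x. FD (\<lambda>x. f x + g x) x v) S" for v
    by (rule C_k_on_cong[OF Suc.prems(3), of "\<lambda>x. FD f x v + FD g x v"])
      (use Suc d FD_eq in \<open>fastforce+\<close>)
  then show ?case using d by (auto simp: differentiable_def)
qed

lemma C_k_on_sum:
  assumes "\<And>i. i \<in> I \<Longrightarrow> C_k_on k (f i) S" "open S"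
  shows "C_k_on k (\<lambda>x. \<Sum>i\<in>I. f i x) S"
  using assms(1)
  by (induction I rule: infinite_finite_induct) (auto intro!: C_k_on_const C_k_on_add assms(2))

lemma C_k_on_bilinear:
  assumes b: "bounded_bilinear b"
  shows "C_k_on k f S \<Longrightarrow> C_k_on k g S \<Longrightarrow> open S \<Longrightarrow> C_k_on k (\<lambda>x. b (f x) (g x)) S"
proof (induction k arbitrary: f g)
  case 0
  then show ?case by (simp add: bounded_bilinear.continuous_on[OF b])
next
  case (Suc k)
  have d: "((\<lambda>x. b (f x) (g x)) has_derivative (\<lambda>v. b (f x) (FD g x v) + b (FD f x v) (g x))) (at x)"
    if "x \<in> S" for x
    using Suc.prems that by (auto intro!: bounded_bilinear.FDERIV[OF b] FD_has_derivative)
  have "C_k_on k (\<lambda>x. FD (\<lambda>x. b (f x) (g x)) x v) S" for v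
  proof (rule C_k_on_cong[OF Suc.prems(3)])
    have "C_k_on k f S" "C_k_on k g S" using Suc.prems C_k_on_SucD by blast+
    then show "C_k_on k (\<lambda>x. b (f x) (FD g x v) + b (FD f x v) (g x)) S"
      using Suc.prems by (intro C_k_on_add Suc.IH) auto
  qed (simp add: FD_eq[OF d])
  then show ?case using d by (auto simp: differentiable_def)
qed

lemma bounded_linear_sum_Basis:
  fixes f :: "'a::euclidean_space \<Rightarrow> 'b::real_normed_vector"
  assumes "bounded_linear f"
  shows "f x = (\<Sum>b\<in>Basis. (x \<bullet> b) *\<^sub>R f b)"
proof -
  interpret bounded_linear f by fact
  have "f x = f (\<Sum>b\<in>Basis. (x \<bullet> b) *\<^sub>R b)" by (simp add: euclidean_representation)
  then show ?thesis by (simp add: sum scaleR)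
qed

text \<open>\<open>C_k_on\<close> controls derivatives only in fixed directions, while the inner
  derivative \<open>FD f x v\<close> moves with x. A Euclidean middle space allows the chain rule to
  be expanded over \<open>Basis\<close> into finitely many products of functions of the right
  order.\<close>

lemma C_k_on_compose:
  fixes f :: "'a::real_normed_vector \<Rightarrow> 'b::euclidean_space"
  assumes S: "open S" and fS: "f ` S \<subseteq> T"
  shows "C_k_on k f S \<Longrightarrow> C_k_on k g T \<Longrightarrow> C_k_on k (\<lambda>x. g (f x)) S"
proof (induction k arbitrary: g)
  case 0
  then show ?case using continuous_on_compose2[of T g S f] fS by auto
next
  case (Suc k)
  have d: "((\<lambda>x. g (f x)) has_derivative (\<lambda>v. FD g (f x) (FD f x v))) (at x)"
    if "x \<in> S" for x
    using Suc.prems that fS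
    by (intro has_derivative_compose[of f "FD f x" x UNIV g]) (auto intro!: FD_has_derivative)
  have "C_k_on k (\<lambda>x. FD (\<lambda>x. g (f x)) x v) S" for v
  proof (rule C_k_on_cong[OF S])
    show "C_k_on k (\<lambda>x. \<Sum>b\<in>Basis. (FD f x v \<bullet> b) *\<^sub>R FD g (f x) b) S"
    proof (intro C_k_on_sum C_k_on_bilinear[OF bounded_bilinear_scaleR] S)
      show "C_k_on k (\<lambda>x. FD f x v \<bullet> b) S" for b
        by (rule C_k_on_linear_comp[of "\<lambda>y. y \<bullet> b"]) (use Suc.prems S in \<open>auto intro: bounded_linear_inner_left\<close>)
      show "C_k_on k (\<lambda>x. FD g (f x) b) S" for b
        by (rule Suc.IH) (use Suc.prems C_k_on_SucD in auto)
    qed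
    show "(\<Sum>b\<in>Basis. (FD f y v \<bullet> b) *\<^sub>R FD g (f y) b) = FD (\<lambda>x. g (f x)) y v" if "y \<in> S" for y
    proof -
      have "bounded_linear (FD g (f y))"
        using Suc.prems that fS by (intro FD_bounded_linear) auto
      from bounded_linear_sum_Basis[OF this, of "FD f y v"] show ?thesis
        using FD_eq[OF d[OF that]] by simp
    qed
  qed
  then show ?case using d by (auto simp: differentiable_def)
qed

section \<open>Elementary real functions\<close>

text \<open>Starts the induction on the order for \<open>inverse\<close>, \<open>sqrt\<close>,
  \<open>cosh\<close> and \<open>sinh\<close>, whose derivatives are expressed by the functions
  themselves.\<close>

lemma C_k_on_real_deriv:
  fixes h :: "real \<Rightarrow> real"
  assumes "open T" "\<And>x. x \<in> T \<Longrightarrow> (h has_real_derivative h' x) (at x)" "C_k_on k h' T"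
  shows "C_k_on (Suc k) h T"
proof -
  have d: "FD h x = (\<lambda>v. v * h' x)" if "x \<in> T" for x
    using FD_eq[of h _ x] assms(2)[OF that] by (auto simp: has_field_derivative_def mult.commute)
  have "C_k_on k (\<lambda>x. FD h x v) T" for v
    by (rule C_k_on_cong[OF assms(1), of "\<lambda>x. v * h' x"])
      (auto simp: d intro!: C_k_on_linear_comp[OF bounded_linear_mult_right assms(3,1)])
  then show ?thesis
    using assms(2) by (auto simp: has_field_derivative_def differentiable_def)
qed

lemma C_k_on_inverse: "C_k_on k (inverse :: real \<Rightarrow> real) (- {0})"
proof (induction k)
  case 0
  show ?case by (auto intro!: continuous_intros)
next
  case (Suc k)
  show ?case
  proof (rule C_k_on_real_deriv[where h' = "\<lambda>x. - (inverse x * inverse x)"])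
    show "(inverse has_real_derivative - (inverse x * inverse x)) (at x)" if "x \<in> - {0}" for x :: real
      using DERIV_inverse[of x UNIV] that by (simp add: power2_eq_square)
    have "C_k_on k (\<lambda>x::real. inverse x * inverse x) (- {0})"
      by (rule C_k_on_bilinear[OF bounded_bilinear_mult Suc Suc]) auto
    then show "C_k_on k (\<lambda>x::real. - (inverse x * inverse x)) (- {0})"
      by (rule C_k_on_linear_comp[OF bounded_linear_minus[OF bounded_linear_ident]]) auto
  qed auto
qed

lemma C_k_on_sqrt: "C_k_on k sqrt {0<..}"
proof (induction k)
  case 0
  show ?case by (auto intro!: continuous_intros)
next
  case (Suc k)
  show ?case
  proof (rule C_k_on_real_deriv[where h' = "\<lambda>x. inverse (sqrt x) * (1/2)"])
    show "(sqrt has_real_derivative inverse (sqrt x) * (1/2)) (at x)" if "x \<in> {0<..}" for x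
      using DERIV_real_sqrt[of x] that by simp
    have "C_k_on k (\<lambda>x. inverse (sqrt x)) {0<..}"
      by (rule C_k_on_compose[OF _ _ Suc C_k_on_inverse]) auto
    then show "C_k_on k (\<lambda>x. inverse (sqrt x) * (1/2)) {0<..}"
      by (rule C_k_on_linear_comp[OF bounded_linear_mult_left]) auto
  qed auto
qed

lemma C_k_on_cosh_sinh: "C_k_on k (cosh :: real \<Rightarrow> real) UNIV \<and> C_k_on k (sinh :: real \<Rightarrow> real) UNIV"
proof (induction k)
  case 0
  show ?case by (auto intro!: continuous_intros)
next
  case (Suc k)
  then show ?case
    by (auto intro!: C_k_on_real_deriv[where h = cosh and h' = sinh] C_k_on_real_deriv[where h = sinh and h' = cosh]
        derivative_eq_intros simp del: C_k_on.simps)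
qed

section \<open>Calculus of smooth maps\<close>

lemma smooth_onD: "smooth_on f S \<Longrightarrow> C_k_on k f S"
  by (simp add: smooth_on_def)

lemma smooth_on_differentiable: "smooth_on f S \<Longrightarrow> x \<in> S \<Longrightarrow> f differentiable at x"
  using smooth_onD[of f S 1] by simp

lemma smooth_on_continuous: "smooth_on f S \<Longrightarrow> continuous_on S f"
  using smooth_onD[of f S 0] by simp

lemma smooth_on_FD: "smooth_on f S \<Longrightarrow> smooth_on (\<lambda>x. FD f x v) S"
  unfolding smooth_on_def by (metis C_k_on.simps(2))

lemma smooth_on_cong:
  "open S \<Longrightarrow> (\<And>y. y \<in> S \<Longrightarrow> f y = g y) \<Longrightarrow> smooth_on f S \<Longrightarrow> smooth_on g S"
  using C_k_on_cong unfolding smooth_on_def by metis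

lemma smooth_on_subset: "smooth_on f S \<Longrightarrow> T \<subseteq> S \<Longrightarrow> smooth_on f T"
  unfolding smooth_on_def using C_k_on_subset by metis

lemma smooth_on_local:
  assumes "\<And>x. x \<in> S \<Longrightarrow> \<exists>N. open N \<and> x \<in> N \<and> smooth_on f N"
  shows "smooth_on f S"
  unfolding smooth_on_def
proof
  show "C_k_on k f S" for k
    by (rule C_k_on_local) (use assms smooth_onD in blast)
qed

lemma smooth_on_const: "smooth_on (\<lambda>x. c) S"
  by (simp add: smooth_on_def C_k_on_const)

lemma smooth_on_bounded_linear: "bounded_linear f \<Longrightarrow> smooth_on f S"
  by (simp add: smooth_on_def C_k_on_bounded_linear)

lemma smooth_on_id: "smooth_on (\<lambda>x. x) S"
  by (simp add: smooth_on_bounded_linear)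

lemma smooth_on_linear_comp:
  "bounded_linear h \<Longrightarrow> smooth_on f S \<Longrightarrow> open S \<Longrightarrow> smooth_on (\<lambda>x. h (f x)) S"
  by (simp add: smooth_on_def C_k_on_linear_comp)

lemma smooth_on_add:
  "smooth_on f S \<Longrightarrow> smooth_on g S \<Longrightarrow> open S \<Longrightarrow> smooth_on (\<lambda>x. f x + g x) S"
  by (simp add: smooth_on_def C_k_on_add)

lemma smooth_on_sum:
  "(\<And>i. i \<in> I \<Longrightarrow> smooth_on (f i) S) \<Longrightarrow> open S \<Longrightarrow> smooth_on (\<lambda>x. \<Sum>i\<in>I. f i x) S"
  by (simp add: smooth_on_def C_k_on_sum)

lemma smooth_on_minus: "smooth_on f S \<Longrightarrow> open S \<Longrightarrow> smooth_on (\<lambda>x. - f x) S"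
  by (rule smooth_on_linear_comp[OF bounded_linear_minus[OF bounded_linear_ident]])

lemma smooth_on_diff:
  "smooth_on f S \<Longrightarrow> smooth_on g S \<Longrightarrow> open S \<Longrightarrow> smooth_on (\<lambda>x. f x - g x) S"
  using smooth_on_add[OF _ smooth_on_minus, of f S g] by simp

lemma smooth_on_bilinear:
  "bounded_bilinear b \<Longrightarrow> smooth_on f S \<Longrightarrow> smooth_on g S \<Longrightarrow> open S \<Longrightarrow> smooth_on (\<lambda>x. b (f x) (g x)) S"
  by (simp add: smooth_on_def C_k_on_bilinear)

lemmas smooth_on_scaleR = smooth_on_bilinear[OF bounded_bilinear_scaleR]
lemmas smooth_on_mult = smooth_on_bilinear[OF bounded_bilinear_mult]
lemmas smooth_on_inner = smooth_on_bilinear[OF bounded_bilinear_inner]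

lemma smooth_on_compose:
  fixes f :: "'a::real_normed_vector \<Rightarrow> 'b::euclidean_space"
  shows "smooth_on f S \<Longrightarrow> smooth_on g T \<Longrightarrow> open S \<Longrightarrow> f ` S \<subseteq> T \<Longrightarrow> smooth_on (\<lambda>x. g (f x)) S"
  by (simp add: smooth_on_def C_k_on_compose)

lemma smooth_on_fst: "smooth_on f S \<Longrightarrow> open S \<Longrightarrow> smooth_on (\<lambda>x. fst (f x)) S"
  by (rule smooth_on_linear_comp[OF bounded_linear_fst])

lemma smooth_on_snd: "smooth_on f S \<Longrightarrow> open S \<Longrightarrow> smooth_on (\<lambda>x. snd (f x)) S"
  by (rule smooth_on_linear_comp[OF bounded_linear_snd])

lemma smooth_on_Pair:
  assumes "smooth_on f S" "smooth_on g S" "open S"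
  shows "smooth_on (\<lambda>x. (f x, g x)) S"
proof -
  have "smooth_on (\<lambda>x. (f x, 0) + (0, g x)) S"
    by (intro smooth_on_add smooth_on_linear_comp[where h = "\<lambda>y. (y, 0)"]
        smooth_on_linear_comp[where h = "\<lambda>y. (0, y)"] assms bounded_linear_Pair bounded_linear_ident bounded_linear_zero)
  then show ?thesis by simp
qed

lemma smooth_on_inverse:
  assumes "smooth_on f S" "open S" "\<And>x. x \<in> S \<Longrightarrow> f x \<noteq> 0"
  shows "smooth_on (\<lambda>x. inverse (f x) :: real) S"
  by (rule smooth_on_compose[OF assms(1) _ assms(2), where T = "- {0}"])
    (use assms(3) in \<open>auto simp: smooth_on_def C_k_on_inverse\<close>)

lemma smooth_on_divide:
  assumes "smooth_on f S" "smooth_on g S" "open S" "\<And>x. x \<in> S \<Longrightarrow> g x \<noteq> 0"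
  shows "smooth_on (\<lambda>x. f x / g x :: real) S"
  unfolding divide_inverse using assms by (intro smooth_on_mult smooth_on_inverse)

lemma smooth_on_sqrt:
  assumes "smooth_on f S" "open S" "\<And>x. x \<in> S \<Longrightarrow> f x > 0"
  shows "smooth_on (\<lambda>x. sqrt (f x)) S"
  by (rule smooth_on_compose[OF assms(1) _ assms(2), where T = "{0<..}"])
    (use assms(3) in \<open>auto simp: smooth_on_def C_k_on_sqrt\<close>)

lemma smooth_on_cosh: "smooth_on f S \<Longrightarrow> open S \<Longrightarrow> smooth_on (\<lambda>x. cosh (f x :: real)) S"
  by (erule smooth_on_compose[where T = UNIV]) (auto simp: smooth_on_def C_k_on_cosh_sinh)

lemma smooth_on_sinh: "smooth_on f S \<Longrightarrow> open S \<Longrightarrow> smooth_on (\<lambda>x. sinh (f x :: real)) S"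
  by (erule smooth_on_compose[where T = UNIV]) (auto simp: smooth_on_def C_k_on_cosh_sinh)

section \<open>Second derivatives and their symmetry\<close>

lemma smooth_on_FD_apply:
  fixes f :: "'a::euclidean_space \<Rightarrow> 'b::real_normed_vector"
  assumes f: "smooth_on f S" and g: "smooth_on g S" and S: "open S"
  shows "smooth_on (\<lambda>x. FD f x (g x)) S"
proof (rule smooth_on_cong[OF S])
  have "smooth_on (\<lambda>x. (g x \<bullet> b) *\<^sub>R FD f x b) S" for b
    by (rule smooth_on_scaleR[OF smooth_on_inner[OF g smooth_on_const S] smooth_on_FD[OF f] S])
  then show "smooth_on (\<lambda>x. \<Sum>b\<in>Basis. (g x \<bullet> b) *\<^sub>R FD f x b) S"
    by (rule smooth_on_sum[OF _ S])
  show "(\<Sum>b\<in>Basis. (g y \<bullet> b) *\<^sub>R FD f y b) = FD f y (g y)" if "y \<in> S" for y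
    by (rule bounded_linear_sum_Basis[OF FD_bounded_linear[OF smooth_on_differentiable[OF f that]], symmetric])
qed

text \<open>Product rule for a derivative taken at a moving point and applied to a moving vector. In
  coordinates this is how a vector field along a map is differentiated after being pushed into a
  vector space.\<close>

lemma FD_FD_apply:
  fixes f :: "'a::euclidean_space \<Rightarrow> 'b::real_normed_vector" and g :: "'c::real_normed_vector \<Rightarrow> 'a"
  assumes f: "smooth_on f S" and k: "k differentiable at x" "k x \<in> S"
    and S: "open S" and g: "g differentiable at x"
  shows "((\<lambda>y. FD f (k y) (g y)) has_derivative
           (\<lambda>u. FD2 f (k x) (FD k x u) (g x) + FD f (k x) (FD g x u))) (at x)"
proof -
  have lin: "bounded_linear (FD f y)" if "y \<in> S" for y
    using FD_bounded_linear[OF smooth_on_differentiable[OF f that]] .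
  have D: "((\<lambda>y. FD f y b) has_derivative (\<lambda>u. FD2 f y u b)) (at y)" if "y \<in> S" for y b
    using FD_has_derivative[OF smooth_on_differentiable[OF smooth_on_FD[OF f] that]] .
  have Dk: "((\<lambda>y. FD f (k y) b) has_derivative (\<lambda>u. FD2 f (k x) (FD k x u) b)) (at x)" for b
    using has_derivative_compose[OF FD_has_derivative[OF k(1)] D[OF k(2)]] by simp
  have "((\<lambda>y. \<Sum>b\<in>Basis. (g y \<bullet> b) *\<^sub>R FD f (k y) b) has_derivative
      (\<lambda>u. \<Sum>b\<in>Basis. (g x \<bullet> b) *\<^sub>R FD2 f (k x) (FD k x u) b + (FD g x u \<bullet> b) *\<^sub>R FD f (k x) b)) (at x)"
    by (intro has_derivative_sum has_derivative_scaleR has_derivative_inner_left FD_has_derivative g Dk)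
  moreover have "(\<Sum>b\<in>Basis. (FD g x u \<bullet> b) *\<^sub>R FD f (k x) b) = FD f (k x) (FD g x u)" for u
    by (rule bounded_linear_sum_Basis[OF lin[OF k(2)], symmetric])
  \<comment> \<open>Linearity of \<open>FD2\<close> in its second slot, obtained by differentiating
    the basis expansion.\<close>
  moreover have "(\<Sum>b\<in>Basis. (g x \<bullet> b) *\<^sub>R FD2 f (k x) v b) = FD2 f (k x) v (g x)" for v
  proof -
    have "((\<lambda>y. \<Sum>b\<in>Basis. (g x \<bullet> b) *\<^sub>R FD f y b) has_derivative
        (\<lambda>v. \<Sum>b\<in>Basis. (g x \<bullet> b) *\<^sub>R FD2 f (k x) v b)) (at (k x))"
      by (intro has_derivative_sum has_derivative_scaleR_right D k)
    then have "((\<lambda>y. FD f y (g x)) has_derivative (\<lambda>v. \<Sum>b\<in>Basis. (g x \<bullet> b) *\<^sub>R FD2 f (k x) v b)) (at (k x))"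
      by (rule has_derivative_transform_within_open[OF _ S k(2)])
        (rule bounded_linear_sum_Basis[OF lin, symmetric])
    from FD_eq[OF this] show ?thesis by (simp add: fun_eq_iff)
  qed
  ultimately have *: "((\<lambda>y. \<Sum>b\<in>Basis. (g y \<bullet> b) *\<^sub>R FD f (k y) b) has_derivative
      (\<lambda>u. FD2 f (k x) (FD k x u) (g x) + FD f (k x) (FD g x u))) (at x)"
    by (simp add: sum.distrib)
  have "continuous (at x) k" using k differentiable_imp_continuous_within by blast
  then obtain T where T: "open T" "x \<in> T" "\<And>y. y \<in> T \<Longrightarrow> k y \<in> S"
    using S k(2) unfolding continuous_at_open by metis
  show ?thesis
    by (rule has_derivative_transform_within_open[OF * T(1,2)])
      (rule bounded_linear_sum_Basis[OF lin[OF T(3)], symmetric])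
qed

text \<open>Two mean value theorems in succession: in s for the difference between t = h and t = 0,
  then in t. With the variables exchanged, the same second difference is expressed by the other
  mixed derivative.\<close>

lemma second_difference_mvt:
  fixes p q r :: "real \<Rightarrow> real \<Rightarrow> real"
  assumes h: "0 < h"
    and q: "\<And>s t. \<bar>s\<bar> \<le> h \<Longrightarrow> \<bar>t\<bar> \<le> h \<Longrightarrow> ((\<lambda>s. p s t) has_real_derivative q s t) (at s)"
    and r: "\<And>s t. \<bar>s\<bar> \<le> h \<Longrightarrow> \<bar>t\<bar> \<le> h \<Longrightarrow> ((\<lambda>t. q s t) has_real_derivative r s t) (at t)"
  shows "\<exists>s t. 0 < s \<and> s < h \<and> 0 < t \<and> t < h \<and> p h h - p h 0 - p 0 h + p 0 0 = h * h * r s t"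
proof -
  have "\<exists>s. 0 < s \<and> s < h \<and> (p h h - p h 0) - (p 0 h - p 0 0) = (h - 0) * (q s h - q s 0)"
    by (rule MVT2[where f = "\<lambda>s. p s h - p s 0"]) (use h q in \<open>auto intro!: DERIV_diff\<close>)
  then obtain s where s: "0 < s" "s < h" "(p h h - p h 0) - (p 0 h - p 0 0) = (h - 0) * (q s h - q s 0)"
    by blast
  have "\<exists>t. 0 < t \<and> t < h \<and> q s h - q s 0 = (h - 0) * r s t"
    by (rule MVT2) (use h r s in auto)
  then obtain t where t: "0 < t" "t < h" "q s h - q s 0 = (h - 0) * r s t"
    by blast
  have "p h h - p h 0 - p 0 h + p 0 0 = h * h * r s t"
    using s(3) unfolding t(3) by simp
  then show ?thesis using s t by blast
qed

text \<open>Both mixed derivatives, each at some point of a small square, equal the same second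
  difference divided by the square of h. By continuity each lies within e of its value at x, which
  is impossible if e is half the gap between these values.\<close>

lemma FD2_sym_real:
  fixes f :: "'a::real_normed_vector \<Rightarrow> real"
  assumes f: "smooth_on f S" and S: "open S" and x: "x \<in> S"
  shows "FD2 f x u w = FD2 f x w u"
proof (rule ccontr)
  assume ne: "FD2 f x u w \<noteq> FD2 f x w u"
  define e where "e = \<bar>FD2 f x u w - FD2 f x w u\<bar> / 2"
  have e: "e > 0" using ne by (simp add: e_def)
  have cont: "continuous_on S (\<lambda>y. FD2 f y a b)" for a b
    by (intro smooth_on_continuous smooth_on_FD f)
  obtain d1 where d1: "d1 > 0" "\<And>y. dist y x < d1 \<Longrightarrow> y \<in> S"
    using S x by (auto simp: open_dist)
  have "\<exists>d>0. \<forall>y. dist y x < d \<longrightarrow> \<bar>FD2 f y a b - FD2 f x a b\<bar> < e" for a b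
    using cont[where a = a and b = b] S x e by (auto simp: continuous_on_eq_continuous_at continuous_at_eps_delta dist_real_def)
  then obtain d2 d3 where d2: "d2 > 0" "\<And>y. dist y x < d2 \<Longrightarrow> \<bar>FD2 f y u w - FD2 f x u w\<bar> < e"
    and d3: "d3 > 0" "\<And>y. dist y x < d3 \<Longrightarrow> \<bar>FD2 f y w u - FD2 f x w u\<bar> < e"
    by metis
  define m where "m = min d1 (min d2 d3)"
  \<comment> \<open>The summand 1 keeps c positive even for u = w = 0; the choice h c = m / 2 keeps
    the whole square within distance m of x.\<close>
  define c where "c = norm u + norm w + 1"
  have c: "c > 0" by (simp add: c_def add_nonneg_pos)
  define h where "h = m / (2 * c)"
  have m: "m > 0" using d1 d2 d3 by (simp add: m_def)
  have h: "h > 0" using m c by (simp add: h_def)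
  have near: "dist (x + s *\<^sub>R u + t *\<^sub>R w) x < m" if "\<bar>s\<bar> \<le> h" "\<bar>t\<bar> \<le> h" for s t
  proof -
    have "dist (x + s *\<^sub>R u + t *\<^sub>R w) x \<le> \<bar>s\<bar> * norm u + \<bar>t\<bar> * norm w"
      using norm_triangle_ineq[of "s *\<^sub>R u" "t *\<^sub>R w"] by (simp add: dist_norm add.assoc)
    also have "\<dots> \<le> h * norm u + h * norm w" using that by (intro add_mono mult_right_mono) auto
    also have "\<dots> \<le> h * c" using h by (simp add: c_def algebra_simps)
    also have "\<dots> = m / 2"
      using c by (simp add: h_def)
    also have "\<dots> < m" using m by simp
    finally show ?thesis .
  qed
  have inS: "x + s *\<^sub>R u + t *\<^sub>R w \<in> S" if "\<bar>s\<bar> \<le> h" "\<bar>t\<bar> \<le> h" for s t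
    using near[OF that] d1 by (simp add: m_def)
  have line: "((\<lambda>r. g (y + r *\<^sub>R b)) has_real_derivative FD g (y + t *\<^sub>R b) b) (at t)"
    if "smooth_on g S" "y + t *\<^sub>R b \<in> S" for g :: "'a \<Rightarrow> real" and y b t
  proof -
    have D: "(g has_derivative FD g (y + t *\<^sub>R b)) (at (y + t *\<^sub>R b))"
      using FD_has_derivative smooth_on_differentiable that by blast
    have "((\<lambda>r. g (y + r *\<^sub>R b)) has_derivative (\<lambda>r. FD g (y + t *\<^sub>R b) (r *\<^sub>R b))) (at t)"
    proof (rule has_derivative_compose[of "\<lambda>r. y + r *\<^sub>R b" "\<lambda>r. r *\<^sub>R b" t UNIV g])
      show "((\<lambda>r. y + r *\<^sub>R b) has_derivative (\<lambda>r. r *\<^sub>R b)) (at t)"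
        by (auto intro!: derivative_eq_intros)
    qed (rule D)
    moreover have "FD g (y + t *\<^sub>R b) (r *\<^sub>R b) = FD g (y + t *\<^sub>R b) b * r" for r
      using linear_cmul[OF has_derivative_linear[OF D]] by simp
    ultimately show ?thesis by (simp add: has_field_derivative_def)
  qed
  have A: "\<exists>s t. 0 < s \<and> s < h \<and> 0 < t \<and> t < h \<and>
      f (x + h *\<^sub>R u + h *\<^sub>R w) - f (x + h *\<^sub>R u + 0 *\<^sub>R w) - f (x + 0 *\<^sub>R u + h *\<^sub>R w) + f (x + 0 *\<^sub>R u + 0 *\<^sub>R w)
        = h * h * FD2 f (x + s *\<^sub>R u + t *\<^sub>R w) w u"
  proof (rule second_difference_mvt[OF h, where p = "\<lambda>s t. f (x + s *\<^sub>R u + t *\<^sub>R w)"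
        and q = "\<lambda>s t. FD f (x + s *\<^sub>R u + t *\<^sub>R w) u"])
    fix s t assume st: "\<bar>s\<bar> \<le> h" "\<bar>t\<bar> \<le> h"
    show "((\<lambda>s. f (x + s *\<^sub>R u + t *\<^sub>R w)) has_real_derivative FD f (x + s *\<^sub>R u + t *\<^sub>R w) u) (at s)"
      using line[OF f, of "x + t *\<^sub>R w" s u] inS[OF st] by (simp add: add_ac)
    show "((\<lambda>t. FD f (x + s *\<^sub>R u + t *\<^sub>R w) u) has_real_derivative FD2 f (x + s *\<^sub>R u + t *\<^sub>R w) w u) (at t)"
      using line[OF smooth_on_FD[OF f], of "x + s *\<^sub>R u" t w] inS[OF st] by simp
  qed
  have B: "\<exists>t s. 0 < t \<and> t < h \<and> 0 < s \<and> s < h \<and>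
      f (x + h *\<^sub>R u + h *\<^sub>R w) - f (x + 0 *\<^sub>R u + h *\<^sub>R w) - f (x + h *\<^sub>R u + 0 *\<^sub>R w) + f (x + 0 *\<^sub>R u + 0 *\<^sub>R w)
        = h * h * FD2 f (x + s *\<^sub>R u + t *\<^sub>R w) u w"
  proof (rule second_difference_mvt[OF h, where p = "\<lambda>t s. f (x + s *\<^sub>R u + t *\<^sub>R w)"
        and q = "\<lambda>t s. FD f (x + s *\<^sub>R u + t *\<^sub>R w) w"])
    fix t s assume st: "\<bar>t\<bar> \<le> h" "\<bar>s\<bar> \<le> h"
    show "((\<lambda>t. f (x + s *\<^sub>R u + t *\<^sub>R w)) has_real_derivative FD f (x + s *\<^sub>R u + t *\<^sub>R w) w) (at t)"
      using line[OF f, of "x + s *\<^sub>R u" t w] inS[OF st(2,1)] by simp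
    show "((\<lambda>s. FD f (x + s *\<^sub>R u + t *\<^sub>R w) w) has_real_derivative FD2 f (x + s *\<^sub>R u + t *\<^sub>R w) u w) (at s)"
      using line[OF smooth_on_FD[OF f], of "x + t *\<^sub>R w" s u] inS[OF st(2,1)] by (simp add: add_ac)
  qed
  from A obtain s t where st: "0 < s" "s < h" "0 < t" "t < h"
    "f (x + h *\<^sub>R u + h *\<^sub>R w) - f (x + h *\<^sub>R u) - f (x + h *\<^sub>R w) + f x = h * h * FD2 f (x + s *\<^sub>R u + t *\<^sub>R w) w u"
    by auto
  from B obtain s' t' where st': "0 < s'" "s' < h" "0 < t'" "t' < h"
    "f (x + h *\<^sub>R u + h *\<^sub>R w) - f (x + h *\<^sub>R w) - f (x + h *\<^sub>R u) + f x = h * h * FD2 f (x + s' *\<^sub>R u + t' *\<^sub>R w) u w"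
    by auto
  have "FD2 f (x + s *\<^sub>R u + t *\<^sub>R w) w u = FD2 f (x + s' *\<^sub>R u + t' *\<^sub>R w) u w"
  proof -
    have "h * h * FD2 f (x + s *\<^sub>R u + t *\<^sub>R w) w u = h * h * FD2 f (x + s' *\<^sub>R u + t' *\<^sub>R w) u w"
      using st(5) st'(5) by linarith
    then show ?thesis using h by simp
  qed
  moreover have "\<bar>FD2 f (x + s *\<^sub>R u + t *\<^sub>R w) w u - FD2 f x w u\<bar> < e"
    using d3(2) near[of s t] st by (simp add: m_def)
  moreover have "\<bar>FD2 f (x + s' *\<^sub>R u + t' *\<^sub>R w) u w - FD2 f x u w\<bar> < e"
    using d2(2) near[of s' t'] st' by (simp add: m_def)
  ultimately show False unfolding e_def by (simp add: abs_if split: if_splits)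
qed

lemma FD2_sym:
  fixes f :: "'a::real_normed_vector \<Rightarrow> 'b::euclidean_space"
  assumes f: "smooth_on f S" and S: "open S" and x: "x \<in> S"
  shows "FD2 f x u w = FD2 f x w u"
proof (rule euclidean_eqI)
  fix b :: 'b assume "b \<in> Basis"
  have D: "FD (\<lambda>x. g x \<bullet> b) y v = FD g y v \<bullet> b" if "smooth_on g S" "y \<in> S" for g :: "'a \<Rightarrow> 'b" and y v
  proof -
    have "((\<lambda>x. g x \<bullet> b) has_derivative (\<lambda>v. FD g y v \<bullet> b)) (at y)"
      by (rule has_derivative_inner_left[OF FD_has_derivative[OF smooth_on_differentiable[OF that]]])
    from FD_eq[OF this] show ?thesis by simp
  qed
  have "FD2 (\<lambda>x. f x \<bullet> b) x u w = FD2 f x u w \<bullet> b" for u w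
    using FD_cong[OF S x, of "\<lambda>y. FD (\<lambda>x. f x \<bullet> b) y w" "\<lambda>y. FD f y w \<bullet> b"]
    by (simp add: D[OF f] D[OF smooth_on_FD[OF f] x])
  moreover have "smooth_on (\<lambda>x. f x \<bullet> b) S"
    by (rule smooth_on_inner[OF f smooth_on_const S])
  ultimately show "FD2 f x u w \<bullet> b = FD2 f x w u \<bullet> b"
    using FD2_sym_real[of "\<lambda>x. f x \<bullet> b" S x u w] S x by simp
qed

section \<open>Atlases and Levi-Civita connections\<close>

text \<open>The chart conditions shared by the given manifold, the hyperboloid and the space of
  geodesics.\<close>

locale smooth_atlas =
  fixes A :: "('a, 'e::euclidean_space) chart set"
  assumes chart_inj: "c \<in> A \<Longrightarrow> inj_on (snd c) (fst c)"
    and chart_open: "c \<in> A \<Longrightarrow> open (snd c ` fst c)"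
    and overlap_open: "c \<in> A \<Longrightarrow> d \<in> A \<Longrightarrow> open (snd c ` (fst c \<inter> fst d))"
    and overlap_smooth: "c \<in> A \<Longrightarrow> d \<in> A \<Longrightarrow>
      smooth_on (\<lambda>y. snd d (chart_inv c y)) (snd c ` (fst c \<inter> fst d))"
begin

lemma chart_inv_eq [simp]: "c \<in> A \<Longrightarrow> q \<in> fst c \<Longrightarrow> chart_inv c (snd c q) = q"
  by (simp add: chart_inj)

lemma chart_inv_in: "y \<in> snd c ` fst c \<Longrightarrow> chart_inv c y \<in> fst c"
  by (simp add: inv_into_into)

lemma chart_eq_inv: "y \<in> snd c ` fst c \<Longrightarrow> snd c (chart_inv c y) = y"
  by (simp add: f_inv_into_f)

lemma trans_has_derivative:
  assumes "c \<in> A" "d \<in> A" "q \<in> fst c" "q \<in> fst d"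
  shows "((\<lambda>y. snd d (chart_inv c y)) has_derivative FD (\<lambda>y. snd d (chart_inv c y)) (snd c q)) (at (snd c q))"
  by (rule FD_has_derivative[OF smooth_on_differentiable[OF overlap_smooth[OF assms(1,2)]]]) (use assms in auto)

lemma trans_linear:
  assumes "c \<in> A" "d \<in> A" "q \<in> fst c" "q \<in> fst d"
  shows "linear (FD (\<lambda>y. snd d (chart_inv c y)) (snd c q))"
  by (rule has_derivative_linear[OF trans_has_derivative[OF assms]])

text \<open>Independence of the chart for \<open>dderiv\<close> and the cocycle rule for coordinate
  changes both come from this chain rule.\<close>

lemma trans_comp:
  fixes F :: "'a \<Rightarrow> 'b::real_normed_vector"
  assumes c: "c \<in> A" and d: "d \<in> A" and q: "q \<in> fst c" "q \<in> fst d"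
    and F: "(\<lambda>y. F (chart_inv d y)) differentiable at (snd d q)"
  shows "((\<lambda>y. F (chart_inv c y)) has_derivative
    (\<lambda>u. FD (\<lambda>y. F (chart_inv d y)) (snd d q) (FD (\<lambda>y. snd d (chart_inv c y)) (snd c q) u))) (at (snd c q))"
proof -
  have F': "((\<lambda>y. F (chart_inv d y)) has_derivative FD (\<lambda>y. F (chart_inv d y)) (snd d q))
      (at (snd d (chart_inv c (snd c q))))"
    using FD_has_derivative[OF F] c q by simp
  have "((\<lambda>y. F (chart_inv d (snd d (chart_inv c y)))) has_derivative
    (\<lambda>u. FD (\<lambda>y. F (chart_inv d y)) (snd d q) (FD (\<lambda>y. snd d (chart_inv c y)) (snd c q) u))) (at (snd c q))"
    by (rule has_derivative_compose[OF trans_has_derivative[OF c d q] F'])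
  then show ?thesis
    by (rule has_derivative_transform_within_open[OF _ overlap_open[OF c d]]) (use c d q in auto)
qed

lemma trans_self:
  assumes c: "c \<in> A" and q: "q \<in> fst c"
  shows "FD (\<lambda>y. snd c (chart_inv c y)) (snd c q) = (\<lambda>u. u)"
proof -
  have "FD (\<lambda>y. snd c (chart_inv c y)) (snd c q) = FD (\<lambda>y. y) (snd c q)"
    by (rule FD_cong[OF chart_open[OF c]]) (use c q in auto)
  then show ?thesis by simp
qed

lemma trans_cocycle:
  assumes "c \<in> A" "d \<in> A" "e \<in> A" "q \<in> fst c" "q \<in> fst d" "q \<in> fst e"
  shows "FD (\<lambda>y. snd e (chart_inv d y)) (snd d q) (FD (\<lambda>y. snd d (chart_inv c y)) (snd c q) u)
    = FD (\<lambda>y. snd e (chart_inv c y)) (snd c q) u"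
proof -
  have "(\<lambda>y. snd e (chart_inv d y)) differentiable at (snd d q)"
    using trans_has_derivative[OF assms(2,3,5,6)] by (auto simp: differentiable_def)
  from FD_eq[OF trans_comp[OF assms(1,2,4,5) this]] show ?thesis by simp
qed

section \<open>Tangent vectors as families of coordinate vectors\<close>

lemma tangent_spaceD:
  assumes "X \<in> tangent_space A q" "c \<in> A" "d \<in> A" "q \<in> fst c" "q \<in> fst d"
  shows "X d = FD (\<lambda>y. snd d (chart_inv c y)) (snd c q) (X c)"
  using assms unfolding tangent_space_def comp_def by blast

lemma tangent_spaceI:
  assumes "\<And>c d. c \<in> A \<Longrightarrow> d \<in> A \<Longrightarrow> q \<in> fst c \<Longrightarrow> q \<in> fst d \<Longrightarrow> X d = FD (\<lambda>y. snd d (chart_inv c y)) (snd c q) (X c)"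
    and "\<And>c. \<not> (c \<in> A \<and> q \<in> fst c) \<Longrightarrow> X c = 0"
  shows "X \<in> tangent_space A q"
  unfolding tangent_space_def comp_def mem_Collect_eq
proof (rule conjI; intro ballI allI impI)
  fix c d assume "c \<in> A" "d \<in> A" "q \<in> fst c \<inter> fst d"
  then show "X d = FD (\<lambda>y. snd d (chart_inv c y)) (snd c q) (X c)" by (intro assms(1)) auto
qed (rule assms(2))

lemma tangent_space_zero: "X \<in> tangent_space A q \<Longrightarrow> \<not> (c \<in> A \<and> q \<in> fst c) \<Longrightarrow> X c = 0"
  unfolding tangent_space_def by blast

lemma tvec_of_apply: "tvec_of A q c u d =
    (if d \<in> A \<and> q \<in> fst d then FD (\<lambda>y. snd d (chart_inv c y)) (snd c q) u else 0)"
  by (simp add: tvec_of_def comp_def)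

lemma tvec_of_in: "c \<in> A \<Longrightarrow> q \<in> fst c \<Longrightarrow> tvec_of A q c u \<in> tangent_space A q"
  by (rule tangent_spaceI) (auto simp: tvec_of_apply trans_cocycle)

lemma tvec_of_same [simp]: "c \<in> A \<Longrightarrow> q \<in> fst c \<Longrightarrow> tvec_of A q c u c = u"
  by (simp add: tvec_of_apply trans_self)

text \<open>One coordinate vector determines the others through the coordinate changes, and the
  normalisation fixes the value at all remaining charts.\<close>

lemma tangent_eqI:
  assumes "X \<in> tangent_space A q" "Y \<in> tangent_space A q" "c \<in> A" "q \<in> fst c" "X c = Y c"
  shows "X = Y"
proof
  fix d
  show "X d = Y d"
  proof (cases "d \<in> A \<and> q \<in> fst d")
    case True
    then show ?thesis using tangent_spaceD[of _ q c d] assms by metis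
  next
    case False
    then show ?thesis using assms(1,2) tangent_space_zero by metis
  qed
qed

lemma tvec_of_coord [simp]:
  "X \<in> tangent_space A q \<Longrightarrow> c \<in> A \<Longrightarrow> q \<in> fst c \<Longrightarrow> tvec_of A q c (X c) = X"
  by (rule tangent_eqI[of _ q _ c]) (auto simp: tvec_of_in)

lemma tangent_subspace: "subspace (tangent_space A q)"
proof (rule subspaceI)
  show "0 \<in> tangent_space A q"
    by (rule tangent_spaceI) (auto simp: linear_0[OF trans_linear])
  show "X + Y \<in> tangent_space A q" if "X \<in> tangent_space A q" "Y \<in> tangent_space A q" for X Y
  proof (rule tangent_spaceI)
    show "(X + Y) d = FD (\<lambda>y. snd d (chart_inv c y)) (snd c q) ((X + Y) c)"
      if "c \<in> A" "d \<in> A" "q \<in> fst c" "q \<in> fst d" for c d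
      using tangent_spaceD[OF \<open>X \<in> _\<close> that] tangent_spaceD[OF \<open>Y \<in> _\<close> that]
      by (simp add: plus_fun_def linear_add[OF trans_linear[OF that]])
    show "\<not> (c \<in> A \<and> q \<in> fst c) \<Longrightarrow> (X + Y) c = 0" for c
      using tangent_space_zero[OF \<open>X \<in> _\<close>] tangent_space_zero[OF \<open>Y \<in> _\<close>]
      by (simp add: plus_fun_def)
  qed
  show "r *\<^sub>R X \<in> tangent_space A q" if "X \<in> tangent_space A q" for r X
  proof (rule tangent_spaceI)
    show "(r *\<^sub>R X) d = FD (\<lambda>y. snd d (chart_inv c y)) (snd c q) ((r *\<^sub>R X) c)"
      if "c \<in> A" "d \<in> A" "q \<in> fst c" "q \<in> fst d" for c d
      using tangent_spaceD[OF \<open>X \<in> _\<close> that]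
      by (simp add: scaleR_fun_def linear_cmul[OF trans_linear[OF that]])
    show "\<not> (c \<in> A \<and> q \<in> fst c) \<Longrightarrow> (r *\<^sub>R X) c = 0" for c
      using tangent_space_zero[OF \<open>X \<in> _\<close>] by (simp add: scaleR_fun_def)
  qed
qed

lemma tvec_of_linear:
  assumes "c \<in> A" "q \<in> fst c"
  shows "linear (tvec_of A q c)"
proof (rule linearI)
  show "tvec_of A q c (u + w) = tvec_of A q c u + tvec_of A q c w" for u w
    by (rule tangent_eqI[of _ q _ c])
      (use assms subspace_add[OF tangent_subspace] tvec_of_in in \<open>auto simp: plus_fun_def\<close>)
  show "tvec_of A q c (r *\<^sub>R u) = r *\<^sub>R tvec_of A q c u" for r u
    by (rule tangent_eqI[of _ q _ c])
      (use assms subspace_scale[OF tangent_subspace] tvec_of_in in \<open>auto simp: scaleR_fun_def\<close>)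
qed

lemma chart_at:
  assumes "q \<in> carrier A"
  shows "chart_at A q \<in> A" "q \<in> fst (chart_at A q)"
proof -
  have "\<exists>c. c \<in> A \<and> q \<in> fst c" using assms by (auto simp: carrier_def)
  from someI_ex[OF this] show "chart_at A q \<in> A" "q \<in> fst (chart_at A q)"
    by (auto simp: chart_at_def)
qed

lemma carrierI: "c \<in> A \<Longrightarrow> q \<in> fst c \<Longrightarrow> q \<in> carrier A"
  by (auto simp: carrier_def)

lemma dderiv_chart:
  fixes F :: "'a \<Rightarrow> 'b::real_normed_vector"
  assumes c: "c \<in> A" and q: "q \<in> fst c" and X: "X \<in> tangent_space A q"
    and F: "(\<lambda>y. F (chart_inv c y)) differentiable at (snd c q)"
  shows "dderiv A F q X = FD (\<lambda>y. F (chart_inv c y)) (snd c q) (X c)"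
proof -
  let ?e = "chart_at A q"
  have e: "?e \<in> A" "q \<in> fst ?e" using chart_at[OF carrierI[OF c q]] by simp_all
  show ?thesis
    using FD_eq[OF trans_comp[OF e(1) c e(2) q F]] tangent_spaceD[OF X e(1) c e(2) q]
    by (simp add: dderiv_def Let_def comp_def)
qed

section \<open>The topology defined by an atlas\<close>

lemma istopology_mfd: "istopology (\<lambda>W. W \<subseteq> carrier A \<and> (\<forall>c\<in>A. open (snd c ` (W \<inter> fst c))))"
  unfolding istopology_def
proof (rule conjI; intro allI impI)
  fix S T assume S: "S \<subseteq> carrier A \<and> (\<forall>c\<in>A. open (snd c ` (S \<inter> fst c)))"
    and T: "T \<subseteq> carrier A \<and> (\<forall>c\<in>A. open (snd c ` (T \<inter> fst c)))"
  show "S \<inter> T \<subseteq> carrier A \<and> (\<forall>c\<in>A. open (snd c ` (S \<inter> T \<inter> fst c)))"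
  proof (intro conjI ballI)
    fix c assume c: "c \<in> A"
    have "snd c ` (S \<inter> T \<inter> fst c) = snd c ` ((S \<inter> fst c) \<inter> (T \<inter> fst c))"
      by (rule arg_cong[where f = "\<lambda>M. snd c ` M"]) auto
    also have "\<dots> = snd c ` (S \<inter> fst c) \<inter> snd c ` (T \<inter> fst c)"
      by (rule inj_on_image_Int[OF chart_inj[OF c]]) auto
    finally show "open (snd c ` (S \<inter> T \<inter> fst c))" using S T c by auto
  qed (use S in auto)
next
  fix K assume K: "\<forall>S\<in>K. S \<subseteq> carrier A \<and> (\<forall>c\<in>A. open (snd c ` (S \<inter> fst c)))"
  show "\<Union> K \<subseteq> carrier A \<and> (\<forall>c\<in>A. open (snd c ` (\<Union> K \<inter> fst c)))"
  proof (intro conjI ballI)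
    show "\<Union> K \<subseteq> carrier A" using K by auto
    fix c assume "c \<in> A"
    then have "open (\<Union>S\<in>K. snd c ` (S \<inter> fst c))" using K by auto
    moreover have "(\<Union>S\<in>K. snd c ` (S \<inter> fst c)) = snd c ` (\<Union> K \<inter> fst c)" by auto
    ultimately show "open (snd c ` (\<Union> K \<inter> fst c))" by simp
  qed
qed

lemma openin_mfd:
  "openin (mfd_topology A) W \<longleftrightarrow> W \<subseteq> carrier A \<and> (\<forall>c\<in>A. open (snd c ` (W \<inter> fst c)))"
  unfolding mfd_topology_def using istopology_mfd by (simp add: topology_inverse')

lemma openin_chart: "c \<in> A \<Longrightarrow> openin (mfd_topology A) (fst c)"
  using overlap_open by (auto simp: openin_mfd carrier_def Int_commute)

text \<open>The fields with constant coordinates in \<open>c\<close> serve as test fields for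
  connections, because their Lie brackets vanish.\<close>

lemma smooth_vector_field_const:
  assumes c: "c \<in> A"
  shows "smooth_vector_field A (fst c) (\<lambda>y. tvec_of A y c u)"
  unfolding smooth_vector_field_def
proof (intro conjI ballI)
  show "tvec_of A q c u \<in> tangent_space A q" if "q \<in> fst c" for q
    by (rule tvec_of_in[OF c that])
  fix d assume d: "d \<in> A"
  have tr: "smooth_on (\<lambda>y. snd c (chart_inv d y)) (snd d ` (fst c \<inter> fst d))"
    using overlap_smooth[OF d c] by (simp add: Int_commute)
  have op: "open (snd d ` (fst c \<inter> fst d))" using overlap_open[OF d c] by (simp add: Int_commute)
  have "smooth_on (\<lambda>a. FD (\<lambda>y. snd d (chart_inv c y)) (snd c (chart_inv d a)) u) (snd d ` (fst c \<inter> fst d))"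
    by (rule smooth_on_compose[OF tr smooth_on_FD[OF overlap_smooth[OF c d], of u] op]) (use d in auto)
  then show "smooth_on (\<lambda>a. tvec_of A (chart_inv d a) c u d) (snd d ` (fst c \<inter> fst d))"
    by (rule smooth_on_cong[OF op, rotated]) (use d in \<open>auto simp: tvec_of_apply\<close>)
qed

end

lemma smooth_manifold_atlas: "smooth_manifold A \<Longrightarrow> smooth_atlas A"
  by unfold_locales (simp_all add: smooth_manifold_def comp_def)

section \<open>Differentials in a pair of charts\<close>

text \<open>A local form of smoothness in one pair of charts. It allows the differential of the
  Gauss map to be computed near a chosen point.\<close>

definition smooth_rep :: "('a, 'e::euclidean_space) chart \<Rightarrow> ('b, 'f::euclidean_space) chart \<Rightarrow>
    ('a \<Rightarrow> 'b) \<Rightarrow> 'e set \<Rightarrow> bool" where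
  "smooth_rep c d F N \<longleftrightarrow> open N \<and> N \<subseteq> snd c ` fst c \<and> (\<forall>y\<in>N. F (chart_inv c y) \<in> fst d) \<and>
     smooth_on (\<lambda>y. snd d (F (chart_inv c y))) N"

locale atlas_pair = A: smooth_atlas A + B: smooth_atlas B
  for A :: "('a, 'e::euclidean_space) chart set" and B :: "('b, 'f::euclidean_space) chart set"
begin

lemma smooth_rep_in: "c \<in> A \<Longrightarrow> q \<in> fst c \<Longrightarrow> smooth_rep c d F N \<Longrightarrow> snd c q \<in> N \<Longrightarrow> F q \<in> fst d"
  unfolding smooth_rep_def by (drule (1) A.chart_inv_eq) auto

lemma smooth_rep_has_derivative:
  assumes "smooth_rep c d F N" "y \<in> N"
  shows "((\<lambda>y. snd d (F (chart_inv c y))) has_derivative FD (\<lambda>y. snd d (F (chart_inv c y))) y) (at y)"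
  by (rule FD_has_derivative[OF smooth_on_differentiable[OF _ assms(2)]])
    (use assms in \<open>simp add: smooth_rep_def\<close>)

lemma differential_chart:
  assumes c: "c \<in> A" "q \<in> fst c" and d: "d \<in> B" and X: "X \<in> tangent_space A q"
    and F: "smooth_rep c d F N" "snd c q \<in> N"
  shows "differential A B F q X = tvec_of B (F q) d (FD (\<lambda>y. snd d (F (chart_inv c y))) (snd c q) (X c))"
proof -
  let ?d = "chart_at B (F q)"
  have Fq: "F q \<in> fst d" by (rule smooth_rep_in[OF c F])
  have d': "?d \<in> B" "F q \<in> fst ?d" using B.chart_at[OF B.carrierI[OF d Fq]] by simp_all
  have D: "((\<lambda>y. snd d (F (chart_inv c y))) has_derivative FD (\<lambda>y. snd d (F (chart_inv c y))) (snd c q)) (at (snd c q))"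
    by (rule smooth_rep_has_derivative[OF F])
  have D': "((\<lambda>y. snd ?d (chart_inv d y)) has_derivative FD (\<lambda>y. snd ?d (chart_inv d y)) (snd d (F q)))
      (at (snd d (F (chart_inv c (snd c q)))))"
    using B.trans_has_derivative[OF d d'(1) Fq d'(2)] c by simp
  have "((\<lambda>y. snd ?d (F (chart_inv c y))) has_derivative
    (\<lambda>u. FD (\<lambda>y. snd ?d (chart_inv d y)) (snd d (F q)) (FD (\<lambda>y. snd d (F (chart_inv c y))) (snd c q) u))) (at (snd c q))"
    by (rule has_derivative_transform_within_open[OF has_derivative_compose[OF D D'], of N])
      (use F d in \<open>auto simp: smooth_rep_def\<close>)
  from FD_eq[OF this] this have "dderiv A (snd ?d \<circ> F) q X =
      FD (\<lambda>y. snd ?d (chart_inv d y)) (snd d (F q)) (FD (\<lambda>y. snd d (F (chart_inv c y))) (snd c q) (X c))"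
    using A.dderiv_chart[OF c X, of "snd ?d \<circ> F"] by (auto simp: differentiable_def)
  moreover have "FD (\<lambda>y. snd ?d (chart_inv d y)) (snd d (F q)) u = tvec_of B (F q) d u ?d" for u
    using d' by (simp add: B.tvec_of_apply)
  ultimately show ?thesis
    using B.tvec_of_in[OF d Fq] d' by (simp add: differential_def Let_def)
qed

lemma differential_in:
  assumes c: "c \<in> A" "q \<in> fst c" and d: "d \<in> B" and X: "X \<in> tangent_space A q"
    and F: "smooth_rep c d F N" "snd c q \<in> N"
  shows "differential A B F q X \<in> tangent_space B (F q)"
    "differential A B F q X d = FD (\<lambda>y. snd d (F (chart_inv c y))) (snd c q) (X c)"
proof -
  have "F q \<in> fst d" by (rule smooth_rep_in[OF c F])
  then show "differential A B F q X \<in> tangent_space B (F q)"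
    "differential A B F q X d = FD (\<lambda>y. snd d (F (chart_inv c y))) (snd c q) (X c)"
    using d by (simp_all add: differential_chart[OF assms] B.tvec_of_in)
qed

end

section \<open>The Koszul formula at a point\<close>

lemma connection_in:
  assumes "connection A D" "openin (mfd_topology A) W" "smooth_vector_field A W Y"
    and "q \<in> W" "v \<in> tangent_space A q"
  shows "D q v Y \<in> tangent_space A q"
proof -
  \<comment> \<open>The rules in \<open>connection\<close> form one implication whose premise
    mentions a smooth function, so one has to be supplied.\<close>
  have "smooth_fun A W (\<lambda>_. 0)"
    by (simp add: smooth_fun_def comp_def smooth_on_const)
  with assms(1)[unfolded connection_def, rule_format, OF assms(2), THEN conjunct2, rule_format,
      OF assms(4,5,5), of Y Y] assms(3)
  show ?thesis by blast
qed

lemma levi_civita_rules: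
  assumes "levi_civita A g D" "openin (mfd_topology A) W" "smooth_vector_field A W X"
    "smooth_vector_field A W Y" "smooth_vector_field A W Z" "q \<in> W"
  shows "D q (X q) Y - D q (Y q) X = lie_bracket A X Y q"
    "dderiv A (\<lambda>r. g r (Y r) (Z r)) q (X q) = g q (D q (X q) Y) (Z q) + g q (Y q) (D q (X q) Z)"
proof -
  have "openin (mfd_topology A) W \<and> smooth_vector_field A W X \<and>
        smooth_vector_field A W Y \<and> smooth_vector_field A W Z" using assms by simp
  from assms(1)[unfolded levi_civita_def, THEN conjunct2, rule_format, OF this assms(6)]
  show "D q (X q) Y - D q (Y q) X = lie_bracket A X Y q"
    "dderiv A (\<lambda>r. g r (Y r) (Z r)) q (X q) = g q (D q (X q) Y) (Z q) + g q (Y q) (D q (X q) Z)"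
    by simp_all
qed

text \<open>What the Koszul formula needs at p: a map \<open>s\<close> from coordinates to a vector
  space with a symmetric bilinear form Q whose pull-back agrees with g to first order at
  \<open>y0\<close>. For the hyperboloid, \<open>s\<close> is the inclusion and the agreement holds
  everywhere; for the space of geodesics, \<open>s\<close> is a section that is horizontal at
  \<open>y0\<close>. The chart is \<open>chart_at B p\<close> because \<open>cov_along\<close> and
  \<open>lie_bracket\<close> use that one.\<close>

locale lc_jet = smooth_atlas B
  for B :: "('b, 'f::euclidean_space) chart set" +
  fixes g :: "('b, 'f) metric" and D :: "('b, 'f) conn" and p :: 'b
    and s :: "'f \<Rightarrow> 'v::euclidean_space" and Q :: "'v \<Rightarrow> 'v \<Rightarrow> real" and N :: "'f set"
    and d :: "('b, 'f) chart" and y0 :: 'f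
  assumes d_def: "d = chart_at B p" and y0_def: "y0 = snd d p"
    and lc: "levi_civita B g D" and p: "p \<in> carrier B"
    and N: "open N" "y0 \<in> N" and s: "smooth_on s N"
    and Q: "bounded_bilinear Q" "\<And>x y. Q x y = Q y x"
    and g_sym: "\<And>X Y. X \<in> tangent_space B p \<Longrightarrow> Y \<in> tangent_space B p \<Longrightarrow> g p X Y = g p Y X"
    and g_add: "\<And>X Y Z. X \<in> tangent_space B p \<Longrightarrow> Y \<in> tangent_space B p \<Longrightarrow> Z \<in> tangent_space B p \<Longrightarrow>
      g p (X + Y) Z = g p X Z + g p Y Z"
    and g_at: "\<And>u w. g p (tvec_of B p d u) (tvec_of B p d w) = Q (FD s y0 u) (FD s y0 w)"
    and g_deriv: "\<And>u w. ((\<lambda>y. g (chart_inv d y) (tvec_of B (chart_inv d y) d u) (tvec_of B (chart_inv d y) d w))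
      has_derivative (\<lambda>k. Q (FD2 s y0 k u) (FD s y0 w) + Q (FD s y0 u) (FD2 s y0 k w))) (at y0)"
begin

lemma d: "d \<in> B" "p \<in> fst d"
  unfolding d_def using chart_at[OF p] by simp_all

definition "const u = (\<lambda>y. tvec_of B y d u)"

lemma const_p: "const u p = tvec_of B p d u"
  by (simp add: const_def)

lemma const_smooth: "smooth_vector_field B (fst d) (const u)"
  unfolding const_def by (rule smooth_vector_field_const[OF d(1)])

lemma const_in: "const u p \<in> tangent_space B p"
  unfolding const_def by (rule tvec_of_in[OF d])

lemma D_in: "v \<in> tangent_space B p \<Longrightarrow> D p v (const w) \<in> tangent_space B p"
  using connection_in[OF _ openin_chart[OF d(1)] const_smooth d(2)] lc unfolding levi_civita_def by blast

text \<open>Vanishing torsion, applied to coordinate fields: their coordinates are constant, so they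
  commute.\<close>

lemma D_sym: "D p (const u p) (const w) = D p (const w p) (const u)"
proof -
  have "dderiv B (\<lambda>r. const w r d) p X = 0" for w X
  proof -
    have "FD (\<lambda>y. const w (chart_inv d y) d) (snd d p) = FD (\<lambda>_. w) (snd d p)"
      by (rule FD_cong[OF chart_open[OF d(1)]]) (use d in \<open>auto simp: const_def\<close>)
    then show ?thesis by (simp add: dderiv_def Let_def comp_def flip: d_def)
  qed
  then have "lie_bracket B (const u) (const w) p = 0"
    using linear_0[OF tvec_of_linear[OF d]] by (simp add: lie_bracket_def Let_def flip: d_def)
  moreover have "D p (const u p) (const w) - D p (const w p) (const u) = lie_bracket B (const u) (const w) p"
    by (rule levi_civita_rules(1)[OF lc openin_chart[OF d(1)] const_smooth const_smooth const_smooth d(2)])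
  ultimately show ?thesis by simp
qed

lemma D_metric:
  "Q (FD2 s y0 k u) (FD s y0 w) + Q (FD s y0 u) (FD2 s y0 k w) =
    g p (D p (const k p) (const u)) (const w p) + g p (const u p) (D p (const k p) (const w))"
proof -
  have "dderiv B (\<lambda>r. g r (const u r) (const w r)) p (const k p) =
      g p (D p (const k p) (const u)) (const w p) + g p (const u p) (D p (const k p) (const w))"
    by (rule levi_civita_rules(2)[OF lc openin_chart[OF d(1)] const_smooth const_smooth const_smooth d(2)])
  moreover have "dderiv B (\<lambda>r. g r (const u r) (const w r)) p (const k p) =
      Q (FD2 s y0 k u) (FD s y0 w) + Q (FD s y0 u) (FD2 s y0 k w)"
    using FD_eq[OF g_deriv[of u w]] d by (simp add: dderiv_def Let_def comp_def const_def y0_def flip: d_def)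
  ultimately show ?thesis by simp
qed

text \<open>Metric compatibility for differentiation along u and along w is added, that along k is
  subtracted. Symmetry of second derivatives and of Q cancels everything on the right except twice
  the stated term.\<close>

lemma koszul:
  "g p (D p (const u p) (const w)) (const k p) = Q (FD2 s y0 u w) (FD s y0 k)"
proof -
  have sym2: "FD2 s y0 a b = FD2 s y0 b a" for a b
    by (rule FD2_sym[OF s N])
  have "g p (D p (const u p) (const w)) (const k p) + g p (const w p) (D p (const u p) (const k)) =
      Q (FD2 s y0 u w) (FD s y0 k) + Q (FD s y0 w) (FD2 s y0 u k)"
    by (rule D_metric[symmetric])
  moreover have "g p (D p (const u p) (const w)) (const k p) + g p (const u p) (D p (const w p) (const k)) =
      Q (FD2 s y0 u w) (FD s y0 k) + Q (FD s y0 u) (FD2 s y0 w k)"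
    using D_metric[where k = w and u = u and w = k] unfolding D_sym[of w u] sym2[where a = w and b = u] by simp
  moreover have "g p (D p (const u p) (const k)) (const w p) + g p (const u p) (D p (const w p) (const k)) =
      Q (FD2 s y0 u k) (FD s y0 w) + Q (FD s y0 u) (FD2 s y0 w k)"
    using D_metric[where k = k and u = u and w = w] unfolding D_sym[of k u] D_sym[of k w] sym2[where a = k and b = u]
      sym2[where a = k and b = w] by simp
  moreover have "g p (D p (const u p) (const k)) (const w p) = g p (const w p) (D p (const u p) (const k))"
    using g_sym D_in const_in by blast
  ultimately show ?thesis using Q(2)[of "FD2 s y0 u k"] by simp
qed

end

locale lc_jet_along = atlas_pair A B + lc_jet B g D p s Q N d y0
  for A :: "('a, 'e::euclidean_space) chart set" and B :: "('b, 'f::euclidean_space) chart set"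
    and g D p and s :: "'f \<Rightarrow> 'v::euclidean_space" and Q N d y0 +
  fixes F :: "'a \<Rightarrow> 'b" and c :: "('a, 'e) chart" and q :: 'a and M :: "'e set"
  assumes c: "c \<in> A" "q \<in> fst c" and Fq: "F q = p"
    and F: "smooth_rep c d F M" "snd c q \<in> M"
begin

lemma cov_along_eq:
  assumes X: "X \<in> tangent_space A q"
    and Y: "(\<lambda>a. Y (chart_inv c a) d) differentiable at (snd c q)"
  shows "cov_along A B D F Y q X = tvec_of B p d (FD (\<lambda>a. Y (chart_inv c a) d) (snd c q) (X c)) +
    D p (const (FD (\<lambda>y. snd d (F (chart_inv c y))) (snd c q) (X c)) p) (const (Y q d))"
  using A.dderiv_chart[OF c X Y] differential_chart[OF c d(1) X F] Fq
  by (simp add: cov_along_def Let_def const_def flip: d_def)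

lemma cov_along_in:
  assumes X: "X \<in> tangent_space A q"
    and Y: "(\<lambda>a. Y (chart_inv c a) d) differentiable at (snd c q)"
  shows "cov_along A B D F Y q X \<in> tangent_space B p"
  unfolding cov_along_eq[where Y = Y, OF assms]
  by (intro subspace_add[OF B.tangent_subspace] B.tvec_of_in d D_in const_in)

text \<open>The classical rule for submanifolds: differentiate in the ambient vector space, then
  project. It is expressed through pairings, so no projection has to be constructed.\<close>

lemma cov_along_metric:
  assumes X: "X \<in> tangent_space A q" and Z: "Z \<in> tangent_space B p"
    and Y: "(\<lambda>a. Y (chart_inv c a) d) differentiable at (snd c q)"
  shows "g p (cov_along A B D F Y q X) Z =
    Q (FD (\<lambda>a. FD s (snd d (F (chart_inv c a))) (Y (chart_inv c a) d)) (snd c q) (X c)) (FD s y0 (Z d))"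
proof -
  let ?F = "\<lambda>y. snd d (F (chart_inv c y))" and ?Y = "\<lambda>a. Y (chart_inv c a) d"
  have F': "?F differentiable at (snd c q)"
    using smooth_rep_has_derivative[OF F] by (auto simp: differentiable_def)
  have y0: "?F (snd c q) = y0" using c Fq by (simp add: y0_def)
  have "FD (\<lambda>a. FD s (?F a) (?Y a)) (snd c q) (X c) =
      FD2 s y0 (FD ?F (snd c q) (X c)) (Y q d) + FD s y0 (FD ?Y (snd c q) (X c))"
    using FD_eq[OF FD_FD_apply[OF s F' _ N(1) Y]] N y0 c by simp
  moreover have "g p (cov_along A B D F Y q X) Z =
      Q (FD2 s y0 (FD ?F (snd c q) (X c)) (Y q d)) (FD s y0 (Z d)) +
      Q (FD s y0 (FD ?Y (snd c q) (X c))) (FD s y0 (Z d))"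
    using g_add[OF B.tvec_of_in[OF d] D_in[OF const_in] Z]
      g_at[where w = "Z d"] koszul[where k = "Z d"] Z d
    by (simp add: cov_along_eq[where Y = Y, OF X Y] const_p)
  ultimately show ?thesis
    by (simp add: bounded_bilinear.add_left[OF Q(1)])
qed

end

section \<open>Bilinear forms\<close>

lemma bounded_bilinear_diff:
  fixes b b' :: "'a::real_normed_vector \<Rightarrow> 'a \<Rightarrow> real"
  assumes "bounded_bilinear b" "bounded_bilinear b'"
  shows "bounded_bilinear (\<lambda>x y. b x y - b' x y)"
proof -
  interpret b: bounded_bilinear b by fact
  interpret b': bounded_bilinear b' by fact
  obtain K K' where K: "\<And>x y. norm (b x y) \<le> norm x * norm y * K" "\<And>x y. norm (b' x y) \<le> norm x * norm y * K'"
    using b.bounded b'.bounded by blast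
  have "norm (b x y - b' x y) \<le> norm x * norm y * (K + K')" for x y
    using norm_triangle_ineq4[of "b x y" "b' x y"] K[of x y] by (simp add: algebra_simps)
  then show ?thesis
    by (intro bounded_bilinear.intro exI[of _ "K + K'"] allI)
      (auto simp: b.add_left b.add_right b'.add_left b'.add_right b.scaleR_left b.scaleR_right
        b'.scaleR_left b'.scaleR_right algebra_simps)
qed

text \<open>Only \<open>b y y \<noteq> 0\<close> is asked for, not definiteness, so that the lemma
  covers the Lorentz form with its timelike vectors.\<close>

lemma orthogonal_independent:
  fixes b :: "'v::real_vector \<Rightarrow> 'v \<Rightarrow> real"
  assumes lin: "\<And>y. linear (b y)" and fin: "finite B"
    and nz: "\<And>y. y \<in> B \<Longrightarrow> b y y \<noteq> 0" and orth: "\<And>x y. x \<in> B \<Longrightarrow> y \<in> B \<Longrightarrow> x \<noteq> y \<Longrightarrow> b x y = 0"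
  shows "independent B"
proof (rule independent_if_scalars_zero[OF fin])
  fix f y assume 0: "(\<Sum>x\<in>B. f x *\<^sub>R x) = 0" and y: "y \<in> B"
  have "0 = b y (\<Sum>x\<in>B. f x *\<^sub>R x)" using linear_0[OF lin] 0 by simp
  also have "\<dots> = (\<Sum>x\<in>B. f x * b y x)"
    by (simp add: linear_sum[OF lin] linear_cmul[OF lin])
  also have "\<dots> = (\<Sum>x\<in>B. if x = y then f y * b y y else 0)"
    by (rule sum.cong) (use orth y in auto)
  also have "\<dots> = f y * b y y" using fin y by simp
  finally show "f y = 0" using nz[OF y] by simp
qed

lemma orthogonal_spans:
  fixes b :: "'v::euclidean_space \<Rightarrow> 'v \<Rightarrow> real"
  assumes "\<And>y. linear (b y)" "finite B" "card B = DIM('v)"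
    and "\<And>y. y \<in> B \<Longrightarrow> b y y \<noteq> 0" "\<And>x y. x \<in> B \<Longrightarrow> y \<in> B \<Longrightarrow> x \<noteq> y \<Longrightarrow> b x y = 0"
  shows "span B = UNIV"
proof -
  have "independent B" by (rule orthogonal_independent[OF assms(1,2,4,5)])
  then have "UNIV \<subseteq> span B"
    using card_ge_dim_independent[of B UNIV] assms(3) by simp
  then show ?thesis by auto
qed

lemma linear_left: "bounded_bilinear b \<Longrightarrow> linear (\<lambda>x. b x y)"
  by (simp add: bounded_bilinear.bounded_linear_left bounded_linear.linear)

lemma linear_right: "bounded_bilinear b \<Longrightarrow> linear (b y)"
  using bounded_bilinear.bounded_linear_right[of b y] by (simp add: bounded_linear.linear)

lemma bilinear_double_sum:
  fixes b :: "'v::real_normed_vector \<Rightarrow> 'v \<Rightarrow> real"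
  assumes b: "bounded_bilinear b"
  shows "b (\<Sum>i\<in>I. x i *\<^sub>R e i) (\<Sum>j\<in>J. y j *\<^sub>R e j) = (\<Sum>i\<in>I. \<Sum>j\<in>J. x i * y j * b (e i) (e j))"
proof -
  have "b (\<Sum>i\<in>I. x i *\<^sub>R e i) z = (\<Sum>i\<in>I. x i * b (e i) z)" for z
    by (simp add: linear_sum[OF linear_left[OF b]] linear_cmul[OF linear_left[OF b]])
  note left = this
  have "b z (\<Sum>j\<in>J. y j *\<^sub>R e j) = (\<Sum>j\<in>J. y j * b z (e j))" for z
    by (simp add: linear_sum[OF linear_right[OF b]] linear_cmul[OF linear_right[OF b]])
  note right = this
  show ?thesis
    by (subst left, subst right) (simp add: sum_distrib_left mult.assoc)
qed

section \<open>Orthonormal frames and traces\<close>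

definition orthonormal_frame :: "(real ^ 'n \<Rightarrow> real ^ 'n \<Rightarrow> real) \<Rightarrow> ('n::finite \<Rightarrow> real ^ 'n) \<Rightarrow> bool" where
  "orthonormal_frame g e \<longleftrightarrow> (\<forall>i j. g (e i) (e j) = (if i = j then 1 else 0))"

lemma orthonormal_frame_inj: "orthonormal_frame g e \<Longrightarrow> inj e"
  unfolding orthonormal_frame_def inj_def by (metis zero_neq_one)

lemma orthonormal_frame_span:
  fixes e :: "'n::finite \<Rightarrow> real ^ 'n"
  assumes g: "bounded_bilinear g" and e: "orthonormal_frame g e"
  shows "span (range e) = UNIV"
  by (rule orthogonal_spans[of g])
    (use e linear_right[OF g] in \<open>auto simp: orthonormal_frame_def card_image[OF orthonormal_frame_inj[OF e]]\<close>)

lemma orthonormal_frame_expand: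
  fixes e :: "'n::finite \<Rightarrow> real ^ 'n"
  assumes g: "bounded_bilinear g" and e: "orthonormal_frame g e"
  shows "w = (\<Sum>i\<in>UNIV. g (e i) w *\<^sub>R e i)"
proof -
  note lin = linear_right[OF g]
  let ?f = "\<lambda>w. \<Sum>i\<in>UNIV. g (e i) w *\<^sub>R e i"
  have "linear ?f"
    by (rule linearI) (simp_all add: linear_add[OF lin] linear_cmul[OF lin] scaleR_add_left
        sum.distrib scaleR_sum_right)
  moreover have "e j = ?f (e j)" for j
  proof -
    have "?f (e j) = (\<Sum>i\<in>UNIV. if i = j then e j else 0)"
      by (rule sum.cong) (use e in \<open>auto simp: orthonormal_frame_def\<close>)
    then show ?thesis by simp
  qed
  ultimately show ?thesis
    using linear_eq_on_span[OF linear_ident, of ?f "range e" w] orthonormal_frame_span[OF assms] by blast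
qed

text \<open>The coefficients between two orthonormal frames form an orthogonal matrix. This is what
  makes the trace in \<open>mean_curvature\<close> independent of the chosen fields.\<close>

lemma orthonormal_trace:
  fixes e e' :: "'n::finite \<Rightarrow> real ^ 'n"
  assumes g: "bounded_bilinear g" "\<And>x y. g x y = g y x"
    and e: "orthonormal_frame g e" and e': "orthonormal_frame g e'"
    and T: "bounded_bilinear (T :: real ^ 'n \<Rightarrow> real ^ 'n \<Rightarrow> real)"
  shows "(\<Sum>i\<in>UNIV. T (e' i) (e' i)) = (\<Sum>i\<in>UNIV. T (e i) (e i))"
proof -
  define a where "a i j = g (e j) (e' i)" for i j
  have ex: "e' i = (\<Sum>j\<in>UNIV. a i j *\<^sub>R e j)" for i
    unfolding a_def by (rule orthonormal_frame_expand[OF g(1) e])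
  have "T (e' i) (e' i) = (\<Sum>j\<in>UNIV. \<Sum>k\<in>UNIV. a i j * a i k * T (e j) (e k))" for i
    by (subst (1 2) ex) (rule bilinear_double_sum[OF T])
  then have "(\<Sum>i\<in>UNIV. T (e' i) (e' i)) = (\<Sum>i\<in>UNIV. \<Sum>j\<in>UNIV. \<Sum>k\<in>UNIV. a i j * a i k * T (e j) (e k))"
    by simp
  also have "\<dots> = (\<Sum>j\<in>UNIV. \<Sum>i\<in>UNIV. \<Sum>k\<in>UNIV. a i j * a i k * T (e j) (e k))"
    by (rule sum.swap)
  also have "\<dots> = (\<Sum>j\<in>UNIV. \<Sum>k\<in>UNIV. \<Sum>i\<in>UNIV. a i j * a i k * T (e j) (e k))"
    by (rule sum.cong[OF refl]) (rule sum.swap)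
  also have "\<dots> = (\<Sum>j\<in>UNIV. \<Sum>k\<in>UNIV. if j = k then T (e j) (e k) else 0)"
  proof (intro sum.cong refl)
    fix j k
    \<comment> \<open>Expanding in the second frame gives the orthogonality relation between the
      columns of \<open>a\<close>, which is the one that occurs in the sum.\<close>
    have "e k = (\<Sum>i\<in>UNIV. g (e' i) (e k) *\<^sub>R e' i)" by (rule orthonormal_frame_expand[OF g(1) e'])
    then have "g (e j) (e k) = g (e j) (\<Sum>i\<in>UNIV. g (e' i) (e k) *\<^sub>R e' i)"
      by (rule arg_cong)
    then have "g (e j) (e k) = (\<Sum>i\<in>UNIV. a i k * a i j)"
      by (simp add: linear_sum[OF linear_right[OF g(1)]] linear_cmul[OF linear_right[OF g(1)]] a_def
          g(2)[of "e' _" "e k"])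
    then have "(\<Sum>i\<in>UNIV. a i j * a i k) = (if j = k then 1 else 0)"
      using e by (simp add: orthonormal_frame_def mult.commute)
    then show "(\<Sum>i\<in>UNIV. a i j * a i k * T (e j) (e k)) = (if j = k then T (e j) (e k) else 0)"
      by (simp flip: sum_distrib_right)
  qed
  also have "\<dots> = (\<Sum>i\<in>UNIV. T (e i) (e i))" by simp
  finally show ?thesis .
qed

section \<open>Simultaneous diagonalization of two forms\<close>

text \<open>The first-order condition at a minimum, for a quadratic polynomial with its minimum at t
  = 0.\<close>

lemma linear_term_zero:
  fixes a b :: real
  assumes "\<And>t. 2 * t * a + t\<^sup>2 * b \<ge> 0"
  shows "a = 0"
proof (rule ccontr)
  assume a: "a \<noteq> 0"
  \<comment> \<open>For this t the quadratic term is at most -t a, hence at most half the size of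
    the negative linear term 2 t a.\<close>
  define t where "t = - a / (1 + \<bar>b\<bar>)"
  have p: "1 + \<bar>b\<bar> > 0" by simp
  have "t\<^sup>2 * b \<le> t\<^sup>2 * (1 + \<bar>b\<bar>)" by (rule mult_left_mono) auto
  also have "\<dots> = - t * a" unfolding t_def using p by (simp add: power2_eq_square divide_simps)
  finally have "t * a \<ge> 0" using assms[of t] by simp
  moreover have "t * a = - (a * a) / (1 + \<bar>b\<bar>)" by (simp add: t_def)
  moreover have "- (a * a) / (1 + \<bar>b\<bar>) < 0"
    using a p by (intro divide_neg_pos) (auto simp: not_sum_squares_lt_zero less_le)
  ultimately show False by simp
qed

text \<open>By homogeneity it suffices to take the minimum on the compact unit sphere. The bound
  shows that the vectors with \<open>g w w = 1\<close> form a bounded set.\<close>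

lemma positive_definite_lower_bound:
  fixes g :: "'v::euclidean_space \<Rightarrow> 'v \<Rightarrow> real"
  assumes g: "bounded_bilinear g" and pos: "\<And>w. w \<noteq> 0 \<Longrightarrow> g w w > 0"
  shows "\<exists>c>0. \<forall>w. c * (norm w)\<^sup>2 \<le> g w w"
proof -
  interpret g: bounded_bilinear g by fact
  obtain b :: 'v where "b \<in> Basis" using nonempty_Basis by blast
  then have ne: "sphere (0 :: 'v) 1 \<noteq> {}" by (auto intro!: exI[of _ b])
  have cont: "continuous_on (sphere 0 1) (\<lambda>w. g w w)"
    by (intro g.continuous_on continuous_on_id)
  obtain m where m: "m \<in> sphere 0 1" "\<And>w. w \<in> sphere 0 1 \<Longrightarrow> g m m \<le> g w w"
    using continuous_attains_inf[OF compact_sphere ne cont] by blast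
  have "g m m * (norm w)\<^sup>2 \<le> g w w" for w
  proof (cases "w = 0")
    case False
    then have "g m m \<le> g (inverse (norm w) *\<^sub>R w) (inverse (norm w) *\<^sub>R w)"
      by (intro m(2)) auto
    then show ?thesis using False
      by (simp add: g.scaleR_left g.scaleR_right power2_eq_square field_simps)
  qed (simp add: g.zero_left)
  moreover have "g m m > 0" using m(1) by (intro pos) auto
  ultimately show ?thesis by blast
qed

text \<open>The spectral theorem for h relative to the inner product g, by induction on the number
  of vectors found. Among the g-unit vectors orthogonal to the earlier ones, a maximum point of
  \<open>h w w\<close> is the next eigenvector. The application is to the second fundamental form
  relative to the first.\<close>

lemma simultaneous_eigenvectors:
  fixes g h :: "'v::euclidean_space \<Rightarrow> 'v \<Rightarrow> real"
  assumes g: "bounded_bilinear g" and g_sym: "\<And>x y. g x y = g y x" and pos: "\<And>w. w \<noteq> 0 \<Longrightarrow> g w w > 0"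
    and h: "bounded_bilinear h" and h_sym: "\<And>x y. h x y = h y x"
  shows "k \<le> DIM('v) \<Longrightarrow> \<exists>B. finite B \<and> card B = k \<and>
    (\<forall>x\<in>B. \<forall>y\<in>B. g x y = (if x = y then 1 else 0)) \<and> (\<forall>x\<in>B. \<exists>l. \<forall>w. h x w = l * g x w)"
proof (induction k)
  case 0
  show ?case by (intro exI[of _ "{}"]) auto
next
  case (Suc k)
  interpret g: bounded_bilinear g by fact
  interpret h: bounded_bilinear h by fact
  from Suc obtain B where B: "finite B" "card B = k"
    "\<And>x y. x \<in> B \<Longrightarrow> y \<in> B \<Longrightarrow> g x y = (if x = y then 1 else 0)"
    "\<And>x. x \<in> B \<Longrightarrow> \<exists>l. \<forall>w. h x w = l * g x w"
    by auto
  \<comment> \<open>\<open>V\<close> is the g-orthogonal complement of the vectors found so far and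
    \<open>P\<close> the g-orthogonal projection onto their span.\<close>
  define V where "V = {w. \<forall>b\<in>B. g b w = 0}"
  define P where "P w = (\<Sum>b\<in>B. g b w *\<^sub>R b)" for w
  have PV: "w - P w \<in> V" for w
    unfolding V_def
  proof clarify
    fix b assume b: "b \<in> B"
    have "g b (P w) = (\<Sum>x\<in>B. g x w * g b x)"
      unfolding P_def by (simp add: g.sum_right g.scaleR_right)
    also have "\<dots> = (\<Sum>x\<in>B. if x = b then g b w else 0)"
      by (rule sum.cong) (use B(3) b in auto)
    finally show "g b (w - P w) = 0" using b B(1) by (simp add: g.diff_right)
  qed
  \<comment> \<open>Fewer vectors than the dimension leave some w0 outside their span; its component
    in \<open>V\<close> is then nonzero, so \<open>K\<close> is not empty.\<close>
  have "span B \<noteq> UNIV"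
  proof
    assume "span B = UNIV"
    then have "DIM('v) \<le> card B" using dim_le_card[of UNIV B] B(1) by simp
    then show False using Suc.prems B(2) by simp
  qed
  then obtain w0 where w0: "w0 \<notin> span B" by blast
  define w1 where "w1 = w0 - P w0"
  have "P w0 \<in> span B" unfolding P_def by (intro span_sum span_scale span_base)
  then have w1: "w1 \<noteq> 0" "w1 \<in> V" using w0 PV by (auto simp: w1_def)
  define K where "K = V \<inter> {w. g w w = 1}"
  have Vscale: "r *\<^sub>R w \<in> V" if "w \<in> V" for r w
    using that by (simp add: V_def g.scaleR_right)
  have norm1: "inverse (sqrt (g w w)) *\<^sub>R w \<in> K" if "w \<in> V" "w \<noteq> 0" for w
    using pos[OF that(2)] Vscale[OF that(1)]
    by (simp add: K_def g.scaleR_left g.scaleR_right field_simps)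
  obtain c where c: "c > 0" "\<And>w. c * (norm w)\<^sup>2 \<le> g w w"
    using positive_definite_lower_bound[OF g pos] by blast
  have "bounded K"
  proof (rule boundedI)
    fix w assume "w \<in> K"
    then have "c * (norm w)\<^sup>2 \<le> 1" using c(2)[of w] by (simp add: K_def)
    then have "(norm w)\<^sup>2 \<le> inverse c" using c(1) by (simp add: field_simps)
    then show "norm w \<le> sqrt (inverse c)" by (rule real_le_rsqrt)
  qed
  moreover have "closed K"
  proof -
    have "closed {w. g b w = 0}" for b
      by (intro closed_Collect_eq continuous_intros linear_continuous_on g.bounded_linear_right)
    then have "closed (\<Inter>b\<in>B. {w. g b w = 0})" by blast
    moreover have "V = (\<Inter>b\<in>B. {w. g b w = 0})" by (auto simp: V_def)
    moreover have "closed {w. g w w = 1}"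
      by (intro closed_Collect_eq g.continuous_on continuous_intros)
    ultimately show ?thesis unfolding K_def by (simp add: closed_Int)
  qed
  ultimately have K: "compact K" by (simp add: compact_eq_bounded_closed)
  have "continuous_on K (\<lambda>w. h w w)" by (intro h.continuous_on continuous_on_id)
  then obtain m where m: "m \<in> K" "\<And>w. w \<in> K \<Longrightarrow> h w w \<le> h m m"
    using continuous_attains_sup[OF K] norm1[OF w1(2,1)] by blast
  define l where "l = h m m"
  have mV: "m \<in> V" "g m m = 1" using m(1) by (auto simp: K_def)
  have le: "h w w \<le> l * g w w" if "w \<in> V" for w
  proof (cases "w = 0")
    case False
    have "h (inverse (sqrt (g w w)) *\<^sub>R w) (inverse (sqrt (g w w)) *\<^sub>R w) \<le> l"
      unfolding l_def by (rule m(2)[OF norm1[OF that False]])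
    then show ?thesis using pos[OF False] by (simp add: h.scaleR_left h.scaleR_right field_simps)
  qed (simp add: h.zero_left g.zero_left)
  \<comment> \<open>First variation at the maximum point: \<open>l * g w w - h w w\<close> is
    nonnegative on \<open>V\<close> and vanishes at m, so its linear term along w is zero.\<close>
  have onV: "h m w = l * g m w" if w: "w \<in> V" for w
  proof -
    have "0 \<le> 2 * t * (l * g m w - h m w) + t\<^sup>2 * (l * g w w - h w w)" for t
    proof -
      have "m + t *\<^sub>R w \<in> V" using mV(1) w by (simp add: V_def g.add_right g.scaleR_right)
      from le[OF this] show ?thesis
        using mV(2) g_sym[of w m] h_sym[of w m]
        by (simp add: g.add_left g.add_right g.scaleR_left g.scaleR_right h.add_left h.add_right
            h.scaleR_left h.scaleR_right power2_eq_square algebra_simps l_def)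
    qed
    from linear_term_zero[OF this] show ?thesis by simp
  qed
  have gm: "g m b = 0" "h m b = 0" if "b \<in> B" for b
  proof -
    show "g m b = 0" using mV(1) that g_sym by (simp add: V_def)
    then show "h m b = 0" using B(4)[OF that] g_sym[of m b] h_sym[of m b] by auto
  qed
  \<comment> \<open>The equation extends from \<open>V\<close> to all vectors, because both forms
    vanish between m and the earlier vectors, h by their eigenvector property.\<close>
  have all: "h m w = l * g m w" for w
  proof -
    have "h m (P w) = 0" "g m (P w) = 0"
      by (simp_all add: P_def g.sum_right h.sum_right g.scaleR_right h.scaleR_right gm)
    then show ?thesis using onV[OF PV[of w]] by (simp add: g.diff_right h.diff_right)
  qed
  have "m \<notin> B" using gm(1)[of m] mV(2) by auto
  then show ?case
    using B gm(1) g_sym mV(2) all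
    by (intro exI[of _ "insert m B"]) auto
qed

lemma simultaneous_diagonalization:
  fixes g h :: "real ^ 'n::finite \<Rightarrow> real ^ 'n \<Rightarrow> real"
  assumes "bounded_bilinear g" "\<And>x y. g x y = g y x" "\<And>w. w \<noteq> 0 \<Longrightarrow> g w w > 0"
    and "bounded_bilinear h" "\<And>x y. h x y = h y x"
  obtains e l where "orthonormal_frame g e" "\<And>i w. h (e i) w = l i * g (e i) w"
proof -
  obtain B where B: "finite B" "card B = CARD('n)"
    "\<And>x y. x \<in> B \<Longrightarrow> y \<in> B \<Longrightarrow> g x y = (if x = y then 1 else 0)"
    "\<And>x. x \<in> B \<Longrightarrow> \<exists>l. \<forall>w. h x w = l * g x w"
    using simultaneous_eigenvectors[OF assms, of "CARD('n)"] by auto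
  then obtain e where e: "bij_betw e (UNIV :: 'n set) B"
    using finite_same_card_bij[of "UNIV :: 'n set" B] by auto
  then have eB: "e i \<in> B" for i by (auto simp: bij_betw_def)
  have "inj e" using e by (simp add: bij_betw_def)
  then have "orthonormal_frame g e"
    using B(3)[OF eB eB] by (simp add: orthonormal_frame_def inj_eq)
  moreover obtain l where "\<And>i w. h (e i) w = l i * g (e i) w"
    using B(4)[OF eB] by metis
  ultimately show ?thesis using that by blast
qed

section \<open>Determinants\<close>

text \<open>In the Leibniz expansion a permutation other than the identity moves at least two
  indices. After one factor has been differentiated, an off-diagonal factor remains, and it vanishes
  at x0. Only the product of the diagonal entries contributes.\<close>

lemma det_has_derivative_diagonal:
  fixes M :: "'a::real_normed_vector \<Rightarrow> real ^ 'n ^ 'n::finite"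
  assumes M: "\<And>i j. ((\<lambda>x. M x $ i $ j) has_derivative M' i j) (at x0)"
    and diag: "\<And>i j. i \<noteq> j \<Longrightarrow> M x0 $ i $ j = 0"
  shows "((\<lambda>x. det (M x)) has_derivative (\<lambda>u. \<Sum>i\<in>UNIV. M' i i u * (\<Prod>j\<in>UNIV - {i}. M x0 $ j $ j))) (at x0)"
proof -
  let ?P = "{p. p permutes (UNIV :: 'n set)}"
  let ?D = "\<lambda>p u. \<Sum>i\<in>UNIV. M' i (p i) u * (\<Prod>j\<in>UNIV - {i}. M x0 $ j $ p j)"
  have "((\<lambda>x. \<Sum>p\<in>?P. of_int (sign p) * (\<Prod>i\<in>UNIV. M x $ i $ p i)) has_derivative
      (\<lambda>u. \<Sum>p\<in>?P. of_int (sign p) * ?D p u)) (at x0)"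
    by (intro has_derivative_sum has_derivative_mult_right has_derivative_prod M)
  moreover have "(\<Sum>p\<in>?P. of_int (sign p) * ?D p u) = ?D id u" for u
  proof -
    have "?D p u = 0" if p: "p \<in> ?P" "p \<noteq> id" for p
    proof (rule sum.neutral, rule ballI)
      fix i
      have "\<exists>j. j \<noteq> i \<and> p j \<noteq> j"
      proof (rule ccontr)
        assume "\<not> ?thesis"
        then have *: "\<And>j. j \<noteq> i \<Longrightarrow> p j = j" by blast
        have "inj p" using p(1) permutes_inj by blast
        then have "p i = i" using * by (metis injD)
        then show False using * p(2) by (metis eq_id_iff)
      qed
      then obtain j where "j \<noteq> i" "p j \<noteq> j" by blast
      then have "M x0 $ j $ p j = 0" "j \<in> UNIV - {i}" using diag by (metis, simp)
      then have "(\<Prod>j\<in>UNIV - {i}. M x0 $ j $ p j) = 0"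
        by (intro prod_zero) auto
      then show "M' i (p i) u * (\<Prod>j\<in>UNIV - {i}. M x0 $ j $ p j) = 0" by simp
    qed
    then have "(\<Sum>p\<in>?P. of_int (sign p) * ?D p u) = (\<Sum>p\<in>?P. if p = id then ?D id u else 0)"
      by (intro sum.cong) (auto simp: sign_id)
    then show ?thesis by (simp add: finite_permutations permutes_id)
  qed
  ultimately show ?thesis by (simp add: det_def[abs_def])
qed

text \<open>The Gram matrix of f is P T P^T, where T is the diagonal Gram matrix of e.\<close>

lemma det_gram:
  fixes b :: "real ^ 'n \<Rightarrow> real ^ 'n \<Rightarrow> real" and f e :: "'n::finite \<Rightarrow> real ^ 'n"
  assumes b: "bounded_bilinear b" and e: "\<And>i j. b (e i) (e j) = (if i = j then t i else 0)"
    and f: "\<And>i. f i = (\<Sum>k\<in>UNIV. P i k *\<^sub>R e k)"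
  shows "det (\<chi> i j. b (f i) (f j)) = (det (\<chi> i j. P i j))\<^sup>2 * (\<Prod>i\<in>UNIV. t i)"
proof -
  let ?P = "\<chi> i j. P i j" and ?T = "\<chi> i j. if i = j then t i else 0"
  have "b (f i) (f j) = (\<Sum>k\<in>UNIV. \<Sum>m\<in>UNIV. P i k * P j m * b (e k) (e m))" for i j
    unfolding f by (rule bilinear_double_sum[OF b])
  moreover have "(\<Sum>m\<in>UNIV. P i k * P j m * b (e k) (e m)) = P i k * t k * P j k" for i j k
    by (simp add: e if_distrib[of "\<lambda>x. _ * x"] cong: if_cong)
  ultimately have "b (f i) (f j) = (?P ** ?T ** transpose ?P) $ i $ j" for i j
    by (simp add: matrix_matrix_mult_def transpose_def if_distrib[of "\<lambda>x. _ * x"] cong: if_cong)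
  then have "(\<chi> i j. b (f i) (f j)) = ?P ** ?T ** transpose ?P"
    by (simp add: vec_eq_iff)
  moreover have "det ?T = (\<Prod>i\<in>UNIV. t i)"
    using det_diagonal[of ?T] by simp
  ultimately show ?thesis by (simp add: det_mul det_transpose power2_eq_square)
qed

lemma FD_bilinear:
  assumes "bounded_bilinear b" "f differentiable at x" "g differentiable at x"
  shows "FD (\<lambda>x. b (f x) (g x)) x u = b (f x) (FD g x u) + b (FD f x u) (g x)"
  using FD_eq[OF bounded_bilinear.FDERIV[OF assms(1) FD_has_derivative[OF assms(2)] FD_has_derivative[OF assms(3)]]]
  by simp

lemma FD_locally_const:
  assumes "open S" "x \<in> S" "\<And>y. y \<in> S \<Longrightarrow> f y = c"
  shows "FD f x u = 0"
  using FD_cong[OF assms(1,2), of f "\<lambda>_. c"] assms(3) by simp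

lemma FD_linear: "f differentiable at x \<Longrightarrow> linear (FD f x)"
  using FD_has_derivative has_derivative_linear by blast

lemma smooth_on_FD_comp:
  fixes f :: "'a::euclidean_space \<Rightarrow> 'b::real_normed_vector"
  assumes f: "smooth_on f T" and k: "smooth_on k S" "k ` S \<subseteq> T" and g: "smooth_on g S"
    and S: "open S" and T: "open T"
  shows "smooth_on (\<lambda>x. FD f (k x) (g x)) S"
proof (rule smooth_on_cong[OF S])
  have "smooth_on (\<lambda>x. FD f (k x) b) S" for b
    by (rule smooth_on_compose[OF k(1) smooth_on_FD[OF f] S k(2)])
  then have "smooth_on (\<lambda>x. (g x \<bullet> b) *\<^sub>R FD f (k x) b) S" for b
    by (rule smooth_on_scaleR[OF smooth_on_inner[OF g smooth_on_const S] _ S])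
  then show "smooth_on (\<lambda>x. \<Sum>b\<in>Basis. (g x \<bullet> b) *\<^sub>R FD f (k x) b) S"
    by (rule smooth_on_sum[OF _ S])
  fix y assume "y \<in> S"
  then have "k y \<in> T" using k(2) by auto
  then show "(\<Sum>b\<in>Basis. (g y \<bullet> b) *\<^sub>R FD f (k y) b) = FD f (k y) (g y)"
    by (rule bounded_linear_sum_Basis[OF FD_bounded_linear[OF smooth_on_differentiable[OF f]], symmetric])
qed

section \<open>The Lorentz form\<close>

lemma bounded_bilinear_lor: "bounded_bilinear lor"
  unfolding lor_def[abs_def]
  by (rule bounded_bilinear_diff)
    (rule bounded_bilinear.comp[OF bounded_bilinear_inner bounded_linear_fst bounded_linear_fst]
      bounded_bilinear.comp[OF bounded_bilinear_mult bounded_linear_snd bounded_linear_snd])+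

interpretation lor: bounded_bilinear lor by (rule bounded_bilinear_lor)

lemma lor_commute: "lor x y = lor y x"
  by (simp add: lor_def inner_commute mult.commute)

lemmas lor_simps = lor.add_left lor.add_right lor.diff_left lor.diff_right lor.scaleR_left lor.scaleR_right
  lor.minus_left lor.minus_right lor.zero_left lor.zero_right

lemma lor_nondegenerate: "(\<And>y. lor w y = 0) \<Longrightarrow> w = 0"
proof -
  assume "\<And>y. lor w y = 0"
  \<comment> \<open>Reversing the time coordinate of the test vector turns the Lorentz product into
    the Euclidean square norm.\<close>
  then have "fst w \<bullet> fst w + snd w * snd w = 0"
    using \<open>\<And>y. lor w y = 0\<close>[of "(fst w, - snd w)"] by (simp add: lor_def)
  then have "fst w \<bullet> fst w = 0" "snd w * snd w = 0"
    by (auto simp: add_nonneg_eq_0_iff)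
  then show "w = 0" by (simp add: prod_eq_iff)
qed

text \<open>x, v and the vectors E i are n + 2 mutually orthogonal vectors with nonzero squares,
  hence a basis of Minkowski space. A vector orthogonal to all of them is zero by
  nondegeneracy.\<close>

lemma lor_frame_zero:
  fixes E :: "'n::finite \<Rightarrow> 'n mink"
  assumes x: "lor x x = -1" and v: "lor v v = 1" and xv: "lor x v = 0"
    and E: "\<And>i j. lor (E i) (E j) = (if i = j then 1 else 0)" "\<And>i. lor x (E i) = 0" "\<And>i. lor v (E i) = 0"
    and w: "lor x w = 0" "lor v w = 0" "\<And>i. lor (E i) w = 0"
  shows "w = 0"
proof (rule lor_nondegenerate)
  have "inj E" using E(1) unfolding inj_def by (metis zero_neq_one)
  then have c1: "card (range E) = CARD('n)" by (simp add: card_image)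
  have c2: "v \<notin> range E" "x \<notin> insert v (range E)" using E x v xv by fastforce+
  have sym: "lor v x = 0" "lor (E i) x = 0" "lor (E i) v = 0" "lor w x = 0" "lor w v = 0" "lor w (E i) = 0" for i
    using xv E w lor_commute by metis+
  let ?B = "insert x (insert v (range E))"
  have "span ?B = UNIV"
  proof (rule orthogonal_spans[of lor])
    show "card ?B = DIM('n mink)" using c1 c2 by simp
    show "lor y y \<noteq> 0" if "y \<in> ?B" for y using that E x v by auto
    show "lor y z = 0" if "y \<in> ?B" "z \<in> ?B" "y \<noteq> z" for y z
      using that E xv sym by auto
  qed (auto intro: linear_right[OF bounded_bilinear_lor])
  moreover have "lor w y = 0" if "y \<in> span ?B" for y
    using that
  proof (induction rule: span_induct_alt)
    case (step a b c)
    then show ?case using sym by (auto simp: lor_simps)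
  qed (simp add: lor_simps)
  ultimately show "lor w y = 0" for y by auto
qed

text \<open>The complement of a timelike vector is spacelike. Otherwise the Cauchy-Schwarz
  inequality for the spatial parts would first force the time coordinate of w to vanish, then its
  spatial part.\<close>

lemma lor_positive:
  assumes x: "lor x x = -1" and w: "lor x w = 0" "w \<noteq> 0"
  shows "lor w w > 0"
proof (rule ccontr)
  assume "\<not> ?thesis"
  then have le: "fst w \<bullet> fst w \<le> (snd w)\<^sup>2" by (simp add: lor_def power2_eq_square)
  have x': "fst x \<bullet> fst x = (snd x)\<^sup>2 - 1" using x by (simp add: lor_def power2_eq_square)
  have "(snd x * snd w)\<^sup>2 = (fst x \<bullet> fst w)\<^sup>2" using w(1) by (simp add: lor_def)
  also have "\<dots> \<le> (fst x \<bullet> fst x) * (fst w \<bullet> fst w)" by (rule Cauchy_Schwarz_ineq)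
  also have "\<dots> \<le> (fst x \<bullet> fst x) * (snd w)\<^sup>2" using le by (intro mult_left_mono) auto
  finally have "(snd w)\<^sup>2 \<le> 0" by (simp add: x' power_mult_distrib algebra_simps)
  then have "snd w = 0" by simp
  moreover from this le have "fst w \<bullet> fst w = 0" using inner_ge_zero[of "fst w"] by simp
  then have "fst w = 0" by simp
  ultimately show False using w(2) by (simp add: prod_eq_iff)
qed

section \<open>The hyperboloid\<close>

definition hyp_lift :: "real ^ ('n::finite option) \<Rightarrow> 'n mink" where
  "hyp_lift y = (y, sqrt (1 + y \<bullet> y))"

lemma hyp_lift_in: "hyp_lift y \<in> hyp"
proof -
  have "1 + y \<bullet> y > 0" by (simp add: add_pos_nonneg)
  then show ?thesis by (simp add: hyp_def hyp_lift_def lor_def flip: power2_eq_square)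
qed

lemma hyp_lift_fst: "x \<in> hyp \<Longrightarrow> hyp_lift (fst x) = x"
proof -
  assume "x \<in> hyp"
  then have "1 + fst x \<bullet> fst x = (snd x)\<^sup>2" "snd x > 0"
    by (auto simp: hyp_def lor_def power2_eq_square)
  then show ?thesis by (simp add: hyp_lift_def prod_eq_iff)
qed

lemma fst_hyp_lift [simp]: "fst (hyp_lift y) = y"
  by (simp add: hyp_lift_def)

abbreviation hyp_chart :: "('n::finite mink, real ^ ('n option)) chart" where
  "hyp_chart \<equiv> (hyp, fst)"

lemma inj_fst_hyp: "inj_on fst hyp"
  using hyp_lift_fst by (metis inj_onI)

lemma fst_hyp: "fst ` hyp = UNIV"
  using hyp_lift_in fst_hyp_lift by (metis UNIV_eq_I image_eqI)

lemma chart_inv_hyp: "inv_into hyp fst = (hyp_lift :: real ^ ('n::finite option) \<Rightarrow> 'n mink)"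
proof
  show "inv_into hyp fst y = hyp_lift y" for y :: "real ^ ('n option)"
    using inv_into_f_f[OF inj_fst_hyp hyp_lift_in, of y] by simp
qed

lemma smooth_hyp_lift: "smooth_on hyp_lift S"
proof (rule smooth_on_subset)
  have "smooth_on (\<lambda>y. (y, sqrt (1 + y \<bullet> y))) UNIV"
    by (rule smooth_on_Pair[OF smooth_on_id smooth_on_sqrt[OF smooth_on_add[OF smooth_on_const
        smooth_on_inner[OF smooth_on_id smooth_on_id]]]]) (auto simp: add_pos_nonneg)
  then show "smooth_on hyp_lift UNIV" by (simp add: hyp_lift_def[abs_def])
qed simp

lemma hyp_smooth_atlas: "smooth_atlas (hyp_atlas :: ('n::finite mink, real ^ ('n option)) chart set)"
proof
  fix c d :: "('n mink, real ^ ('n option)) chart" assume cd: "c \<in> hyp_atlas" "d \<in> hyp_atlas"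
  then have "c = hyp_chart" "d = hyp_chart" by (auto simp: hyp_atlas_def)
  then show "inj_on (snd c) (fst c)" "open (snd c ` fst c)" "open (snd c ` (fst c \<inter> fst d))"
    "smooth_on (\<lambda>y. snd d (chart_inv c y)) (snd c ` (fst c \<inter> fst d))"
    using inj_fst_hyp by (simp_all add: fst_hyp chart_inv_hyp smooth_on_id)
qed

interpretation hyp: smooth_atlas hyp_atlas by (rule hyp_smooth_atlas)

lemma carrier_hyp: "carrier hyp_atlas = hyp"
  by (simp add: carrier_def hyp_atlas_def)

lemma chart_at_hyp: "x \<in> hyp \<Longrightarrow> chart_at hyp_atlas x = hyp_chart"
  using hyp.chart_at(1)[of x] by (simp add: carrier_hyp) (simp add: hyp_atlas_def)

lemma ambient_eq: "x \<in> hyp \<Longrightarrow> ambient x X = FD hyp_lift (fst x) (X hyp_chart)"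
  by (simp add: ambient_def dderiv_def chart_at_hyp Let_def chart_inv_hyp comp_def)

lemma hyp_lift_has_derivative: "(hyp_lift has_derivative FD hyp_lift y) (at y)"
  by (rule FD_has_derivative[OF smooth_on_differentiable[OF smooth_hyp_lift, of y UNIV]]) simp

lemma fst_FD_hyp_lift [simp]: "fst (FD hyp_lift y u) = u"
proof -
  have "((\<lambda>y. fst (hyp_lift y)) has_derivative (\<lambda>u. fst (FD hyp_lift y u))) (at y)"
    by (rule has_derivative_fst[OF hyp_lift_has_derivative])
  from FD_eq[OF this] have "(\<lambda>u. fst (FD hyp_lift y u)) = (\<lambda>u. u)" by simp
  then show ?thesis by (rule fun_cong)
qed

lemma lor_FD_hyp_lift: "lor (hyp_lift y) (FD hyp_lift y u) = 0"
proof -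
  have d: "hyp_lift differentiable at y" using hyp_lift_has_derivative by (auto simp: differentiable_def)
  have "FD (\<lambda>y. lor (hyp_lift y) (hyp_lift y)) y u = 0"
    by (rule FD_locally_const[of UNIV]) (use hyp_lift_in in \<open>auto simp: hyp_def\<close>)
  then show ?thesis
    using FD_bilinear[OF bounded_bilinear_lor d d] lor_commute[of "hyp_lift y"] by simp
qed

lemma lor_ambient: "x \<in> hyp \<Longrightarrow> lor x (ambient x X) = 0"
  using lor_FD_hyp_lift[of "fst x"] by (simp add: ambient_eq hyp_lift_fst)

text \<open>Both sides are orthogonal to x and have the same spatial part; since
  \<open>snd x > 0\<close>, orthogonality determines the time coordinate.\<close>

lemma FD_hyp_lift_surj:
  assumes "x \<in> hyp" "lor x w = 0"
  shows "w = FD hyp_lift (fst x) (fst w)"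
proof -
  let ?w = "FD hyp_lift (fst x) (fst w)"
  have "lor x ?w = 0" using lor_FD_hyp_lift[of "fst x"] assms(1) by (simp add: hyp_lift_fst)
  then have "snd x * snd ?w = snd x * snd w" using assms(2) by (simp add: lor_def)
  moreover have "snd x > 0" using assms(1) by (simp add: hyp_def)
  ultimately show ?thesis by (simp add: prod_eq_iff)
qed

text \<open>Here the pull-back of the Lorentz form is the metric at every point, so the condition on
  the derivative is just the product rule.\<close>

lemma hyp_jet:
  fixes D :: "('n::finite mink, real ^ ('n option)) conn"
  assumes lc: "levi_civita hyp_atlas hyp_metric D" and p: "p \<in> hyp"
  shows "lc_jet hyp_atlas hyp_metric D p hyp_lift lor UNIV hyp_chart (fst p)"
proof
  have metric: "hyp_metric (hyp_lift y) (tvec_of hyp_atlas (hyp_lift y) hyp_chart u)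
      (tvec_of hyp_atlas (hyp_lift y) hyp_chart w) = lor (FD hyp_lift y u) (FD hyp_lift y w)"
    for y and u w :: "real ^ ('n option)"
  proof -
    have "hyp_chart \<in> hyp_atlas" by (simp add: hyp_atlas_def)
    then have "tvec_of hyp_atlas (hyp_lift y) hyp_chart u hyp_chart = u" for u :: "real ^ ('n option)"
      by (rule hyp.tvec_of_same) (simp add: hyp_lift_in)
    then show ?thesis
      by (simp add: hyp_metric_def ambient_eq[OF hyp_lift_in])
  qed
  show "hyp_metric p (tvec_of hyp_atlas p hyp_chart u) (tvec_of hyp_atlas p hyp_chart w) =
      lor (FD hyp_lift (fst p) u) (FD hyp_lift (fst p) w)" for u w
    using metric[of "fst p"] by (simp add: hyp_lift_fst[OF p])
  have D: "((\<lambda>y. FD hyp_lift y u) has_derivative (\<lambda>k. FD2 hyp_lift y k u)) (at y)" for y u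
    by (rule FD_has_derivative[OF smooth_on_differentiable[OF smooth_on_FD[OF smooth_hyp_lift], of y UNIV]]) simp
  show "((\<lambda>y. hyp_metric (chart_inv hyp_chart y) (tvec_of hyp_atlas (chart_inv hyp_chart y) hyp_chart u)
        (tvec_of hyp_atlas (chart_inv hyp_chart y) hyp_chart w)) has_derivative
        (\<lambda>k. lor (FD2 hyp_lift (fst p) k u) (FD hyp_lift (fst p) w) +
             lor (FD hyp_lift (fst p) u) (FD2 hyp_lift (fst p) k w))) (at (fst p))" for u w
    using lor.FDERIV[OF D[of u "fst p"] D[of w "fst p"]]
    by (simp add: chart_inv_hyp metric add.commute)
  show "hyp_metric p X Y = hyp_metric p Y X" for X Y
    by (simp add: hyp_metric_def lor_commute)
  show "hyp_metric p (X + Y) Z = hyp_metric p X Z + hyp_metric p Y Z" for X Y Z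
    by (simp add: hyp_metric_def ambient_eq[OF p] lor_simps plus_fun_def
        linear_add[OF has_derivative_linear[OF hyp_lift_has_derivative]])
qed (use assms in \<open>auto simp: chart_at_hyp carrier_hyp smooth_hyp_lift bounded_bilinear_lor lor_commute\<close>)

section \<open>Hypersurfaces in coordinates\<close>

lemma (in smooth_atlas) topspace_mfd: "topspace (mfd_topology A) = carrier A"
proof (rule antisym)
  show "topspace (mfd_topology A) \<subseteq> carrier A"
    using openin_mfd[of "topspace (mfd_topology A)"] by simp
  have "openin (mfd_topology A) (carrier A)"
    using chart_open by (auto simp: openin_mfd carrier_def Int_absorb1 UN_upper)
  then show "carrier A \<subseteq> topspace (mfd_topology A)" by (rule openin_subset)
qed

locale hypersurface =
  fixes A :: "('a, real ^ 'n::finite) chart set" and \<sigma> :: "'a \<Rightarrow> 'n mink" and \<nu> :: "'a \<Rightarrow> 'n hyp_tvec"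
    and D :: "('n mink, real ^ ('n option)) conn"
  assumes manifold: "smooth_manifold A"
    and levi_civita: "levi_civita hyp_atlas hyp_metric D"
    and embedding: "smooth_embedding A hyp_atlas \<sigma>"
    and normal: "unit_normal_field A \<sigma> \<nu>"
begin

sublocale A: smooth_atlas A by (rule smooth_manifold_atlas[OF manifold])

sublocale hyp_pair: atlas_pair A hyp_atlas ..

definition sg :: "('a, real ^ 'n) chart \<Rightarrow> real ^ 'n \<Rightarrow> 'n mink" where
  "sg c a = \<sigma> (chart_inv c a)"

definition nu :: "('a, real ^ 'n) chart \<Rightarrow> real ^ 'n \<Rightarrow> 'n mink" where
  "nu c a = ambient (sg c a) (\<nu> (chart_inv c a))"

text \<open>\<open>continuous_map\<close> includes that the values lie in the underlying set of the
  target topology.\<close>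

lemma sigma_in: "q \<in> carrier A \<Longrightarrow> \<sigma> q \<in> hyp"
proof -
  assume q: "q \<in> carrier A"
  have "continuous_map (mfd_topology A) (mfd_topology hyp_atlas) \<sigma>"
    using embedding unfolding smooth_embedding_def smooth_map_def by blast
  then have "\<sigma> q \<in> topspace (mfd_topology hyp_atlas)"
    using q unfolding continuous_map_def A.topspace_mfd by blast
  then show ?thesis by (simp only: hyp.topspace_mfd carrier_hyp)
qed

lemma sigma_vimage: "c \<in> A \<Longrightarrow> fst c \<inter> \<sigma> -` hyp = fst c"
proof -
  assume c: "c \<in> A"
  have "\<sigma> q \<in> hyp" if "q \<in> fst c" for q by (rule sigma_in[OF A.carrierI[OF c that]])
  then show ?thesis by auto
qed

lemma hyp_chart_in: "hyp_chart \<in> hyp_atlas"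
  by (simp add: hyp_atlas_def)

lemma chart_in_carrier: "c \<in> A \<Longrightarrow> a \<in> snd c ` fst c \<Longrightarrow> chart_inv c a \<in> carrier A"
  by (rule A.carrierI[OF _ A.chart_inv_in])

lemma sg_in: "c \<in> A \<Longrightarrow> a \<in> snd c ` fst c \<Longrightarrow> sg c a \<in> hyp"
  unfolding sg_def by (intro sigma_in chart_in_carrier)

lemma fst_sg_smooth:
  assumes "c \<in> A"
  shows "smooth_on (\<lambda>a. fst (sg c a)) (snd c ` fst c)"
proof -
  have "smooth_on (snd hyp_chart \<circ> \<sigma> \<circ> chart_inv c) (snd c ` (fst c \<inter> \<sigma> -` fst hyp_chart))"
    using embedding assms hyp_chart_in unfolding smooth_embedding_def smooth_map_def by blast
  then show ?thesis by (simp add: sigma_vimage[OF assms] comp_def sg_def)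
qed

lemma sigma_rep: "c \<in> A \<Longrightarrow> smooth_rep c hyp_chart \<sigma> (snd c ` fst c)"
  using fst_sg_smooth[of c] A.chart_open[of c] sg_in[of c] by (auto simp: smooth_rep_def sg_def)

lemma sg_smooth:
  assumes "c \<in> A"
  shows "smooth_on (sg c) (snd c ` fst c)"
proof (rule smooth_on_cong[OF A.chart_open[OF assms]])
  show "smooth_on (\<lambda>a. hyp_lift (fst (sg c a))) (snd c ` fst c)"
    by (rule smooth_on_compose[OF fst_sg_smooth[OF assms] smooth_hyp_lift[of UNIV] A.chart_open[OF assms]]) simp
  show "hyp_lift (fst (sg c a)) = sg c a" if "a \<in> snd c ` fst c" for a
    using hyp_lift_fst[OF sg_in[OF assms that]] .
qed

lemma nu_eq: "c \<in> A \<Longrightarrow> a \<in> snd c ` fst c \<Longrightarrow>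
    nu c a = FD hyp_lift (fst (sg c a)) (\<nu> (chart_inv c a) hyp_chart)"
  unfolding nu_def by (rule ambient_eq[OF sg_in])

lemma nu_coord_smooth:
  assumes "c \<in> A"
  shows "smooth_on (\<lambda>a. \<nu> (chart_inv c a) hyp_chart) (snd c ` fst c)"
proof -
  have "smooth_on (\<lambda>a. \<nu> (chart_inv c a) hyp_chart) (snd c ` (fst c \<inter> \<sigma> -` fst hyp_chart))"
    using normal assms hyp_chart_in unfolding unit_normal_field_def smooth_field_along_def by blast
  then show ?thesis by (simp add: sigma_vimage[OF assms])
qed

lemma nu_smooth:
  assumes "c \<in> A"
  shows "smooth_on (nu c) (snd c ` fst c)"
proof (rule smooth_on_cong[OF A.chart_open[OF assms]])
  show "smooth_on (\<lambda>a. FD hyp_lift (fst (sg c a)) (\<nu> (chart_inv c a) hyp_chart)) (snd c ` fst c)"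
    by (rule smooth_on_FD_comp[OF smooth_hyp_lift[of UNIV] fst_sg_smooth[OF assms] _
          nu_coord_smooth[OF assms] A.chart_open[OF assms]]) auto
qed (simp add: nu_eq[OF assms])

end

section \<open>The Minkowski-valued lifts \<open>sg\<close> and \<open>nu\<close> in one
  chart\<close>

locale hypersurface_chart = hypersurface A \<sigma> \<nu> D
  for A :: "('a, real ^ 'n::finite) chart set" and \<sigma> :: "'a \<Rightarrow> 'n mink" and \<nu> :: "'a \<Rightarrow> 'n hyp_tvec"
    and D :: "('n mink, real ^ ('n option)) conn" +
  fixes c :: "('a, real ^ 'n) chart" and U :: "(real ^ 'n) set"
  assumes c: "c \<in> A" and U_def: "U = snd c ` fst c"
begin

lemma U: "open U"
  unfolding U_def by (rule A.chart_open[OF c])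

lemma smooth: "smooth_on (sg c) U" "smooth_on (nu c) U"
  unfolding U_def by (rule sg_smooth[OF c], rule nu_smooth[OF c])

lemma chart_point:
  assumes "a \<in> U"
  shows "chart_inv c a \<in> fst c" "snd c (chart_inv c a) = a" "chart_inv c a \<in> carrier A"
  using assms unfolding U_def
  by (rule A.chart_inv_in, rule A.chart_eq_inv, rule chart_in_carrier[OF c])

lemma differentiable_lifts:
  assumes "a \<in> U"
  shows "sg c differentiable at a" "nu c differentiable at a"
    "(\<lambda>a. FD (sg c) a u) differentiable at a" "(\<lambda>a. FD (nu c) a u) differentiable at a"
  by (rule smooth_on_differentiable[OF smooth(1) assms] smooth_on_differentiable[OF smooth(2) assms]
      smooth_on_differentiable[OF smooth_on_FD[OF smooth(1)] assms]
      smooth_on_differentiable[OF smooth_on_FD[OF smooth(2)] assms])+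

lemma linear_lifts: "a \<in> U \<Longrightarrow> linear (FD (sg c) a)" "a \<in> U \<Longrightarrow> linear (FD (nu c) a)"
  by (rule FD_linear[OF differentiable_lifts(1)], simp, rule FD_linear[OF differentiable_lifts(2)], simp)

lemma FD_sg_eq:
  assumes q: "q \<in> fst c" and X: "X \<in> tangent_space A q"
  shows "FD (sg c) (snd c q) (X c) = ambient (\<sigma> q) (differential A hyp_atlas \<sigma> q X)"
proof -
  have qU: "snd c q \<in> snd c ` fst c" using q by simp
  have sq: "sg c (snd c q) = \<sigma> q" using c q by (simp add: sg_def)
  have "((\<lambda>a. hyp_lift (fst (sg c a))) has_derivative
      (\<lambda>u. FD hyp_lift (fst (sg c (snd c q))) (FD (\<lambda>a. fst (sg c a)) (snd c q) u))) (at (snd c q))"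
    by (rule has_derivative_compose[OF FD_has_derivative[OF smooth_on_differentiable[OF fst_sg_smooth[OF c] qU]]
          hyp_lift_has_derivative])
  then have "(sg c has_derivative
      (\<lambda>u. FD hyp_lift (fst (sg c (snd c q))) (FD (\<lambda>a. fst (sg c a)) (snd c q) u))) (at (snd c q))"
    by (rule has_derivative_transform_within_open[OF _ A.chart_open[OF c] qU])
      (rule hyp_lift_fst[OF sg_in[OF c]])
  from FD_eq[OF this] have "FD (sg c) (snd c q) (X c) =
      FD hyp_lift (fst (\<sigma> q)) (FD (\<lambda>a. fst (sg c a)) (snd c q) (X c))" by (simp add: sq)
  moreover have "differential A hyp_atlas \<sigma> q X hyp_chart = FD (\<lambda>a. fst (sg c a)) (snd c q) (X c)"
    using hyp_pair.differential_in(2)[OF c q hyp_chart_in X sigma_rep[OF c] qU] by (simp add: sg_def)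
  ultimately show ?thesis
    using ambient_eq[OF sg_in[OF c qU]] by (simp add: sq)
qed

lemma FD_sg_tvec:
  assumes a: "a \<in> U"
  shows "FD (sg c) a u = ambient (sg c a)
    (differential A hyp_atlas \<sigma> (chart_inv c a) (tvec_of A (chart_inv c a) c u))"
proof -
  have q: "chart_inv c a \<in> fst c" "snd c (chart_inv c a) = a"
    by (rule chart_point[OF a])+
  show ?thesis
    using FD_sg_eq[OF q(1) A.tvec_of_in[OF c q(1), of u]] A.tvec_of_same[OF c q(1), of u]
    by (simp add: q(2) sg_def)
qed

lemma point_facts:
  assumes a: "a \<in> U"
  shows "lor (sg c a) (sg c a) = -1" "lor (sg c a) (nu c a) = 0" "lor (nu c a) (nu c a) = 1"
    "lor (sg c a) (FD (sg c) a u) = 0" "lor (nu c a) (FD (sg c) a u) = 0"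
proof -
  have in': "sg c a \<in> hyp" using sg_in c a by (simp add: U_def)
  then show "lor (sg c a) (sg c a) = -1" by (simp add: hyp_def)
  have q: "chart_inv c a \<in> fst c" "chart_inv c a \<in> carrier A"
    by (rule chart_point[OF a])+
  show "lor (sg c a) (nu c a) = 0" unfolding nu_def by (rule lor_ambient[OF in'])
  show "lor (nu c a) (nu c a) = 1"
    using normal q(2) by (simp add: unit_normal_field_def hyp_metric_def nu_def sg_def)
  show "lor (sg c a) (FD (sg c) a u) = 0"
    unfolding FD_sg_tvec[OF a] by (rule lor_ambient[OF in'])
  show "lor (nu c a) (FD (sg c) a u) = 0"
    using normal q(2) A.tvec_of_in[OF c q(1), of u] FD_sg_tvec[OF a]
    by (simp add: unit_normal_field_def hyp_metric_def nu_def sg_def)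
qed

text \<open>Each follows by differentiating a constant product. For the third, differentiating
  \<open>lor (nu c a) (FD (sg c) a u) = 0\<close> expresses the product through the second
  derivative of \<open>sg c\<close>, which is symmetric; this is the symmetry of the second
  fundamental form.\<close>

lemma nu_facts:
  assumes a: "a \<in> U"
  shows "lor (nu c a) (FD (nu c) a u) = 0" "lor (sg c a) (FD (nu c) a u) = 0"
    "lor (FD (sg c) a u) (FD (nu c) a w) = lor (FD (sg c) a w) (FD (nu c) a u)"
proof -
  have "FD (\<lambda>a. lor (nu c a) (nu c a)) a u = 0"
    by (rule FD_locally_const[OF U a]) (rule point_facts)
  then show "lor (nu c a) (FD (nu c) a u) = 0"
    using FD_bilinear[OF bounded_bilinear_lor differentiable_lifts(2,2)[OF a], of u] lor_commute[of "FD (nu c) a u"] by simp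
  have "FD (\<lambda>a. lor (sg c a) (nu c a)) a u = 0"
    by (rule FD_locally_const[OF U a]) (rule point_facts)
  then show "lor (sg c a) (FD (nu c) a u) = 0"
    using FD_bilinear[OF bounded_bilinear_lor differentiable_lifts(1,2)[OF a], of u] point_facts(5)[OF a, of u]
      lor_commute[of "FD (sg c) a u"] by simp
  have *: "lor (FD (sg c) a u) (FD (nu c) a w) = - lor (nu c a) (FD2 (sg c) a w u)" for u w
  proof -
    have "FD (\<lambda>a. lor (nu c a) (FD (sg c) a u)) a w = 0"
      by (rule FD_locally_const[OF U a]) (rule point_facts)
    then show ?thesis
      using FD_bilinear[OF bounded_bilinear_lor differentiable_lifts(2,3)[OF a], of u w] lor_commute[of "FD (sg c) a u"] by simp
  qed
  show "lor (FD (sg c) a u) (FD (nu c) a w) = lor (FD (sg c) a w) (FD (nu c) a u)"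
    unfolding * FD2_sym[OF smooth(1) U a, of u w] ..
qed

lemma FD_sg_inj:
  assumes a: "a \<in> U" and 0: "FD (sg c) a u = 0"
  shows "u = 0"
proof -
  let ?q = "chart_inv c a"
  have q: "?q \<in> fst c" "snd c ?q = a" "?q \<in> carrier A"
    by (rule chart_point[OF a])+
  have aU: "snd c ?q \<in> snd c ` fst c" by (rule imageI[OF q(1)])
  have diff_tvec: "differential A hyp_atlas \<sigma> ?q (tvec_of A ?q c w) =
      tvec_of hyp_atlas (\<sigma> ?q) hyp_chart (fst (FD (sg c) a w))" for w
  proof -
    have "FD (\<lambda>a. fst (sg c a)) a w = fst (FD (sg c) a w)"
      using FD_eq[OF has_derivative_fst[OF FD_has_derivative[OF differentiable_lifts(1)[OF a]]]] by simp
    then show ?thesis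
      using hyp_pair.differential_chart[OF c q(1) hyp_chart_in A.tvec_of_in[OF c q(1), of w] sigma_rep[OF c] aU]
        A.tvec_of_same[OF c q(1), of w] by (simp add: q(2) sg_def)
  qed
  have "tvec_of A ?q c u = tvec_of A ?q c 0"
  proof (rule inj_onD)
    show "inj_on (differential A hyp_atlas \<sigma> ?q) (tangent_space A ?q)"
      using embedding q(3) by (simp add: smooth_embedding_def)
    show "differential A hyp_atlas \<sigma> ?q (tvec_of A ?q c u) = differential A hyp_atlas \<sigma> ?q (tvec_of A ?q c 0)"
      unfolding diff_tvec 0 linear_0[OF linear_lifts(1)[OF a]] ..
  qed (use A.tvec_of_in[OF c q(1)] in auto)
  then have "tvec_of A ?q c u c = tvec_of A ?q c 0 c" by (rule arg_cong)
  then show ?thesis by (simp add: A.tvec_of_same[OF c q(1)])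
qed

lemma bounded_linear_lifts: "a \<in> U \<Longrightarrow> bounded_linear (FD (sg c) a)" "a \<in> U \<Longrightarrow> bounded_linear (FD (nu c) a)"
  by (rule FD_bounded_linear[OF differentiable_lifts(1)], simp, rule FD_bounded_linear[OF differentiable_lifts(2)], simp)

section \<open>Principal frames\<close>

lemma bounded_bilinear_first_form:
  "a \<in> U \<Longrightarrow> bounded_bilinear (\<lambda>u w. lor (FD (sg c) a u) (FD (sg c) a w))"
  by (rule bounded_bilinear.comp[OF bounded_bilinear_lor]) (rule bounded_linear_lifts, assumption)+

text \<open>Orthonormality refers to the first fundamental form; the sign is that of the Weingarten
  equation d\<nu> = -d\<sigma> B, so that the numbers \<open>l i\<close> are the principal
  curvatures.\<close>

definition eigenframe :: "real ^ 'n \<Rightarrow> ('n \<Rightarrow> real ^ 'n) \<Rightarrow> ('n \<Rightarrow> real) \<Rightarrow> bool" where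
  "eigenframe a e l \<longleftrightarrow> orthonormal_frame (\<lambda>u w. lor (FD (sg c) a u) (FD (sg c) a w)) e \<and>
     (\<forall>i. FD (nu c) a (e i) = - l i *\<^sub>R FD (sg c) a (e i))"

lemma tangent_zero:
  assumes a: "a \<in> U" and e: "orthonormal_frame (\<lambda>u w. lor (FD (sg c) a u) (FD (sg c) a w)) e"
    and "lor (sg c a) w = 0" "lor (nu c a) w = 0" "\<And>i. lor (FD (sg c) a (e i)) w = 0"
  shows "w = 0"
  using e by (intro lor_frame_zero[OF point_facts(1)[OF a] point_facts(3)[OF a] point_facts(2)[OF a],
        of "\<lambda>i. FD (sg c) a (e i)"])
    (use assms point_facts(4,5)[OF a] in \<open>auto simp: orthonormal_frame_def\<close>)

text \<open>The second fundamental form is diagonalized relative to the first. This gives the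
  eigenvector equation paired with tangent vectors; both sides are also orthogonal to \<sigma> and
  \<nu>, so \<open>tangent_zero\<close> upgrades it to an identity of vectors.\<close>

lemma eigenframe_exists:
  assumes a: "a \<in> U"
  shows "\<exists>e l. eigenframe a e l"
proof -
  have 1: "bounded_bilinear (\<lambda>u w. lor (FD (sg c) a u) (- FD (nu c) a w))"
    by (rule bounded_bilinear.comp[OF bounded_bilinear_lor bounded_linear_lifts(1)[OF a]
          bounded_linear_minus[OF bounded_linear_lifts(2)[OF a]]])
  have 2: "lor (FD (sg c) a w) (FD (sg c) a w) > 0" if "w \<noteq> 0" for w
    by (rule lor_positive[OF point_facts(1,4)[OF a]]) (use FD_sg_inj[OF a] that in auto)
  have 3: "lor (FD (sg c) a x) (- FD (nu c) a y) = lor (FD (sg c) a y) (- FD (nu c) a x)" for x y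
    using nu_facts(3)[OF a, of x y] by (simp add: lor_simps)
  obtain e l where e: "orthonormal_frame (\<lambda>u w. lor (FD (sg c) a u) (FD (sg c) a w)) e"
    and l: "\<And>i w. lor (FD (sg c) a (e i)) (- FD (nu c) a w) = l i * lor (FD (sg c) a (e i)) (FD (sg c) a w)"
    by (rule simultaneous_diagonalization[OF bounded_bilinear_first_form[OF a] lor_commute 2 1 3])
      (assumption, rule that)
  have "FD (nu c) a (e i) + l i *\<^sub>R FD (sg c) a (e i) = 0" for i
  proof (rule tangent_zero[OF a e])
    fix j
    have "lor (FD (sg c) a (e j)) (FD (nu c) a (e i)) = lor (FD (sg c) a (e i)) (FD (nu c) a (e j))"
      by (rule nu_facts(3)[OF a])
    then show "lor (FD (sg c) a (e j)) (FD (nu c) a (e i) + l i *\<^sub>R FD (sg c) a (e i)) = 0"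
      using l[of i "e j"] lor_commute[of "FD (sg c) a (e j)" "FD (sg c) a (e i)"] by (simp add: lor_simps)
  qed (simp_all add: lor_simps point_facts[OF a] nu_facts[OF a])
  then have "eigenframe a e l"
    using e by (simp add: eigenframe_def eq_neg_iff_add_eq_0)
  then show ?thesis by blast
qed

lemma eigenframe_expand:
  assumes "a \<in> U" "eigenframe a e l"
  shows "w = (\<Sum>i\<in>UNIV. lor (FD (sg c) a (e i)) (FD (sg c) a w) *\<^sub>R e i)"
  using orthonormal_frame_expand[OF bounded_bilinear_first_form[OF assms(1)]] assms(2)
  by (simp add: eigenframe_def)

lemma orthonormal_frame_first_form:
  "eigenframe a e l \<Longrightarrow> lor (FD (sg c) a (e i)) (FD (sg c) a (e j)) = (if i = j then 1 else 0)"
  by (simp add: eigenframe_def orthonormal_frame_def)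

lemma eigenframe_nu:
  "eigenframe a e l \<Longrightarrow> FD (nu c) a (e i) = - l i *\<^sub>R FD (sg c) a (e i)"
  by (simp add: eigenframe_def)

section \<open>Shape operator and principal curvatures\<close>

text \<open>The ambient derivative of \<nu> is orthogonal to \<sigma>, hence already tangent to the
  hyperboloid, so no correction term appears.\<close>

lemma ambient_cov:
  assumes q: "q \<in> fst c" and W: "W \<in> tangent_space A q"
  shows "cov_along A hyp_atlas D \<sigma> \<nu> q W \<in> tangent_space hyp_atlas (\<sigma> q)"
    "ambient (\<sigma> q) (cov_along A hyp_atlas D \<sigma> \<nu> q W) = FD (nu c) (snd c q) (W c)"
proof -
  define a where "a = snd c q"
  have a: "a \<in> U" using q by (simp add: a_def U_def)
  have aU: "snd c q \<in> snd c ` fst c" using q by simp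
  have sq: "sg c a = \<sigma> q" using c q by (simp add: sg_def a_def)
  have p: "\<sigma> q \<in> hyp" using sg_in[OF c aU] sq by (simp add: a_def)
  interpret J: lc_jet hyp_atlas hyp_metric D "\<sigma> q" hyp_lift lor UNIV hyp_chart "fst (\<sigma> q)"
    by (rule hyp_jet[OF levi_civita p])
  interpret J: lc_jet_along A hyp_atlas hyp_metric D "\<sigma> q" hyp_lift lor UNIV hyp_chart "fst (\<sigma> q)"
    \<sigma> c q "snd c ` fst c"
    by unfold_locales (use c q sigma_rep[OF c] in auto)
  have nd: "(\<lambda>a. \<nu> (chart_inv c a) hyp_chart) differentiable at (snd c q)"
    by (rule smooth_on_differentiable[OF nu_coord_smooth[OF c] aU])
  show cov: "cov_along A hyp_atlas D \<sigma> \<nu> q W \<in> tangent_space hyp_atlas (\<sigma> q)"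
    by (rule J.cov_along_in[where Y = \<nu>, OF W nd])
  let ?C = "ambient (\<sigma> q) (cov_along A hyp_atlas D \<sigma> \<nu> q W)" and ?N = "FD (nu c) a (W c)"
  have eq: "FD (\<lambda>a. FD hyp_lift (fst (sg c a)) (\<nu> (chart_inv c a) hyp_chart)) a = FD (nu c) a"
    by (rule FD_cong[OF U a]) (use nu_eq[OF c] in \<open>simp add: U_def\<close>)
  have pair: "lor ?C w = lor ?N w" if w: "lor (\<sigma> q) w = 0" for w
  proof -
    define Z where "Z = tvec_of hyp_atlas (\<sigma> q) hyp_chart (fst w)"
    have Z: "Z \<in> tangent_space hyp_atlas (\<sigma> q)" "Z hyp_chart = fst w"
      unfolding Z_def by (rule hyp.tvec_of_in, rule hyp_chart_in, simp add: p,
          rule hyp.tvec_of_same, rule hyp_chart_in, simp add: p)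
    have "ambient (\<sigma> q) Z = w"
      using FD_hyp_lift_surj[OF p w] by (simp add: ambient_eq[OF p] Z(2))
    moreover have "hyp_metric (\<sigma> q) (cov_along A hyp_atlas D \<sigma> \<nu> q W) Z = lor ?N (FD hyp_lift (fst (\<sigma> q)) (Z hyp_chart))"
      using J.cov_along_metric[where Y = \<nu>, OF W Z(1) nd] eq by (simp add: a_def sg_def)
    ultimately show ?thesis
      by (simp add: hyp_metric_def ambient_eq[OF p, of Z])
  qed
  have C: "lor (\<sigma> q) ?C = 0" by (rule lor_ambient[OF p])
  have N: "lor (\<sigma> q) ?N = 0" using nu_facts(2)[OF a] by (simp add: sq)
  \<comment> \<open>The difference is tangent to the hyperboloid, so it may be paired with itself;
    its square is zero, and tangent vectors are spacelike.\<close>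
  have "lor (\<sigma> q) (?C - ?N) = 0" using C N by (simp add: lor_simps)
  then have "lor (?C - ?N) (?C - ?N) = 0" using pair[of "?C - ?N"] by (simp add: lor_simps)
  moreover have "lor (\<sigma> q) (\<sigma> q) = -1" using p by (simp add: hyp_def)
  ultimately show "?C = FD (nu c) (snd c q) (W c)"
    using lor_positive[of "\<sigma> q" "?C - ?N"] \<open>lor (\<sigma> q) (?C - ?N) = 0\<close> by (force simp: a_def)
qed

text \<open>The solution u of the Weingarten equation gives existence for the definite description;
  injectivity of the differential of \<sigma> gives uniqueness.\<close>

lemma shape_operator_eq:
  assumes q: "q \<in> fst c" and W: "W \<in> tangent_space A q"
    and u: "FD (nu c) (snd c q) (W c) = - FD (sg c) (snd c q) u"
  shows "shape_operator A D \<sigma> \<nu> q W = tvec_of A q c u"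
  unfolding shape_operator_def
proof (rule the_equality)
  have a: "snd c q \<in> U" using q by (simp add: U_def)
  have aU: "snd c q \<in> snd c ` fst c" using q by simp
  have sq: "sg c (snd c q) = \<sigma> q" using c q by (simp add: sg_def)
  have p: "\<sigma> q \<in> hyp" using sg_in[OF c aU] sq by simp
  let ?T = "tangent_space hyp_atlas (\<sigma> q)"
  let ?C = "cov_along A hyp_atlas D \<sigma> \<nu> q W"
  have mC: "- ?C \<in> ?T" using subspace_neg[OF hyp.tangent_subspace ambient_cov(1)[OF q W]] .
  have amb_neg: "ambient (\<sigma> q) (- ?C) = - ambient (\<sigma> q) ?C"
    using linear_neg[OF has_derivative_linear[OF hyp_lift_has_derivative]] by (simp add: ambient_eq[OF p])
  have iff: "differential A hyp_atlas \<sigma> q X = - ?C \<longleftrightarrow> FD (sg c) (snd c q) (X c) = FD (sg c) (snd c q) u"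
    if X: "X \<in> tangent_space A q" for X
  proof
    assume "differential A hyp_atlas \<sigma> q X = - ?C"
    then show "FD (sg c) (snd c q) (X c) = FD (sg c) (snd c q) u"
      using FD_sg_eq[OF q X] amb_neg ambient_cov(2)[OF q W] u by simp
  next
    assume eq: "FD (sg c) (snd c q) (X c) = FD (sg c) (snd c q) u"
    then have "ambient (\<sigma> q) (differential A hyp_atlas \<sigma> q X) = ambient (\<sigma> q) (- ?C)"
      using FD_sg_eq[OF q X] amb_neg ambient_cov(2)[OF q W] u by simp
    then have "fst (ambient (\<sigma> q) (differential A hyp_atlas \<sigma> q X)) = fst (ambient (\<sigma> q) (- ?C))"
      by (rule arg_cong)
    then have "differential A hyp_atlas \<sigma> q X hyp_chart = (- ?C) hyp_chart"
      by (simp only: ambient_eq[OF p] fst_FD_hyp_lift)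
    moreover have "differential A hyp_atlas \<sigma> q X \<in> ?T"
      by (rule hyp_pair.differential_in(1)[OF c q hyp_chart_in X sigma_rep[OF c] aU])
    ultimately show "differential A hyp_atlas \<sigma> q X = - ?C"
      using hyp.tangent_eqI[OF _ mC hyp_chart_in] p by simp
  qed
  show "tvec_of A q c u \<in> tangent_space A q \<and> differential A hyp_atlas \<sigma> q (tvec_of A q c u) = - ?C"
    using iff[OF A.tvec_of_in[OF c q]] A.tvec_of_same[OF c q] A.tvec_of_in[OF c q] by simp
  fix X assume X: "X \<in> tangent_space A q \<and> differential A hyp_atlas \<sigma> q X = - ?C"
  then have "FD (sg c) (snd c q) (X c - u) = 0"
    using iff[of X] linear_diff[OF linear_lifts(1)[OF a], of "X c" u] by simp
  then have "X c = u" using FD_sg_inj[OF a] by fastforce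
  then show "X = tvec_of A q c u" using A.tvec_of_coord[OF conjunct1[OF X] c q] by simp
qed

text \<open>The shape operator is diagonal in an eigenframe, so eigenvalues and multiplicities can
  be read off. The sum in \<open>f_sigma\<close> thereby becomes a sum over the frame.\<close>

lemma curvatures:
  assumes q: "q \<in> fst c" and e: "eigenframe (snd c q) e l"
  shows "principal_curvatures A D \<sigma> \<nu> q = range l"
    "dim (curvature_eigenspace A D \<sigma> \<nu> q \<mu>) = card {i. l i = \<mu>}"
proof -
  have a: "snd c q \<in> U" using q by (simp add: U_def)
  let ?S = "FD (sg c) (snd c q)"
  let ?g = "\<lambda>u w. lor (?S u) (?S w)"
  let ?T = "tvec_of A q c"
  note g = bounded_bilinear_first_form[OF a]
  have orth: "?g (e i) (e j) = (if i = j then 1 else 0)" for i j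
    by (rule orthonormal_frame_first_form[OF e])
  have Tin: "?T u \<in> tangent_space A q" for u by (rule A.tvec_of_in[OF c q])
  have Tc: "?T u c = u" for u by (rule A.tvec_of_same[OF c q])
  have shape: "shape_operator A D \<sigma> \<nu> q W = ?T (\<Sum>i\<in>UNIV. (l i * ?g (e i) (W c)) *\<^sub>R e i)"
    if W: "W \<in> tangent_space A q" for W
  proof (rule shape_operator_eq[OF q W])
    have "FD (nu c) (snd c q) (W c) = FD (nu c) (snd c q) (\<Sum>i\<in>UNIV. ?g (e i) (W c) *\<^sub>R e i)"
      using eigenframe_expand[OF a e, of "W c"] by simp
    also have "\<dots> = (\<Sum>i\<in>UNIV. ?g (e i) (W c) *\<^sub>R (- l i *\<^sub>R ?S (e i)))"
      by (simp add: linear_sum[OF linear_lifts(2)[OF a]] linear_cmul[OF linear_lifts(2)[OF a]] eigenframe_nu[OF e])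
    also have "\<dots> = - (\<Sum>i\<in>UNIV. (l i * ?g (e i) (W c)) *\<^sub>R ?S (e i))"
      by (simp add: mult.commute flip: sum_negf)
    also have "(\<Sum>i\<in>UNIV. (l i * ?g (e i) (W c)) *\<^sub>R ?S (e i)) = ?S (\<Sum>i\<in>UNIV. (l i * ?g (e i) (W c)) *\<^sub>R e i)"
      by (simp add: linear_sum[OF linear_lifts(1)[OF a]] linear_cmul[OF linear_lifts(1)[OF a]])
    finally show "FD (nu c) (snd c q) (W c) = - ?S (\<Sum>i\<in>UNIV. (l i * ?g (e i) (W c)) *\<^sub>R e i)" .
  qed
  have coeff: "?g (e j) (\<Sum>i\<in>UNIV. x i *\<^sub>R e i) = x j" for x j
    by (simp add: linear_sum[OF linear_right[OF g]] linear_cmul[OF linear_right[OF g]] orth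
        if_distrib[of "\<lambda>y. _ * y"] cong: if_cong)
  have eig: "(l j - m) * ?g (e j) (W c) = 0" if "W \<in> curvature_eigenspace A D \<sigma> \<nu> q m" for W m j
  proof -
    have W: "W \<in> tangent_space A q" "shape_operator A D \<sigma> \<nu> q W = m *\<^sub>R W"
      using that by (auto simp: curvature_eigenspace_def)
    have "(\<Sum>i\<in>UNIV. (l i * ?g (e i) (W c)) *\<^sub>R e i) = ?T (\<Sum>i\<in>UNIV. (l i * ?g (e i) (W c)) *\<^sub>R e i) c"
      by (rule Tc[symmetric])
    also have "\<dots> = (m *\<^sub>R W) c" by (rule fun_cong[OF trans[OF shape[OF W(1), symmetric] W(2)]])
    also have "\<dots> = m *\<^sub>R W c" by (simp add: scaleR_fun_def)
    finally have "(\<Sum>i\<in>UNIV. (l i * ?g (e i) (W c)) *\<^sub>R e i) = m *\<^sub>R W c" .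
    then have "?g (e j) (\<Sum>i\<in>UNIV. (l i * ?g (e i) (W c)) *\<^sub>R e i) = ?g (e j) (m *\<^sub>R W c)"
      by (rule arg_cong)
    then have "l j * ?g (e j) (W c) = ?g (e j) (m *\<^sub>R W c)" unfolding coeff .
    then show ?thesis by (simp add: linear_cmul[OF linear_right[OF g]] left_diff_distrib)
  qed
  have Te: "?T (e j) \<in> curvature_eigenspace A D \<sigma> \<nu> q (l j)" for j
  proof -
    have "(\<Sum>i\<in>UNIV. (l i * ?g (e i) (e j)) *\<^sub>R e i) = (\<Sum>i\<in>UNIV. if i = j then l j *\<^sub>R e j else 0)"
      by (rule sum.cong) (simp_all add: orth)
    then have "(\<Sum>i\<in>UNIV. (l i * ?g (e i) (e j)) *\<^sub>R e i) = l j *\<^sub>R e j" by simp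
    then show ?thesis
      using shape[OF Tin[of "e j"]] Tin[of "e j"] linear_cmul[OF A.tvec_of_linear[OF c q]]
      by (simp add: curvature_eigenspace_def Tc)
  qed
  have "e j \<noteq> 0" for j using orth[of j j] linear_0[OF linear_lifts(1)[OF a]] by (auto simp: lor_simps)
  then have T0: "?T (e j) \<noteq> 0" for j using Tc[of "e j"] by (auto simp: zero_fun_def)
  have expand: "W = (\<Sum>i\<in>UNIV. ?g (e i) (W c) *\<^sub>R ?T (e i))" if W: "W \<in> tangent_space A q" for W
  proof -
    have "W = ?T (W c)" using A.tvec_of_coord[OF W c q] by simp
    also have "\<dots> = ?T (\<Sum>i\<in>UNIV. ?g (e i) (W c) *\<^sub>R e i)"
      using eigenframe_expand[OF a e, of "W c"] by simp
    finally show ?thesis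
      by (simp add: linear_sum[OF A.tvec_of_linear[OF c q]] linear_cmul[OF A.tvec_of_linear[OF c q]])
  qed
  show "principal_curvatures A D \<sigma> \<nu> q = range l"
  proof (intro equalityI subsetI)
    fix m assume "m \<in> principal_curvatures A D \<sigma> \<nu> q"
    then obtain W where W: "W \<in> curvature_eigenspace A D \<sigma> \<nu> q m" "W \<noteq> 0"
      by (auto simp: principal_curvatures_def)
    then have "W \<in> tangent_space A q" by (simp add: curvature_eigenspace_def)
    note ex = expand[OF this]
    have "\<exists>i. ?g (e i) (W c) \<noteq> 0"
    proof (rule ccontr)
      assume "\<not> ?thesis"
      then have "(\<Sum>i\<in>UNIV. ?g (e i) (W c) *\<^sub>R ?T (e i)) = 0" by simp
      then show False using W(2) ex by simp
    qed
    then obtain i where "?g (e i) (W c) \<noteq> 0" by blast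
    then have "m = l i" using eig[OF W(1), of i] by simp
    then show "m \<in> range l" by simp
  next
    fix m assume "m \<in> range l"
    then show "m \<in> principal_curvatures A D \<sigma> \<nu> q"
      using Te T0 by (auto simp: principal_curvatures_def)
  qed
  let ?E = "{i. l i = \<mu>}" and ?V = "curvature_eigenspace A D \<sigma> \<nu> q \<mu>"
  let ?B = "(\<lambda>i. ?T (e i)) ` ?E"
  have inj: "inj (\<lambda>i. ?T (e i))"
  proof (rule injI)
    fix i j assume "?T (e i) = ?T (e j)"
    then have "?T (e i) c = ?T (e j) c" by (rule arg_cong)
    then have "e i = e j" by (simp only: Tc)
    then show "i = j" using orth[of i j] orth[of j j] by (simp split: if_splits)
  qed
  \<comment> \<open>Tangent vectors are elements of a function space without an inner product. The
    first fundamental form, evaluated on the coordinates in \<open>c\<close>, is linear on that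
    whole space and serves instead.\<close>
  have "independent ?B"
  proof (rule orthogonal_independent[of "\<lambda>X Y. ?g (X c) (Y c)"])
    show "linear (\<lambda>Y. ?g (X c) (Y c))" for X
      by (rule linearI) (simp_all add: plus_fun_def scaleR_fun_def linear_add[OF linear_right[OF g]]
          linear_cmul[OF linear_right[OF g]])
  qed (auto simp: Tc orth)
  moreover have "?B \<subseteq> ?V" using Te by auto
  moreover have "?V \<subseteq> span ?B"
  proof
    fix W assume W: "W \<in> ?V"
    then have "W \<in> tangent_space A q" by (simp add: curvature_eigenspace_def)
    from expand[OF this] have "W = (\<Sum>i\<in>UNIV. ?g (e i) (W c) *\<^sub>R ?T (e i))" .
    moreover have "?g (e i) (W c) *\<^sub>R ?T (e i) \<in> span ?B" for i
    proof (cases "l i = \<mu>")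
      case True
      then show ?thesis by (intro span_scale span_base) auto
    next
      case False
      then have "?g (e i) (W c) = 0" using eig[OF W, of i] by simp
      then show ?thesis by (simp add: span_zero)
    qed
    ultimately show "W \<in> span ?B" using span_sum[of UNIV "\<lambda>i. ?g (e i) (W c) *\<^sub>R ?T (e i)" ?B] by simp
  qed
  ultimately have "card ?B = dim ?V" by (intro basis_card_eq_dim)
  moreover have "card ?B = card ?E" by (rule card_image[OF inj_on_subset[OF inj]]) simp
  ultimately show "dim ?V = card ?E" by simp
qed

lemma f_sigma_eq:
  assumes q: "q \<in> fst c" and e: "eigenframe (snd c q) e l"
  shows "f_sigma A D \<sigma> \<nu> q = (1 / real CARD('n)) * (\<Sum>i\<in>UNIV. artanh (l i))"
proof -
  have "(\<Sum>i\<in>UNIV. artanh (l i)) = (\<Sum>\<mu>\<in>range l. \<Sum>i\<in>{i\<in>UNIV. l i = \<mu>}. artanh (l i))"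
    by (rule sum.image_gen) simp
  also have "\<dots> = (\<Sum>\<mu>\<in>range l. real (card {i. l i = \<mu>}) * artanh \<mu>)"
    by (rule sum.cong) auto
  finally show ?thesis by (simp add: f_sigma_def curvatures[OF assms])
qed

end

section \<open>The differential of the function \<open>f\<close>\<close>

locale small_hypersurface_chart = hypersurface_chart A \<sigma> \<nu> D c U
  for A :: "('a, real ^ 'n::finite) chart set" and \<sigma> :: "'a \<Rightarrow> 'n mink" and \<nu> :: "'a \<Rightarrow> 'n hyp_tvec"
    and D :: "('n mink, real ^ ('n option)) conn" and c :: "('a, real ^ 'n) chart" and U :: "(real ^ 'n) set" +
  assumes small: "small_principal_curvatures A D \<sigma> \<nu>"
begin

lemma D2_has_derivative:
  assumes a: "a \<in> U"
  shows "((\<lambda>a. FD (sg c) a u) has_derivative (\<lambda>k. FD2 (sg c) a k u)) (at a)"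
    "((\<lambda>a. FD (nu c) a u) has_derivative (\<lambda>k. FD2 (nu c) a k u)) (at a)"
  using FD_has_derivative[OF differentiable_lifts(3)[OF a]] FD_has_derivative[OF differentiable_lifts(4)[OF a]] .

definition cubic :: "real ^ 'n \<Rightarrow> real ^ 'n \<Rightarrow> real ^ 'n \<Rightarrow> real ^ 'n \<Rightarrow> real" where
  "cubic a u w k = lor (FD2 (sg c) a u w) (FD (nu c) a k) - lor (FD2 (nu c) a u w) (FD (sg c) a k)"

lemma cubic_sym12: "a \<in> U \<Longrightarrow> cubic a u w k = cubic a w u k"
  unfolding cubic_def by (subst FD2_sym[OF smooth(1) U], assumption, subst FD2_sym[OF smooth(2) U], assumption, rule refl)

lemma cubic_sym23:
  assumes a: "a \<in> U"
  shows "cubic a u w k = cubic a u k w"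
proof -
  have "FD (\<lambda>a. lor (FD (sg c) a w) (FD (nu c) a k)) a u = FD (\<lambda>a. lor (FD (sg c) a k) (FD (nu c) a w)) a u"
    by (rule fun_cong[OF FD_cong[OF U a]]) (rule nu_facts(3))
  then have "lor (FD (sg c) a w) (FD2 (nu c) a u k) + lor (FD2 (sg c) a u w) (FD (nu c) a k) =
      lor (FD (sg c) a k) (FD2 (nu c) a u w) + lor (FD2 (sg c) a u k) (FD (nu c) a w)"
    unfolding FD_bilinear[OF bounded_bilinear_lor differentiable_lifts(3,4)[OF a]] .
  then show ?thesis
    unfolding cubic_def lor_commute[of "FD2 (nu c) a u w"] lor_commute[of "FD2 (nu c) a u k"] by linarith
qed

lemma eigenvalue_bounds:
  assumes a: "a \<in> U" and e: "eigenframe a e l"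
  shows "-1 < l i" "l i < 1"
proof -
  have "eigenframe (snd c (chart_inv c a)) e l" using e chart_point(2)[OF a] by simp
  from curvatures(1)[OF chart_point(1)[OF a] this] have "range l \<subseteq> {-1<..<1}"
    using small chart_point(3)[OF a] unfolding small_principal_curvatures_def by auto
  then have "l i \<in> {-1<..<1}" by blast
  then show "-1 < l i" "l i < 1" by auto
qed

text \<open>The Gram matrices of the null-vector valued maps \<open>\<sigma> + \<nu>\<close> and \<open>\<sigma> - \<nu>\<close>, which are smooth
  and whose determinants have quotient \<open>(\<Prod>i. (1 - \<lambda>\<^sub>i) / (1 + \<lambda>\<^sub>i))\<^sup>2\<close>.\<close>

definition gram :: "real \<Rightarrow> ('n \<Rightarrow> real ^ 'n) \<Rightarrow> real ^ 'n \<Rightarrow> real ^ 'n ^ 'n" where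
  "gram s e a = (\<chi> i j. lor (FD (sg c) a (e i) + s *\<^sub>R FD (nu c) a (e i)) (FD (sg c) a (e j) + s *\<^sub>R FD (nu c) a (e j)))"

text \<open>On the eigenframe at a, the map D\<sigma> + s D\<nu> is D\<sigma> scaled by
  \<open>1 - s * l' i\<close>, so the Gram matrix there is diagonal. The frame e belongs to another
  point and enters only through its coefficients.\<close>

lemma det_gram_matrix:
  assumes a: "a \<in> U" and e': "eigenframe a e' l'"
  shows "det (gram s e a) = (det (\<chi> i k. lor (FD (sg c) a (e' k)) (FD (sg c) a (e i))))\<^sup>2 * (\<Prod>i\<in>UNIV. (1 - s * l' i)\<^sup>2)"
  unfolding gram_def
proof (rule det_gram)
  have bl: "bounded_linear (\<lambda>u. FD (sg c) a u + s *\<^sub>R FD (nu c) a u)"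
    by (rule bounded_linear_add[OF bounded_linear_lifts(1)[OF a]
          bounded_linear_compose[OF bounded_linear_scaleR_right bounded_linear_lifts(2)[OF a]]])
  show "bounded_bilinear (\<lambda>u w. lor (FD (sg c) a u + s *\<^sub>R FD (nu c) a u) (FD (sg c) a w + s *\<^sub>R FD (nu c) a w))"
    by (rule bounded_bilinear.comp[OF bounded_bilinear_lor bl bl])
  show "lor (FD (sg c) a (e' i) + s *\<^sub>R FD (nu c) a (e' i)) (FD (sg c) a (e' j) + s *\<^sub>R FD (nu c) a (e' j)) =
      (if i = j then (1 - s * l' i)\<^sup>2 else 0)" for i j
    using orthonormal_frame_first_form[OF e', of i j] orthonormal_frame_first_form[OF e', of j j]
    by (simp add: eigenframe_nu[OF e'] lor_simps power2_eq_square algebra_simps)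
  show "e i = (\<Sum>k\<in>UNIV. lor (FD (sg c) a (e' k)) (FD (sg c) a (e i)) *\<^sub>R e' k)" for i
    by (rule eigenframe_expand[OF a e'])
qed

text \<open>The frames are orthonormal at different points, so the coefficient matrix is not
  orthogonal; the matrix of the expansion in the opposite direction is its inverse.\<close>

lemma frame_change_nonzero:
  assumes a: "a \<in> U" and e': "eigenframe a e' l'" and b: "b \<in> U" and e: "eigenframe b e l"
  shows "det (\<chi> i k. lor (FD (sg c) a (e' k)) (FD (sg c) a (e i))) \<noteq> 0"
proof -
  let ?P = "\<chi> i k. lor (FD (sg c) a (e' k)) (FD (sg c) a (e i))"
  let ?Q = "\<chi> i k. lor (FD (sg c) b (e k)) (FD (sg c) b (e' i))"
  note lin' = linear_right[OF bounded_bilinear_first_form[OF a]]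
  have "(\<Sum>j\<in>UNIV. ?Q $ i $ j * ?P $ j $ k) = (if i = k then 1 else 0)" for i k
  proof -
    have "lor (FD (sg c) a (e' k)) (FD (sg c) a (e' i)) =
        lor (FD (sg c) a (e' k)) (FD (sg c) a (\<Sum>j\<in>UNIV. lor (FD (sg c) b (e j)) (FD (sg c) b (e' i)) *\<^sub>R e j))"
      using eigenframe_expand[OF b e, of "e' i"] by simp
    then show ?thesis
      using orthonormal_frame_first_form[OF e', of k i]
      by (auto simp: linear_sum[OF lin'] linear_cmul[OF lin'])
  qed
  then have "?Q ** ?P = mat 1"
    by (simp add: matrix_matrix_mult_def mat_def vec_eq_iff)
  then have "det ?Q * det ?P = 1" using det_mul[of ?Q ?P] by simp
  then show ?thesis by auto
qed

text \<open>The frame e stays at the base point b while a varies. Its determinant P relative to an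
  eigenframe at a contributes \<open>ln (P\<^sup>2)\<close> to both logarithms and drops
  out.\<close>

lemma f_sigma_gram:
  assumes a: "a \<in> U" and b: "b \<in> U" and e: "eigenframe b e l"
  shows "f_sigma A D \<sigma> \<nu> (chart_inv c a) =
    (1 / (4 * real CARD('n))) * (ln (det (gram (-1) e a)) - ln (det (gram 1 e a)))"
proof -
  obtain e' l' where e': "eigenframe a e' l'" using eigenframe_exists[OF a] by blast
  note l = eigenvalue_bounds[OF a e']
  define P where "P = det (\<chi> i k. lor (FD (sg c) a (e' k)) (FD (sg c) a (e i)))"
  have P: "P \<noteq> 0" unfolding P_def by (rule frame_change_nonzero[OF a e' b e])
  have ln: "ln (det (gram s e a)) = ln (P\<^sup>2) + 2 * (\<Sum>i\<in>UNIV. ln (1 - s * l' i))"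
    if "s = 1 \<or> s = -1" for s
  proof -
    have pos: "1 - s * l' i > 0" for i using l[of i] that by auto
    then have nz: "1 - s * l' i \<noteq> 0" for i using less_imp_neq by (metis)
    have "det (gram s e a) = P\<^sup>2 * (\<Prod>i\<in>UNIV. (1 - s * l' i)\<^sup>2)"
      unfolding P_def by (rule det_gram_matrix[OF a e'])
    moreover have "ln (P\<^sup>2 * (\<Prod>i\<in>UNIV. (1 - s * l' i)\<^sup>2)) = ln (P\<^sup>2) + ln (\<Prod>i\<in>UNIV. (1 - s * l' i)\<^sup>2)"
    proof (rule ln_mult_pos)
      show "(\<Prod>i\<in>UNIV. (1 - s * l' i)\<^sup>2) > 0" by (intro prod_pos zero_less_power pos)
    qed (use P in simp)
    moreover have "ln (\<Prod>i\<in>UNIV. (1 - s * l' i)\<^sup>2) = (\<Sum>i\<in>UNIV. ln ((1 - s * l' i)\<^sup>2))"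
      using nz by (intro ln_prod) auto
    moreover have "ln ((1 - s * l' i)\<^sup>2) = 2 * ln (1 - s * l' i)" for i
      using ln_realpow[of "1 - s * l' i" 2] by simp
    ultimately show ?thesis by (simp add: sum_distrib_left)
  qed
  have "4 * artanh (l' i) = 2 * ln (1 + l' i) - 2 * ln (1 - l' i)" for i
    using l[of i] by (simp add: artanh_def ln_div)
  then have four: "4 * (\<Sum>i\<in>UNIV. artanh (l' i)) = 2 * (\<Sum>i\<in>UNIV. ln (1 + l' i)) - 2 * (\<Sum>i\<in>UNIV. ln (1 - l' i))"
    by (simp add: sum_distrib_left sum_subtractf)
  have f: "f_sigma A D \<sigma> \<nu> (chart_inv c a) = (1 / real CARD('n)) * (\<Sum>i\<in>UNIV. artanh (l' i))"
    by (rule f_sigma_eq) (use chart_point[OF a] e' in auto)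
  have "ln (det (gram (-1) e a)) - ln (det (gram 1 e a)) = 4 * (\<Sum>i\<in>UNIV. artanh (l' i))"
    using ln[of 1] ln[of "-1"] four by simp
  then show ?thesis using f by simp
qed

text \<open>At the base point the Gram matrix is diagonal, so only diagonal entries count. Dividing
  by the determinant removes the entries other than the i-th, and one factor 1 - s \<lambda> of the
  remaining square cancels.\<close>

lemma ln_det_gram_has_derivative:
  assumes a: "a \<in> U" and e: "eigenframe a e l" and s: "s = 1 \<or> s = -1"
  shows "((\<lambda>x. ln (det (gram s e x))) has_derivative
    (\<lambda>k. \<Sum>i\<in>UNIV. 2 * lor (FD2 (sg c) a k (e i) + s *\<^sub>R FD2 (nu c) a k (e i)) (FD (sg c) a (e i)) / (1 - s * l i))) (at a)"
proof -
  let ?R = "\<lambda>i x. FD (sg c) x (e i) + s *\<^sub>R FD (nu c) x (e i)"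
  let ?T = "\<lambda>k i. FD2 (sg c) a k (e i) + s *\<^sub>R FD2 (nu c) a k (e i)"
  have R: "(?R i has_derivative (\<lambda>k. ?T k i)) (at a)" for i
    by (intro has_derivative_add has_derivative_scaleR_right D2_has_derivative[OF a])
  have Ra: "?R i a = (1 - s * l i) *\<^sub>R FD (sg c) a (e i)" for i
    by (simp add: eigenframe_nu[OF e] algebra_simps)
  have pos: "1 - s * l i > 0" for i using eigenvalue_bounds[OF a e, of i] s by auto
  have G: "gram s e a $ i $ j = (if i = j then (1 - s * l i)\<^sup>2 else 0)" for i j
    using orthonormal_frame_first_form[OF e, of i j]
    by (simp add: gram_def Ra lor_simps power2_eq_square)
  have G': "((\<lambda>x. gram s e x $ i $ j) has_derivative (\<lambda>k. lor (?R i a) (?T k j) + lor (?T k i) (?R j a))) (at a)" for i j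
    using lor.FDERIV[OF R[of i] R[of j]] by (simp add: gram_def)
  let ?t = "\<lambda>i. (1 - s * l i)\<^sup>2"
  have t: "?t i > 0" for i using pos[of i] by simp
  have det: "det (gram s e a) = (\<Prod>i\<in>UNIV. ?t i)"
    using det_diagonal[of "gram s e a"] by (simp add: G)
  then have det_pos: "det (gram s e a) > 0" using t by (simp add: prod_pos)
  have D: "((\<lambda>x. det (gram s e x)) has_derivative
      (\<lambda>k. \<Sum>i\<in>UNIV. (lor (?R i a) (?T k i) + lor (?T k i) (?R i a)) * (\<Prod>j\<in>UNIV - {i}. gram s e a $ j $ j))) (at a)"
    by (rule det_has_derivative_diagonal[OF G']) (simp add: G)
  have ln: "(ln has_derivative (*) (inverse (det (gram s e a)))) (at (det (gram s e a)))"
    using DERIV_ln[OF det_pos] by (simp add: has_field_derivative_def)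
  have "inverse (det (gram s e a)) *
      (\<Sum>i\<in>UNIV. (lor (?R i a) (?T k i) + lor (?T k i) (?R i a)) * (\<Prod>j\<in>UNIV - {i}. gram s e a $ j $ j)) =
      (\<Sum>i\<in>UNIV. 2 * lor (?T k i) (FD (sg c) a (e i)) / (1 - s * l i))" for k
    unfolding sum_distrib_left
  proof (rule sum.cong[OF refl])
    fix i
    define R where "R = (\<Prod>j\<in>UNIV - {i}. ?t j)"
    have dR: "det (gram s e a) = ?t i * R"
      unfolding det R_def by (rule prod.remove) auto
    have R0: "R > 0" unfolding R_def by (intro prod_pos t)
    have "(\<Prod>j\<in>UNIV - {i}. gram s e a $ j $ j) = R" by (simp add: R_def G)
    then have q: "inverse (det (gram s e a)) * (\<Prod>j\<in>UNIV - {i}. gram s e a $ j $ j) = inverse (?t i)"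
      using R0 t[of i] by (simp add: dR)
    have "lor (?R i a) (?T k i) + lor (?T k i) (?R i a) = 2 * (1 - s * l i) * lor (?T k i) (FD (sg c) a (e i))"
      unfolding Ra lor_commute[of "(1 - s * l i) *\<^sub>R FD (sg c) a (e i)"] by (simp only: lor.scaleR_right) simp
    then have "inverse (det (gram s e a)) * ((lor (?R i a) (?T k i) + lor (?T k i) (?R i a)) *
        (\<Prod>j\<in>UNIV - {i}. gram s e a $ j $ j)) = inverse (?t i) * (2 * (1 - s * l i) * lor (?T k i) (FD (sg c) a (e i)))"
      using q by (simp add: mult.assoc mult.left_commute)
    also have "\<dots> = 2 * lor (?T k i) (FD (sg c) a (e i)) / (1 - s * l i)"
    proof -
      have "inverse (p\<^sup>2) * (2 * p * z) = 2 * z / p" if "p > 0" for p z :: real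
        using that by (simp add: power2_eq_square field_simps)
      from this[OF pos[of i]] show ?thesis .
    qed
    finally show "inverse (det (gram s e a)) * ((lor (?R i a) (?T k i) + lor (?T k i) (?R i a)) *
        (\<Prod>j\<in>UNIV - {i}. gram s e a $ j $ j)) = 2 * lor (?T k i) (FD (sg c) a (e i)) / (1 - s * l i)" .
  qed
  then show ?thesis
    using has_derivative_compose[OF D ln] by simp
qed

text \<open>The denominators are the squared lengths of the vectors e i in the metric induced by the
  Gauss map, so the sum is the trace of the cubic form for that metric.\<close>

lemma f_sigma_has_derivative:
  assumes a: "a \<in> U" and e: "eigenframe a e l"
  shows "((\<lambda>x. f_sigma A D \<sigma> \<nu> (chart_inv c x)) has_derivative
    (\<lambda>k. (1 / real CARD('n)) * (\<Sum>i\<in>UNIV. cubic a (e i) (e i) k / (1 - (l i)\<^sup>2)))) (at a)"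
proof -
  let ?T = "\<lambda>s k i. 2 * lor (FD2 (sg c) a k (e i) + s *\<^sub>R FD2 (nu c) a k (e i)) (FD (sg c) a (e i)) / (1 - s * l i)"
  have "((\<lambda>x. (1 / (4 * real CARD('n))) * (ln (det (gram (-1) e x)) - ln (det (gram 1 e x)))) has_derivative
      (\<lambda>k. (1 / (4 * real CARD('n))) * ((\<Sum>i\<in>UNIV. ?T (-1) k i) - (\<Sum>i\<in>UNIV. ?T 1 k i)))) (at a)"
    by (intro has_derivative_mult_right has_derivative_diff ln_det_gram_has_derivative[OF a e]) auto
  moreover have "(\<Sum>i\<in>UNIV. ?T (-1) k i) - (\<Sum>i\<in>UNIV. ?T 1 k i) =
      4 * (\<Sum>i\<in>UNIV. cubic a (e i) (e i) k / (1 - (l i)\<^sup>2))" for k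
    unfolding sum_subtractf[symmetric] sum_distrib_left
  proof (rule sum.cong[OF refl])
    fix i
    have b: "1 + l i > 0" "1 - l i > 0" using eigenvalue_bounds[OF a e, of i] by auto
    let ?x = "lor (FD2 (sg c) a k (e i)) (FD (sg c) a (e i))"
    let ?y = "lor (FD2 (nu c) a k (e i)) (FD (sg c) a (e i))"
    \<comment> \<open>Differentiating the Gram matrices puts the direction k first; total symmetry
      of the cubic form moves it to the last slot.\<close>
    have "cubic a (e i) (e i) k = cubic a k (e i) (e i)"
      using cubic_sym12[OF a] cubic_sym23[OF a] by metis
    then have C: "cubic a (e i) (e i) k = - l i * ?x - ?y"
      by (simp add: cubic_def eigenframe_nu[OF e] lor_simps)
    have "?T (-1) k i - ?T 1 k i = 2 * (?x - ?y) / (1 + l i) - 2 * (?x + ?y) / (1 - l i)"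
      by (simp add: lor_simps)
    also have "\<dots> = 4 * ((- l i * ?x - ?y) / ((1 + l i) * (1 - l i)))"
      using b by (simp add: divide_simps) (simp add: algebra_simps)
    also have "(1 + l i) * (1 - l i) = 1 - (l i)\<^sup>2" by (simp add: power2_eq_square algebra_simps)
    finally show "?T (-1) k i - ?T 1 k i = 4 * (cubic a (e i) (e i) k / (1 - (l i)\<^sup>2))"
      by (simp only: C)
  qed
  ultimately have "((\<lambda>x. (1 / (4 * real CARD('n))) * (ln (det (gram (-1) e x)) - ln (det (gram 1 e x)))) has_derivative
      (\<lambda>k. (1 / real CARD('n)) * (\<Sum>i\<in>UNIV. cubic a (e i) (e i) k / (1 - (l i)\<^sup>2)))) (at a)"
    by simp
  then show ?thesis
    by (rule has_derivative_transform_within_open[OF _ U a]) (rule f_sigma_gram[OF _ a e, symmetric])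
qed

end

section \<open>The geodesic flow\<close>

lemma fst_para_J [simp]: "fst (para_J z) = snd z" and snd_para_J [simp]: "snd (para_J z) = fst z"
  by (simp_all add: para_J_def)

lemma bounded_linear_para_J: "bounded_linear para_J"
  unfolding para_J_def[abs_def] by (intro bounded_linear_Pair bounded_linear_snd bounded_linear_fst)

lemma chi_para_J: "chi z = para_J z"
  by (simp add: chi_def para_J_def)

text \<open>Since \<open>para_J\<close> squares to the identity, the flow is the one-parameter group
  exp (t \<open>para_J\<close>) of linear maps of the ambient space.\<close>

lemma flow_para_J: "flow t z = cosh t *\<^sub>R z + sinh t *\<^sub>R para_J z"
  by (simp add: flow_def prod_eq_iff add.commute)

lemma bounded_linear_flow: "bounded_linear (flow t)"
  unfolding flow_para_J[abs_def]
  by (intro bounded_linear_add bounded_linear_compose[OF bounded_linear_scaleR_right]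
      bounded_linear_ident bounded_linear_para_J)

lemma para_J_flow: "para_J (flow t z) = flow t (para_J z)"
  by (simp add: flow_def para_J_def add.commute)

lemma flow_0 [simp]: "flow 0 z = z"
  by (simp add: flow_def)

lemma flow_flow: "flow s (flow t z) = flow (s + t) z"
  by (simp add: flow_def prod_eq_iff cosh_add sinh_add algebra_simps scaleR_add_left)

text \<open>The flat form Q of the overview. It agrees with the para-Sasaki metric on horizontal
  vectors, but on \<open>chi\<close> it gives 2 instead of 1.\<close>

definition split_form :: "'n::finite mink \<times> 'n mink \<Rightarrow> 'n mink \<times> 'n mink \<Rightarrow> real" where
  "split_form \<xi> \<eta> = lor (fst \<xi>) (fst \<eta>) - lor (snd \<xi>) (snd \<eta>)"

lemma bounded_bilinear_split_form: "bounded_bilinear split_form"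
  unfolding split_form_def[abs_def]
  by (rule bounded_bilinear_diff)
    (rule bounded_bilinear.comp[OF bounded_bilinear_lor bounded_linear_fst bounded_linear_fst]
      bounded_bilinear.comp[OF bounded_bilinear_lor bounded_linear_snd bounded_linear_snd])+

interpretation split_form: bounded_bilinear split_form by (rule bounded_bilinear_split_form)

lemma split_form_commute: "split_form \<xi> \<eta> = split_form \<eta> \<xi>"
  by (simp add: split_form_def lor_commute)

lemma cosh_sinh_cancel: "cosh t * cosh t = 1 + sinh t * sinh (t::real)"
  using cosh_square_eq[of t] by (simp add: power2_eq_square)

lemma cosh_sinh_cancel': "cosh t * (cosh t * r) = r + sinh t * (sinh t * (r::real))"
  by (simp add: cosh_sinh_cancel distrib_right flip: mult.assoc)

lemma split_form_flow: "split_form (flow t \<xi>) (flow t \<eta>) = split_form \<xi> \<eta>"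
  by (simp add: split_form_def flow_def lor_simps cosh_sinh_cancel' algebra_simps)

lemma T1H_iff: "z \<in> T1H \<longleftrightarrow> lor (fst z) (fst z) = -1 \<and> snd (fst z) > 0 \<and>
    lor (fst z) (snd z) = 0 \<and> lor (snd z) (snd z) = 1"
  by (auto simp: T1H_def hyp_def case_prod_unfold)

text \<open>In other words, the null vectors x + v and x - v point to the future. This keeps the
  flow on the upper sheet and makes the endpoints at infinity well defined.\<close>

lemma T1H_time_bound:
  assumes "z \<in> T1H"
  shows "\<bar>snd (snd z)\<bar> < snd (fst z)"
proof -
  have z: "lor (fst z) (fst z) = -1" "snd (fst z) > 0" "lor (fst z) (snd z) = 0" "lor (snd z) (snd z) = 1"
    using assms by (auto simp: T1H_iff)
  let ?a = "snd (fst z)" and ?b = "snd (snd z)"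
  have "(?a * ?b)\<^sup>2 = (fst (fst z) \<bullet> fst (snd z))\<^sup>2" using z(3) by (simp add: lor_def)
  also have "\<dots> \<le> (fst (fst z) \<bullet> fst (fst z)) * (fst (snd z) \<bullet> fst (snd z))" by (rule Cauchy_Schwarz_ineq)
  also have "fst (fst z) \<bullet> fst (fst z) = ?a\<^sup>2 - 1" using z(1) by (simp add: lor_def power2_eq_square)
  also have "fst (snd z) \<bullet> fst (snd z) = ?b\<^sup>2 + 1" using z(4) by (simp add: lor_def power2_eq_square)
  finally have "?b\<^sup>2 < ?a\<^sup>2" by (simp add: power_mult_distrib algebra_simps)
  then show ?thesis using z(2) power2_less_imp_less[of "\<bar>?b\<bar>" ?a] by simp
qed

lemma flow_T1H:
  assumes "z \<in> T1H"
  shows "flow t z \<in> T1H"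
proof -
  have z: "lor (fst z) (fst z) = -1" "snd (fst z) > 0" "lor (fst z) (snd z) = 0" "lor (snd z) (snd z) = 1"
    using assms by (auto simp: T1H_iff)
  have z': "lor (snd z) (fst z) = 0" using z(3) by (simp add: lor_commute)
  have "\<bar>sinh t * snd (snd z)\<bar> < cosh t * snd (fst z)"
  proof -
    have "\<bar>sinh t\<bar> \<le> cosh t" using sinh_less_cosh_real[of "\<bar>t\<bar>"] by (simp add: abs_if split: if_splits)
    then have "\<bar>sinh t * snd (snd z)\<bar> \<le> cosh t * \<bar>snd (snd z)\<bar>"
      unfolding abs_mult by (rule mult_right_mono) simp
    also have "\<dots> < cosh t * snd (fst z)"
      using T1H_time_bound[OF assms] by (intro mult_strict_left_mono) auto
    finally show ?thesis .
  qed
  then have "cosh t * snd (fst z) + sinh t * snd (snd z) > 0" by linarith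
  then show ?thesis using z z' by (simp add: T1H_iff flow_def lor_simps cosh_sinh_cancel algebra_simps)
qed

lemma geo_proj_flow: "geo_proj (flow t z) = geo_proj z"
proof -
  have "range (\<lambda>s. flow (s + t) z) = range (\<lambda>s. flow s z)"
  proof (rule equalityI; rule subsetI)
    fix y assume "y \<in> range (\<lambda>s. flow s z)"
    then obtain s where "y = flow (s - t + t) z" by auto
    then show "y \<in> range (\<lambda>s. flow (s + t) z)" by blast
  qed auto
  then show ?thesis by (simp add: geo_proj_def flow_flow)
qed

lemma geo_proj_self: "z \<in> geo_proj z"
  unfolding geo_proj_def by (rule range_eqI[of _ _ 0]) simp

lemma geo_proj_eqD: "geo_proj z = geo_proj z' \<Longrightarrow> \<exists>t. z' = flow t z"
  using geo_proj_self[of z'] by (auto simp: geo_proj_def)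

text \<open>If z' is z moved by time t, then the coefficients are cosh t and sinh t. Written as
  Lorentz products, they depend smoothly on both points, with no need to solve for t.\<close>

lemma orbit_coordinates:
  assumes z: "z \<in> T1H" and eq: "geo_proj z = geo_proj z'"
  shows "z' = (- lor (fst z') (fst z)) *\<^sub>R z + lor (fst z') (snd z) *\<^sub>R para_J z"
proof -
  obtain t where t: "z' = flow t z" using geo_proj_eqD[OF eq] by blast
  have "lor (fst z) (fst z) = -1" "lor (fst z) (snd z) = 0" "lor (snd z) (snd z) = 1" "lor (snd z) (fst z) = 0"
    using z lor_commute[of "snd z" "fst z"] by (auto simp: T1H_iff)
  then have "lor (fst z') (fst z) = - cosh t" "lor (fst z') (snd z) = sinh t"
    by (simp_all add: t flow_def lor_simps)
  then show ?thesis unfolding t flow_para_J by simp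
qed

section \<open>Tangent vectors of the unit tangent bundle\<close>

text \<open>The linearised defining equations of \<open>T1H\<close>, in place of the description by
  spanning vectors in \<open>tangent_T1H\<close>.\<close>

definition T1H_tangent :: "'n::finite mink \<times> 'n mink \<Rightarrow> 'n mink \<times> 'n mink \<Rightarrow> bool" where
  "T1H_tangent z \<xi> \<longleftrightarrow> lor (fst z) (fst \<xi>) = 0 \<and> lor (snd z) (snd \<xi>) = 0 \<and>
     lor (fst z) (snd \<xi>) + lor (snd z) (fst \<xi>) = 0"

lemma T1H_tangent_add: "T1H_tangent z \<xi> \<Longrightarrow> T1H_tangent z \<eta> \<Longrightarrow> T1H_tangent z (\<xi> + \<eta>)"
  by (simp add: T1H_tangent_def lor_simps)

lemma T1H_tangent_scale: "T1H_tangent z \<xi> \<Longrightarrow> T1H_tangent z (r *\<^sub>R \<xi>)"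
  by (simp add: T1H_tangent_def lor_simps flip: distrib_left)

lemma T1H_tangent_chi: "z \<in> T1H \<Longrightarrow> T1H_tangent z (chi z)"
  by (simp add: T1H_tangent_def chi_def T1H_iff lor_commute[of "snd z" "fst z"])

lemma T1H_tangent_flow:
  assumes "T1H_tangent z \<xi>"
  shows "T1H_tangent (flow t z) (flow t \<xi>)"
proof -
  have "lor (fst z) (fst \<xi>) = 0" "lor (snd z) (snd \<xi>) = 0" "lor (fst z) (snd \<xi>) = - lor (snd z) (fst \<xi>)"
    using assms by (auto simp: T1H_tangent_def)
  then show ?thesis
    by (simp add: T1H_tangent_def flow_def lor_simps algebra_simps)
qed

lemma chi_perp_iff:
  assumes "z \<in> T1H"
  shows "\<xi> \<in> chi_perp z \<longleftrightarrow> fst \<xi> \<in> hv_space z \<and> snd \<xi> \<in> hv_space z"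
proof
  have z: "lor (snd z) (snd z) = 1" "lor (fst z) (fst z) = -1" using assms by (auto simp: T1H_iff)
  {
    assume "\<xi> \<in> chi_perp z"
    then obtain a w u where \<xi>: "\<xi> = a *\<^sub>R chi z + (w, 0) + (0, u)" "w \<in> hv_space z" "u \<in> hv_space z"
      and 0: "para_sasaki z \<xi> (chi z) = 0"
      by (auto simp: chi_perp_def tangent_T1H_def)
    have "lor (fst \<xi>) (snd z) = a"
      using \<xi>(2) lor_commute[of w] z by (simp add: \<xi>(1) chi_def lor_simps hv_space_def)
    moreover have "para_sasaki z \<xi> (chi z) = lor (fst \<xi>) (snd z)"
      using z by (simp add: para_sasaki_def chi_def Let_def lor_simps)
    ultimately have "a = 0" using 0 by simp
    then show "fst \<xi> \<in> hv_space z \<and> snd \<xi> \<in> hv_space z" using \<xi> by simp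
  }
  {
    assume h: "fst \<xi> \<in> hv_space z \<and> snd \<xi> \<in> hv_space z"
    then have "\<xi> = 0 *\<^sub>R chi z + (fst \<xi>, 0) + (0, snd \<xi>)" by (simp add: prod_eq_iff)
    then have "\<xi> \<in> tangent_T1H z" using h unfolding tangent_T1H_def by blast
    moreover have "para_sasaki z \<xi> (chi z) = 0"
      using h z lor_commute[of "fst \<xi>" "snd z"]
      by (simp add: para_sasaki_def chi_def Let_def lor_simps hv_space_def)
    ultimately show "\<xi> \<in> chi_perp z" by (simp add: chi_perp_def)
  }
qed

lemma chi_perp_conv:
  assumes "z \<in> T1H"
  shows "\<xi> \<in> chi_perp z \<longleftrightarrow> T1H_tangent z \<xi> \<and> lor (snd z) (fst \<xi>) = 0"
  by (auto simp: chi_perp_iff[OF assms] hv_space_def T1H_tangent_def)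

lemma chi_perp_para_J: "z \<in> T1H \<Longrightarrow> \<xi> \<in> chi_perp z \<Longrightarrow> para_J \<xi> \<in> chi_perp z"
  by (simp add: chi_perp_iff)

lemma para_sasaki_chi_perp:
  assumes "z \<in> T1H" "\<xi> \<in> chi_perp z" "\<eta> \<in> chi_perp z"
  shows "para_sasaki z \<xi> \<eta> = split_form \<xi> \<eta>"
proof -
  have "lor (fst \<xi>) (snd z) = 0" "lor (fst \<eta>) (snd z) = 0"
    using assms lor_commute[of _ "snd z"] by (auto simp: chi_perp_iff hv_space_def)
  then show ?thesis by (simp add: para_sasaki_def split_form_def)
qed

lemma chi_perp_flow:
  assumes "z \<in> T1H" "\<xi> \<in> chi_perp z"
  shows "flow t \<xi> \<in> chi_perp (flow t z)"
  using assms(2) unfolding chi_perp_iff[OF assms(1)] chi_perp_iff[OF flow_T1H[OF assms(1)]]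
  by (simp add: hv_space_def flow_def lor_simps)

lemma T1H_tangent_FD:
  fixes s :: "'e::real_normed_vector \<Rightarrow> 'n::finite mink \<times> 'n mink"
  assumes N: "open N" "b \<in> N" and s: "s differentiable at b" and T: "\<And>b. b \<in> N \<Longrightarrow> s b \<in> T1H"
  shows "T1H_tangent (s b) (FD s b u)"
proof -
  have D: "((\<lambda>b. fst (s b)) has_derivative (\<lambda>u. fst (FD s b u))) (at b)"
    "((\<lambda>b. snd (s b)) has_derivative (\<lambda>u. snd (FD s b u))) (at b)"
    by (rule has_derivative_fst has_derivative_snd, rule FD_has_derivative[OF s])+
  have F: "FD (\<lambda>b. lor (f b) (g b)) b u = lor (f b) (g' u) + lor (f' u) (g b)"
    if "(f has_derivative f') (at b)" "(g has_derivative g') (at b)" for f g :: "'e \<Rightarrow> 'n mink" and f' g'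
    using FD_eq[OF lor.FDERIV[OF that]] by simp
  have "FD (\<lambda>b. lor (fst (s b)) (fst (s b))) b u = 0" "FD (\<lambda>b. lor (fst (s b)) (snd (s b))) b u = 0"
    "FD (\<lambda>b. lor (snd (s b)) (snd (s b))) b u = 0"
    by (rule FD_locally_const[OF N], use T in \<open>simp add: T1H_iff\<close>)+
  then show ?thesis
    using F[OF D(1,1)] F[OF D(1,2)] F[OF D(2,2)] lor_commute[of "fst (FD s b u)"] lor_commute[of "snd (FD s b u)"]
    by (simp add: T1H_tangent_def)
qed

text \<open>The straight line from z in direction \<xi> is corrected by Gram-Schmidt: normalise the
  base point, remove its component from the direction, normalise the direction. The linearised
  equations make all corrections of second order in t, so the velocity at 0 is still \<xi>.\<close>

lemma T1H_curve:
  assumes z: "z \<in> T1H" and \<xi>: "T1H_tangent z \<xi>"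
  shows "\<exists>c e. e > 0 \<and> c 0 = z \<and> (\<forall>t. \<bar>t\<bar> < e \<longrightarrow> c t \<in> T1H) \<and> (c has_vector_derivative \<xi>) (at (0::real))"
proof -
  have Z: "lor (fst z) (fst z) = -1" "snd (fst z) > 0" "lor (fst z) (snd z) = 0" "lor (snd z) (snd z) = 1"
    "lor (snd z) (fst z) = 0" using z lor_commute[of "snd z" "fst z"] by (auto simp: T1H_iff)
  have X: "lor (fst z) (fst \<xi>) = 0" "lor (snd z) (snd \<xi>) = 0" "lor (fst z) (snd \<xi>) + lor (snd z) (fst \<xi>) = 0"
    "lor (fst \<xi>) (fst z) = 0" "lor (snd \<xi>) (snd z) = 0" "lor (snd \<xi>) (fst z) = - lor (fst \<xi>) (snd z)"
    "lor (fst z) (snd \<xi>) = - lor (fst \<xi>) (snd z)" "lor (snd z) (fst \<xi>) = lor (fst \<xi>) (snd z)"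
    using \<xi> lor_commute[of "fst \<xi>"] lor_commute[of "snd \<xi>"] by (auto simp: T1H_tangent_def)
  define \<alpha> \<beta> \<gamma> where "\<alpha> = lor (fst \<xi>) (fst \<xi>)" and "\<beta> = lor (snd \<xi>) (snd \<xi>)" and "\<gamma> = lor (fst \<xi>) (snd \<xi>)"
  define x v where "x t = fst z + t *\<^sub>R fst \<xi>" and "v t = snd z + t *\<^sub>R snd \<xi>" for t
  \<comment> \<open>\<open>m\<close> is minus the square of \<open>x\<close>, and \<open>k\<close>
    the square of \<open>v\<close> after its component along \<open>x\<close> has been
    removed.\<close>
  define m where "m t = 1 - t * t * \<alpha>" for t
  define k where "k t = 1 + t * t * \<beta> + t * t * t * t * \<gamma> * \<gamma> / m t" for t
  define c where "c t = ((1 / sqrt (m t)) *\<^sub>R x t, (1 / sqrt (k t)) *\<^sub>R (v t + (t * t * \<gamma> / m t) *\<^sub>R x t))" for t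
  have xx: "lor (x t) (x t) = - m t" and xv: "lor (x t) (v t) = t * t * \<gamma>" and vv: "lor (v t) (v t) = 1 + t * t * \<beta>" for t
    using Z X lor_commute[of "snd \<xi>" "fst \<xi>"]
    by (auto simp: x_def v_def m_def \<alpha>_def \<beta>_def \<gamma>_def lor_simps algebra_simps)
  have vx: "lor (v t) (x t) = t * t * \<gamma>" for t using xv lor_commute by metis
  have T: "c t \<in> T1H" if "m t > 0" "k t > 0" "snd (x t) > 0" for t
  proof -
    have mm: "m t \<noteq> 0" "sqrt (m t) * sqrt (m t) = m t" "sqrt (k t) * sqrt (k t) = k t" "k t \<noteq> 0" using that by auto
    have 1: "lor (fst (c t)) (fst (c t)) = -1"
      using mm by (simp add: c_def lor_simps xx)
    have "lor (x t) (v t + (t * t * \<gamma> / m t) *\<^sub>R x t) = 0"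
      using mm by (simp add: lor_simps xx xv)
    then have 2: "lor (fst (c t)) (snd (c t)) = 0"
      by (simp add: c_def lor.scaleR_left lor.scaleR_right)
    have "lor (v t + (t * t * \<gamma> / m t) *\<^sub>R x t) (v t + (t * t * \<gamma> / m t) *\<^sub>R x t) = k t"
      using mm by (simp add: lor_simps xx xv vx vv k_def field_simps)
    then have 3: "lor (snd (c t)) (snd (c t)) = 1"
      using mm by (simp add: c_def lor.scaleR_left lor.scaleR_right)
    have "snd (fst (c t)) > 0" using that by (simp add: c_def)
    with 1 2 3 show ?thesis by (simp add: T1H_iff)
  qed
  have "\<forall>\<^sub>F t in nhds 0. m t > 0"
    by (rule order_tendstoD(1)[of m "m 0"]) (auto simp: m_def[abs_def] intro!: tendsto_eq_intros filterlim_ident)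
  moreover have "\<forall>\<^sub>F t in nhds 0. k t > 0"
    by (rule order_tendstoD(1)[of k "k 0"]) (auto simp: k_def[abs_def] m_def[abs_def] intro!: tendsto_eq_intros filterlim_ident)
  moreover have "\<forall>\<^sub>F t in nhds 0. snd (x t) > 0"
    by (rule order_tendstoD(1)[of _ "snd (x 0)"]) (use Z in \<open>auto simp: x_def[abs_def] intro!: tendsto_eq_intros filterlim_ident\<close>)
  ultimately have "\<forall>\<^sub>F t in nhds 0. c t \<in> T1H"
    by eventually_elim (rule T)
  then obtain e where e: "e > 0" "\<And>t. \<bar>t\<bar> < e \<Longrightarrow> c t \<in> T1H"
    by (auto simp: eventually_nhds_metric dist_real_def)
  have dm: "(m has_real_derivative 0) (at 0)"
    unfolding m_def[abs_def] by (auto intro!: derivative_eq_intros)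
  have m0: "m 0 = 1" "k 0 = 1" by (simp_all add: m_def k_def)
  have dk: "(k has_real_derivative 0) (at 0)"
    unfolding k_def[abs_def] by (auto intro!: derivative_eq_intros dm simp: m0)
  have d1: "((\<lambda>t. 1 / sqrt (m t)) has_real_derivative 0) (at 0)"
    by (auto intro!: derivative_eq_intros dm simp: m0)
  have d2: "((\<lambda>t. 1 / sqrt (k t)) has_real_derivative 0) (at 0)"
    by (auto intro!: derivative_eq_intros dk simp: m0)
  have d3: "((\<lambda>t. t * t * \<gamma> / m t) has_real_derivative 0) (at 0)"
    by (auto intro!: derivative_eq_intros dm simp: m0)
  have dx: "(x has_vector_derivative fst \<xi>) (at 0)"
    unfolding x_def[abs_def] by (auto intro!: derivative_eq_intros)
  have dv: "(v has_vector_derivative snd \<xi>) (at 0)"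
    unfolding v_def[abs_def] by (auto intro!: derivative_eq_intros)
  have 1: "((\<lambda>t. (1 / sqrt (m t)) *\<^sub>R x t) has_vector_derivative fst \<xi>) (at 0)"
    using has_vector_derivative_scaleR[OF d1 dx] by (simp add: m0)
  have 2: "((\<lambda>t. v t + (t * t * \<gamma> / m t) *\<^sub>R x t) has_vector_derivative snd \<xi>) (at 0)"
    using has_vector_derivative_add[OF dv has_vector_derivative_scaleR[OF d3 dx]] by simp
  have 3: "((\<lambda>t. (1 / sqrt (k t)) *\<^sub>R (v t + (t * t * \<gamma> / m t) *\<^sub>R x t)) has_vector_derivative snd \<xi>) (at 0)"
    using has_vector_derivative_scaleR[OF d2 2] by (simp add: m0)
  have "(c has_vector_derivative (fst \<xi>, snd \<xi>)) (at 0)"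
    unfolding c_def[abs_def] by (rule has_vector_derivative_Pair[OF 1 3])
  moreover have "c 0 = z" by (simp add: c_def m0 x_def v_def)
  ultimately show ?thesis using e by auto
qed

text \<open>Along a curve in \<open>T1H\<close> with velocity \<xi>, every derivative within
  \<open>T1H\<close> computes the same derivative of a function of a real variable. So
  \<open>d_geo_proj\<close> has a definite value on tangent vectors although
  \<open>frechet_derivative\<close> makes a choice.\<close>

lemma T1H_derivative_unique:
  fixes F :: "'n::finite mink \<times> 'n mink \<Rightarrow> 'b::real_normed_vector"
  assumes z: "z \<in> T1H" and \<xi>: "T1H_tangent z \<xi>"
    and L: "(F has_derivative L) (at z within T1H)" "(F has_derivative L') (at z within T1H)"
  shows "L \<xi> = L' \<xi>"
proof -
  obtain c e where e: "e > 0" and c: "c 0 = z" "\<And>t. \<bar>t\<bar> < e \<Longrightarrow> c t \<in> T1H" "(c has_vector_derivative \<xi>) (at 0)"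
    using T1H_curve[OF z \<xi>] by blast
  have S: "open {-e<..<e}" "(0::real) \<in> {-e<..<e}" using e by auto
  have "((\<lambda>t. F (c t)) has_derivative (\<lambda>t. L (t *\<^sub>R \<xi>))) (at 0)"
    if L: "(F has_derivative L) (at z within T1H)" for L
  proof -
    have "(c has_derivative (\<lambda>t. t *\<^sub>R \<xi>)) (at 0 within {-e<..<e})"
      using c(3) by (simp add: has_vector_derivative_def has_derivative_at_withinI)
    moreover have "(F has_derivative L) (at (c 0) within c ` {-e<..<e})"
      unfolding c(1) by (rule has_derivative_subset[OF L]) (use c(2) in auto)
    ultimately have "((\<lambda>t. F (c t)) has_derivative (\<lambda>t. L (t *\<^sub>R \<xi>))) (at 0 within {-e<..<e})"
      by (rule has_derivative_in_compose)
    then show ?thesis by (simp add: at_within_open[OF S(2,1)])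
  qed
  from has_derivative_unique[OF this[OF L(1)] this[OF L(2)]]
  have "L (1 *\<^sub>R \<xi>) = L' (1 *\<^sub>R \<xi>)" by meson
  then show ?thesis by simp
qed

section \<open>The space of geodesics\<close>

lemma geo_atlasD:
  assumes "c \<in> geo_atlas"
  shows "fst c \<subseteq> geo_proj ` T1H" "inj_on (snd c) (fst c)" "open (snd c ` fst c)"
    "openin (top_of_set T1H) (T1H \<inter> geo_proj -` fst c)"
    "smooth_within (snd c \<circ> geo_proj) (T1H \<inter> geo_proj -` fst c)"
    "\<And>a. a \<in> snd c ` fst c \<Longrightarrow> \<exists>N s. open N \<and> a \<in> N \<and> N \<subseteq> snd c ` fst c \<and> smooth_on s N \<and>
        (\<forall>b\<in>N. s b \<in> T1H \<and> geo_proj (s b) \<in> fst c \<and> snd c (geo_proj (s b)) = b)"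
  using assms unfolding geo_atlas_def by auto

text \<open>The neighbourhood of the local smooth extension is cut down so that it meets
  \<open>T1H\<close> only over the chart domain.\<close>

lemma geo_chart_extension:
  assumes c: "c \<in> geo_atlas" and z: "z \<in> T1H" "geo_proj z \<in> fst c"
  obtains N \<Phi> where "open N" "z \<in> N" "smooth_on \<Phi> N"
    "\<And>y. y \<in> N \<Longrightarrow> y \<in> T1H \<Longrightarrow> geo_proj y \<in> fst c \<and> \<Phi> y = snd c (geo_proj y)"
proof -
  obtain O' where O: "open O'" "T1H \<inter> geo_proj -` fst c = T1H \<inter> O'"
    using geo_atlasD(4)[OF c] by (auto simp: openin_open)
  have zm: "z \<in> T1H \<inter> geo_proj -` fst c" using z by simp
  obtain N \<Phi> where N: "open N" "z \<in> N" "smooth_on \<Phi> N"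
    "\<And>y. y \<in> N \<inter> (T1H \<inter> geo_proj -` fst c) \<Longrightarrow> \<Phi> y = (snd c \<circ> geo_proj) y"
    using geo_atlasD(5)[OF c] zm unfolding smooth_within_def by metis
  show ?thesis
  proof (rule that)
    show "open (N \<inter> O')" using N(1) O(1) by auto
    show "z \<in> N \<inter> O'" using N(2) O(2) zm by auto
    show "smooth_on \<Phi> (N \<inter> O')" by (rule smooth_on_subset[OF N(3)]) auto
    fix y assume y: "y \<in> N \<inter> O'" "y \<in> T1H"
    then have "y \<in> T1H \<inter> geo_proj -` fst c" using O(2) by auto
    then show "geo_proj y \<in> fst c \<and> \<Phi> y = snd c (geo_proj y)" using N(4)[of y] y by auto
  qed
qed

lemma geo_chart_derivative:
  assumes N: "open N" "z \<in> N" "smooth_on \<Phi> N" and z: "z \<in> T1H"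
    and \<Phi>: "\<And>y. y \<in> N \<Longrightarrow> y \<in> T1H \<Longrightarrow> \<Phi> y = snd c (geo_proj y)"
  shows "((snd c \<circ> geo_proj) has_derivative FD \<Phi> z) (at z within T1H)"
proof -
  have D: "(\<Phi> has_derivative FD \<Phi> z) (at z within T1H)"
    by (rule has_derivative_at_withinI[OF FD_has_derivative[OF smooth_on_differentiable[OF N(3,2)]]])
  obtain e where e: "e > 0" "\<And>y. dist y z < e \<Longrightarrow> y \<in> N" using N(1,2) by (auto simp: open_dist)
  show ?thesis
    by (rule has_derivative_transform_within[OF D e(1) z]) (use e(2) \<Phi> in auto)
qed

lemma d_geo_proj_apply:
  assumes c: "c \<in> geo_atlas" "geo_proj z \<in> fst c" and z: "z \<in> T1H" and \<xi>: "T1H_tangent z \<xi>"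
    and L: "((snd c \<circ> geo_proj) has_derivative L) (at z within T1H)"
  shows "d_geo_proj z \<xi> c = L \<xi>"
proof -
  have "((snd c \<circ> geo_proj) has_derivative frechet_derivative (snd c \<circ> geo_proj) (at z within T1H)) (at z within T1H)"
    using L frechet_derivative_works differentiable_def by blast
  then show ?thesis
    using T1H_derivative_unique[OF z \<xi> _ L] c by (simp add: d_geo_proj_def)
qed

lemma d_geo_proj_outside: "\<not> (c \<in> geo_atlas \<and> geo_proj z \<in> fst c) \<Longrightarrow> d_geo_proj z \<xi> c = 0"
  by (auto simp: d_geo_proj_def)

text \<open>Replacing the coordinate map of geodesics by a smooth extension \<Phi> reduces the claim
  to the ordinary chain rule. The map s is any smooth map into \<open>T1H\<close>; besides sections,
  it will be a flow line or the lift of the Gauss map.\<close>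

lemma geo_proj_section:
  fixes s :: "'e::euclidean_space \<Rightarrow> 'n::finite mink \<times> 'n mink"
  assumes c: "c \<in> geo_atlas" and N: "open N" "b \<in> N" and s: "smooth_on s N"
    and T: "\<And>b. b \<in> N \<Longrightarrow> s b \<in> T1H" and b: "geo_proj (s b) \<in> fst c"
  shows "\<exists>N'. open N' \<and> b \<in> N' \<and> N' \<subseteq> N \<and> (\<forall>b\<in>N'. geo_proj (s b) \<in> fst c) \<and>
      smooth_on (\<lambda>b. snd c (geo_proj (s b))) N'"
    and "FD (\<lambda>b. snd c (geo_proj (s b))) b u = d_geo_proj (s b) (FD s b u) c"
proof -
  have sb: "s b \<in> T1H" using T N by blast
  obtain O' \<Phi> where \<Phi>: "open O'" "s b \<in> O'" "smooth_on \<Phi> O'"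
    "\<And>y. y \<in> O' \<Longrightarrow> y \<in> T1H \<Longrightarrow> geo_proj y \<in> fst c \<and> \<Phi> y = snd c (geo_proj y)"
    by (rule geo_chart_extension[OF c sb b]) blast
  define N' where "N' = N \<inter> s -` O'"
  have N': "open N'" "b \<in> N'" "N' \<subseteq> N"
    using continuous_open_preimage[OF smooth_on_continuous[OF s] N(1) \<Phi>(1)] N \<Phi>(2) by (auto simp: N'_def)
  have eq: "geo_proj (s b) \<in> fst c" "\<Phi> (s b) = snd c (geo_proj (s b))" if "b \<in> N'" for b
    using \<Phi>(4)[of "s b"] T that by (auto simp: N'_def)
  have "smooth_on (\<lambda>b. \<Phi> (s b)) N'"
    by (rule smooth_on_compose[OF smooth_on_subset[OF s N'(3)] \<Phi>(3) N'(1)]) (auto simp: N'_def)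
  then have "smooth_on (\<lambda>b. snd c (geo_proj (s b))) N'"
    by (rule smooth_on_cong[OF N'(1), rotated]) (rule eq)
  then show "\<exists>N'. open N' \<and> b \<in> N' \<and> N' \<subseteq> N \<and> (\<forall>b\<in>N'. geo_proj (s b) \<in> fst c) \<and>
      smooth_on (\<lambda>b. snd c (geo_proj (s b))) N'"
    using N' eq(1) by blast
  have sd: "s differentiable at b" by (rule smooth_on_differentiable[OF s N(2)])
  have "((\<lambda>b. \<Phi> (s b)) has_derivative (\<lambda>u. FD \<Phi> (s b) (FD s b u))) (at b)"
    by (rule has_derivative_compose[OF FD_has_derivative[OF sd]
          FD_has_derivative[OF smooth_on_differentiable[OF \<Phi>(3,2)]]])
  then have "((\<lambda>b. snd c (geo_proj (s b))) has_derivative (\<lambda>u. FD \<Phi> (s b) (FD s b u))) (at b)"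
    by (rule has_derivative_transform_within_open[OF _ N'(1,2)]) (rule eq)
  moreover have "d_geo_proj (s b) (FD s b u) c = FD \<Phi> (s b) (FD s b u)"
    by (rule d_geo_proj_apply[OF c b sb T1H_tangent_FD[OF N sd T] geo_chart_derivative[OF \<Phi>(1-3) sb]])
      (use \<Phi>(4) in auto)
  ultimately show "FD (\<lambda>b. snd c (geo_proj (s b))) b u = d_geo_proj (s b) (FD s b u) c"
    by (simp add: FD_eq)
qed

lemma geo_section0:
  assumes c: "c \<in> geo_atlas" and a: "a \<in> snd c ` fst c"
  obtains N s where "open N" "a \<in> N" "N \<subseteq> snd c ` fst c" "smooth_on s N"
    "\<And>b. b \<in> N \<Longrightarrow> s b \<in> T1H" "\<And>b. b \<in> N \<Longrightarrow> geo_proj (s b) = chart_inv c b"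
proof -
  obtain N s where N: "open N" "a \<in> N" "N \<subseteq> snd c ` fst c" "smooth_on s N"
    "\<And>b. b \<in> N \<Longrightarrow> s b \<in> T1H \<and> geo_proj (s b) \<in> fst c \<and> snd c (geo_proj (s b)) = b"
    using geo_atlasD(6)[OF c a] by metis
  have "geo_proj (s b) = chart_inv c b" if "b \<in> N" for b
    using inv_into_f_f[OF geo_atlasD(2)[OF c], of "geo_proj (s b)"] N(5)[OF that] by simp
  then show ?thesis using that N by blast
qed

text \<open>A coordinate change is locally a local section over \<open>c\<close>, followed by the
  projection and the coordinate map of \<open>d\<close>, hence smooth.\<close>

lemma geo_smooth_atlas: "smooth_atlas (geo_atlas :: ('n::finite geodesic, (real ^ 'n) \<times> (real ^ 'n)) chart set)"
proof
  fix c d :: "('n geodesic, (real ^ 'n) \<times> (real ^ 'n)) chart"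
  assume c: "c \<in> geo_atlas"
  show "inj_on (snd c) (fst c)" "open (snd c ` fst c)" by (rule geo_atlasD[OF c])+
  assume d: "d \<in> geo_atlas"
  have *: "\<exists>N. open N \<and> b \<in> N \<and> N \<subseteq> snd c ` (fst c \<inter> fst d) \<and> smooth_on (\<lambda>y. snd d (chart_inv c y)) N"
    if b: "b \<in> snd c ` (fst c \<inter> fst d)" for b
  proof -
    obtain \<gamma> where \<gamma>: "\<gamma> \<in> fst c" "\<gamma> \<in> fst d" "b = snd c \<gamma>" using b by blast
    have bc: "b \<in> snd c ` fst c" using \<gamma> by blast
    have inv_b: "chart_inv c b = \<gamma>" using inv_into_f_f[OF geo_atlasD(2)[OF c] \<gamma>(1)] \<gamma>(3) by simp
    obtain N s where N: "open N" "b \<in> N" "N \<subseteq> snd c ` fst c" "smooth_on s N"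
      and s: "\<And>b. b \<in> N \<Longrightarrow> s b \<in> T1H" "\<And>b. b \<in> N \<Longrightarrow> geo_proj (s b) = chart_inv c b"
      by (rule geo_section0[OF c bc]) blast
    have "geo_proj (s b) \<in> fst d" using s(2)[OF N(2)] inv_b \<gamma> by simp
    from geo_proj_section(1)[OF d N(1,2,4) s(1) this]
    obtain N' where N': "open N'" "b \<in> N'" "N' \<subseteq> N" "\<forall>b\<in>N'. geo_proj (s b) \<in> fst d"
      "smooth_on (\<lambda>b. snd d (geo_proj (s b))) N'" by blast
    have "N' \<subseteq> snd c ` (fst c \<inter> fst d)"
    proof
      fix y assume y: "y \<in> N'"
      then have yN: "y \<in> N" "y \<in> snd c ` fst c" using N' N(3) by auto
      have "chart_inv c y \<in> fst d" using N'(4) y s(2)[OF yN(1)] by metis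
      moreover have "chart_inv c y \<in> fst c" "snd c (chart_inv c y) = y"
        using yN(2) by (auto intro: inv_into_into f_inv_into_f)
      ultimately show "y \<in> snd c ` (fst c \<inter> fst d)" by (metis IntI image_eqI)
    qed
    moreover have "smooth_on (\<lambda>y. snd d (chart_inv c y)) N'"
      by (rule smooth_on_cong[OF N'(1) _ N'(5)]) (use s(2) N'(3) in auto)
    ultimately show ?thesis using N'(1,2) by blast
  qed
  show "open (snd c ` (fst c \<inter> fst d))"
  proof (subst open_subopen, rule ballI)
    fix b assume "b \<in> snd c ` (fst c \<inter> fst d)"
    from *[OF this] show "\<exists>T. open T \<and> b \<in> T \<and> T \<subseteq> snd c ` (fst c \<inter> fst d)" by blast
  qed
  show "smooth_on (\<lambda>y. snd d (chart_inv c y)) (snd c ` (fst c \<inter> fst d))"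
  proof (rule smooth_on_local)
    fix b assume "b \<in> snd c ` (fst c \<inter> fst d)"
    from *[OF this] show "\<exists>N. open N \<and> b \<in> N \<and> smooth_on (\<lambda>y. snd d (chart_inv c y)) N" by blast
  qed
qed

interpretation geo: smooth_atlas geo_atlas by (rule geo_smooth_atlas)

section \<open>The differential of the projection to the space of geodesics\<close>

lemma d_geo_proj_tangent:
  assumes z: "z \<in> T1H" and \<xi>: "T1H_tangent z \<xi>"
  shows "d_geo_proj z \<xi> \<in> tangent_space geo_atlas (geo_proj z)"
proof (rule geo.tangent_spaceI)
  fix c d assume c: "c \<in> geo_atlas" "geo_proj z \<in> fst c" and d: "d \<in> geo_atlas" "geo_proj z \<in> fst d"
  obtain N \<Phi> where \<Phi>: "open N" "z \<in> N" "smooth_on \<Phi> N"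
    "\<And>y. y \<in> N \<Longrightarrow> y \<in> T1H \<Longrightarrow> geo_proj y \<in> fst c \<and> \<Phi> y = snd c (geo_proj y)"
    by (rule geo_chart_extension[OF c(1) z c(2)]) blast
  have \<Phi>z: "\<Phi> z = snd c (geo_proj z)" using \<Phi>(2,4) z by blast
  let ?T = "\<lambda>y. snd d (chart_inv c y)"
  have Dc: "d_geo_proj z \<xi> c = FD \<Phi> z \<xi>"
    by (rule d_geo_proj_apply[OF c z \<xi> geo_chart_derivative[OF \<Phi>(1-3) z]]) (use \<Phi>(4) in auto)
  have "(?T has_derivative FD ?T (snd c (geo_proj z))) (at (\<Phi> z))"
    unfolding \<Phi>z by (rule geo.trans_has_derivative[OF c(1) d(1) c(2) d(2)])
  then have D: "((\<lambda>y. ?T (\<Phi> y)) has_derivative (\<lambda>u. FD ?T (snd c (geo_proj z)) (FD \<Phi> z u))) (at z within T1H)"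
    by (rule has_derivative_compose[OF has_derivative_at_withinI[OF
          FD_has_derivative[OF smooth_on_differentiable[OF \<Phi>(3,2)]]]])
  obtain e where e: "e > 0" "\<And>y. dist y z < e \<Longrightarrow> y \<in> N" using \<Phi>(1,2) by (auto simp: open_dist)
  have "((snd d \<circ> geo_proj) has_derivative (\<lambda>u. FD ?T (snd c (geo_proj z)) (FD \<Phi> z u))) (at z within T1H)"
    by (rule has_derivative_transform_within[OF D e(1) z]) (use e(2) \<Phi>(4) c(1) in auto)
  from d_geo_proj_apply[OF d z \<xi> this]
  show "d_geo_proj z \<xi> d = FD ?T (snd c (geo_proj z)) (d_geo_proj z \<xi> c)" by (simp add: Dc)
qed (rule d_geo_proj_outside)

lemma d_geo_proj_linear_chart:
  assumes z: "z \<in> T1H" and c: "c \<in> geo_atlas" "geo_proj z \<in> fst c"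
  shows "\<exists>L. linear L \<and> (\<forall>\<xi>. T1H_tangent z \<xi> \<longrightarrow> d_geo_proj z \<xi> c = L \<xi>)"
proof -
  obtain N \<Phi> where \<Phi>: "open N" "z \<in> N" "smooth_on \<Phi> N"
    "\<And>y. y \<in> N \<Longrightarrow> y \<in> T1H \<Longrightarrow> geo_proj y \<in> fst c \<and> \<Phi> y = snd c (geo_proj y)"
    by (rule geo_chart_extension[OF c(1) z c(2)]) blast
  have "d_geo_proj z \<xi> c = FD \<Phi> z \<xi>" if "T1H_tangent z \<xi>" for \<xi>
    by (rule d_geo_proj_apply[OF c z that geo_chart_derivative[OF \<Phi>(1-3) z]]) (use \<Phi>(4) in auto)
  moreover have "linear (FD \<Phi> z)" by (rule FD_linear[OF smooth_on_differentiable[OF \<Phi>(3,2)]])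
  ultimately show ?thesis by blast
qed

lemma d_geo_proj_add:
  assumes z: "z \<in> T1H" and \<xi>: "T1H_tangent z \<xi>" "T1H_tangent z \<eta>"
  shows "d_geo_proj z (\<xi> + \<eta>) = d_geo_proj z \<xi> + d_geo_proj z \<eta>"
proof
  fix c
  show "d_geo_proj z (\<xi> + \<eta>) c = (d_geo_proj z \<xi> + d_geo_proj z \<eta>) c"
  proof (cases "c \<in> geo_atlas \<and> geo_proj z \<in> fst c")
    case True
    then obtain L where L: "linear L" "\<And>\<xi>. T1H_tangent z \<xi> \<Longrightarrow> d_geo_proj z \<xi> c = L \<xi>"
      using d_geo_proj_linear_chart[OF z] by blast
    show ?thesis
      using L(2)[OF T1H_tangent_add[OF \<xi>]] L(2)[OF \<xi>(1)] L(2)[OF \<xi>(2)] linear_add[OF L(1)]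
      by (simp add: plus_fun_def)
  qed (simp add: plus_fun_def d_geo_proj_outside)
qed

lemma d_geo_proj_scale:
  assumes z: "z \<in> T1H" and \<xi>: "T1H_tangent z \<xi>"
  shows "d_geo_proj z (r *\<^sub>R \<xi>) = r *\<^sub>R d_geo_proj z \<xi>"
proof
  fix c
  show "d_geo_proj z (r *\<^sub>R \<xi>) c = (r *\<^sub>R d_geo_proj z \<xi>) c"
  proof (cases "c \<in> geo_atlas \<and> geo_proj z \<in> fst c")
    case True
    then obtain L where L: "linear L" "\<And>\<xi>. T1H_tangent z \<xi> \<Longrightarrow> d_geo_proj z \<xi> c = L \<xi>"
      using d_geo_proj_linear_chart[OF z] by blast
    show ?thesis
      using L(2)[OF T1H_tangent_scale[OF \<xi>]] L(2)[OF \<xi>] linear_cmul[OF L(1)]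
      by (simp add: scaleR_fun_def)
  qed (simp add: scaleR_fun_def d_geo_proj_outside)
qed

text \<open>\<open>chi z\<close> is the velocity of the flow line through z, on which the projection
  is constant.\<close>

lemma d_geo_proj_chi:
  assumes z: "z \<in> T1H"
  shows "d_geo_proj z (chi z) = 0"
proof
  fix c
  show "d_geo_proj z (chi z) c = 0 c"
  proof (cases "c \<in> geo_atlas \<and> geo_proj z \<in> fst c")
    case True
    have s: "smooth_on (\<lambda>t. flow t z) UNIV"
      unfolding flow_para_J
      by (rule smooth_on_add[OF smooth_on_scaleR[OF smooth_on_cosh[OF smooth_on_id open_UNIV] smooth_on_const open_UNIV]
            smooth_on_scaleR[OF smooth_on_sinh[OF smooth_on_id open_UNIV] smooth_on_const open_UNIV] open_UNIV])
    have "((\<lambda>t. flow t z) has_derivative (\<lambda>t. t *\<^sub>R chi z)) (at 0)"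
      unfolding flow_para_J chi_para_J by (auto intro!: derivative_eq_intros)
    then have F: "FD (\<lambda>t. flow t z) 0 1 = chi z" using FD_eq by fastforce
    have "FD (\<lambda>t. snd c (geo_proj (flow t z))) 0 1 = d_geo_proj (flow 0 z) (FD (\<lambda>t. flow t z) 0 1) c"
      by (rule geo_proj_section(2)[OF conjunct1[OF True] open_UNIV UNIV_I s flow_T1H[OF z]]) (use True in simp)
    then show ?thesis by (simp add: F geo_proj_flow zero_fun_def)
  qed (simp add: zero_fun_def d_geo_proj_outside)
qed

text \<open>The derivative of \<open>geo_proj (flow t z) = geo_proj z\<close>, where the flow is its
  own derivative because it is linear in z.\<close>

lemma d_geo_proj_flow:
  assumes z: "z \<in> T1H" and \<xi>: "T1H_tangent z \<xi>"
  shows "d_geo_proj (flow t z) (flow t \<xi>) = d_geo_proj z \<xi>"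
proof
  fix c
  have z': "flow t z \<in> T1H" by (rule flow_T1H[OF z])
  show "d_geo_proj (flow t z) (flow t \<xi>) c = d_geo_proj z \<xi> c"
  proof (cases "c \<in> geo_atlas \<and> geo_proj z \<in> fst c")
    case True
    then have c: "c \<in> geo_atlas" "geo_proj z \<in> fst c" "geo_proj (flow t z) \<in> fst c" by (auto simp: geo_proj_flow)
    obtain N \<Phi> where \<Phi>: "open N" "flow t z \<in> N" "smooth_on \<Phi> N"
      "\<And>y. y \<in> N \<Longrightarrow> y \<in> T1H \<Longrightarrow> geo_proj y \<in> fst c \<and> \<Phi> y = snd c (geo_proj y)"
      by (rule geo_chart_extension[OF c(1) z' c(3)]) blast
    have D: "((snd c \<circ> geo_proj) has_derivative FD \<Phi> (flow t z)) (at (flow t z) within T1H)"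
      by (rule geo_chart_derivative[OF \<Phi>(1-3) z']) (use \<Phi>(4) in auto)
    have "((\<lambda>y. (snd c \<circ> geo_proj) (flow t y)) has_derivative (\<lambda>u. FD \<Phi> (flow t z) (flow t u))) (at z within T1H)"
      by (rule has_derivative_in_compose[OF bounded_linear_imp_has_derivative[OF bounded_linear_flow]
            has_derivative_subset[OF D]]) (use flow_T1H in auto)
    then have "((snd c \<circ> geo_proj) has_derivative (\<lambda>u. FD \<Phi> (flow t z) (flow t u))) (at z within T1H)"
      by (simp add: geo_proj_flow comp_def)
    then show ?thesis
      using d_geo_proj_apply[OF c(1,2) z \<xi>] d_geo_proj_apply[OF c(1,3) z' T1H_tangent_flow[OF \<xi>] D] by simp
  qed (simp add: d_geo_proj_outside geo_proj_flow)
qed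

text \<open>A local section from the atlas is moved along the flow, first by a constant time so that
  it passes through z, then by a time linear in the coordinates that makes its derivative at this
  point horizontal. Flowing does not change the geodesics, so it remains a section.\<close>

lemma geo_section:
  assumes c: "c \<in> geo_atlas" "geo_proj z \<in> fst c" and z: "z \<in> T1H"
  obtains N s where "open N" "snd c (geo_proj z) \<in> N" "N \<subseteq> snd c ` fst c" "smooth_on s N"
    "\<And>b. b \<in> N \<Longrightarrow> s b \<in> T1H" "\<And>b. b \<in> N \<Longrightarrow> geo_proj (s b) = chart_inv c b"
    "s (snd c (geo_proj z)) = z" "\<And>u. FD s (snd c (geo_proj z)) u \<in> chi_perp z"
proof -
  let ?y = "snd c (geo_proj z)"
  have y: "?y \<in> snd c ` fst c" using c by blast
  obtain N s0 where N: "open N" "?y \<in> N" "N \<subseteq> snd c ` fst c" and s0: "smooth_on s0 N"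
    "\<And>b. b \<in> N \<Longrightarrow> s0 b \<in> T1H" "\<And>b. b \<in> N \<Longrightarrow> geo_proj (s0 b) = chart_inv c b"
    by (rule geo_section0[OF c(1) y]) blast
  have "geo_proj (s0 ?y) = geo_proj z"
    using s0(3)[OF N(2)] inv_into_f_f[OF geo_atlasD(2)[OF c(1)] c(2)] by simp
  then obtain t where t: "z = flow t (s0 ?y)" using geo_proj_eqD by blast
  define s1 where "s1 b = flow t (s0 b)" for b
  have s1: "smooth_on s1 N"
    unfolding s1_def by (rule smooth_on_linear_comp[OF bounded_linear_flow s0(1) N(1)])
  have s1y: "s1 ?y = z" unfolding s1_def by (rule t[symmetric])
  \<comment> \<open>Minus the \<open>chi\<close>-component of the derivative: to first order,
    flowing for time \<open>\<tau> u\<close> adds \<open>\<tau> u\<close> times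
    \<open>chi z\<close>.\<close>
  define \<tau> where "\<tau> u = - lor (fst (FD s1 ?y u)) (snd z)" for u
  have "bounded_linear (\<lambda>u. lor (fst (FD s1 ?y u)) (snd z))"
    by (rule bounded_linear_compose[OF lor.bounded_linear_left bounded_linear_compose[OF bounded_linear_fst
        FD_bounded_linear[OF smooth_on_differentiable[OF s1 N(2)]]]])
  then have \<tau>: "bounded_linear \<tau>" unfolding \<tau>_def by (rule bounded_linear_minus)
  define s where "s b = flow (\<tau> (b - ?y)) (s1 b)" for b
  have \<tau>0: "\<tau> 0 = 0" using linear_0[OF bounded_linear.linear[OF \<tau>]] .
  have sm\<tau>: "smooth_on (\<lambda>b. \<tau> (b - ?y)) N"
    by (rule smooth_on_linear_comp[OF \<tau> smooth_on_diff[OF smooth_on_id smooth_on_const N(1)] N(1)])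
  have sm: "smooth_on s N"
    unfolding s_def flow_para_J
    by (rule smooth_on_add[OF smooth_on_scaleR[OF smooth_on_cosh[OF sm\<tau> N(1)] s1 N(1)]
          smooth_on_scaleR[OF smooth_on_sinh[OF sm\<tau> N(1)] smooth_on_linear_comp[OF bounded_linear_para_J s1 N(1)] N(1)] N(1)])
  have T: "s b \<in> T1H" if "b \<in> N" for b
    unfolding s_def s1_def by (intro flow_T1H s0(2) that)
  have s_y: "s ?y = z" by (simp add: s_def \<tau>0 s1y)
  have D1: "(s1 has_derivative FD s1 ?y) (at ?y)"
    by (rule FD_has_derivative[OF smooth_on_differentiable[OF s1 N(2)]])
  have D\<tau>: "((\<lambda>b. \<tau> (b - ?y)) has_derivative \<tau>) (at ?y)"
    by (rule has_derivative_eq_rhs[OF bounded_linear.has_derivative[OF \<tau> has_derivative_diff[OF has_derivative_ident has_derivative_const]]]) simp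
  have DJ: "((\<lambda>b. para_J (s1 b)) has_derivative (\<lambda>u. para_J (FD s1 ?y u))) (at ?y)"
    by (rule bounded_linear.has_derivative[OF bounded_linear_para_J D1])
  have cs: "(cosh has_real_derivative 0) (at (\<tau> (?y - ?y)))" "(sinh has_real_derivative 1) (at (\<tau> (?y - ?y)))"
    by (auto intro!: derivative_eq_intros simp: \<tau>0)
  have Dc: "((\<lambda>b. cosh (\<tau> (b - ?y))) has_derivative (\<lambda>u. 0 * \<tau> u)) (at ?y)"
    by (rule has_derivative_compose[OF D\<tau> cs(1)[unfolded has_field_derivative_def]])
  have Ds: "((\<lambda>b. sinh (\<tau> (b - ?y))) has_derivative (\<lambda>u. 1 * \<tau> u)) (at ?y)"
    by (rule has_derivative_compose[OF D\<tau> cs(2)[unfolded has_field_derivative_def]])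
  have "(s has_derivative (\<lambda>u. FD s1 ?y u + \<tau> u *\<^sub>R para_J z)) (at ?y)"
    unfolding s_def flow_para_J
    by (rule has_derivative_eq_rhs[OF has_derivative_add[OF has_derivative_scaleR[OF Dc D1] has_derivative_scaleR[OF Ds DJ]]])
      (simp add: \<tau>0 s1y)
  then have FDs: "FD s ?y u = FD s1 ?y u + \<tau> u *\<^sub>R para_J z" for u
    by (simp add: FD_eq)
  have "FD s ?y u \<in> chi_perp z" for u
  proof -
    have "T1H_tangent z (FD s ?y u)"
      using T1H_tangent_FD[OF N(1,2) smooth_on_differentiable[OF sm N(2)] T] s_y by simp
    moreover have "lor (snd z) (fst (FD s ?y u)) = 0"
      using z lor_commute[of "snd z" "fst (FD s1 ?y u)"] by (simp add: FDs \<tau>_def lor_simps T1H_iff)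
    ultimately show ?thesis by (simp add: chi_perp_conv[OF z])
  qed
  moreover have "geo_proj (s b) = chart_inv c b" if "b \<in> N" for b
    by (simp add: s_def s1_def geo_proj_flow s0(3)[OF that])
  ultimately show ?thesis using that[OF N sm T _ s_y] by blast
qed

section \<open>Charts of the space of geodesics\<close>

definition drop_none :: "real ^ ('n::finite option) \<Rightarrow> real ^ 'n" where
  "drop_none y = (\<chi> i. y $ Some i)"

definition add_none :: "real \<Rightarrow> real ^ 'n \<Rightarrow> real ^ ('n::finite option)" where
  "add_none r p = (\<chi> j. case j of None \<Rightarrow> r | Some i \<Rightarrow> p $ i)"

abbreviation sphere_lift :: "real ^ 'n \<Rightarrow> real ^ ('n::finite option)" where
  "sphere_lift p \<equiv> add_none (sqrt (1 - p \<bullet> p)) p"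

lemma inner_option: "(x :: real ^ ('n::finite option)) \<bullet> y = x $ None * y $ None + drop_none x \<bullet> drop_none y"
proof -
  have "(\<Sum>i\<in>range Some. x $ i * y $ i) = (\<Sum>i\<in>UNIV. x $ Some i * y $ Some i)"
    by (subst sum.reindex) auto
  then show ?thesis
    by (simp add: inner_vec_def drop_none_def UNIV_option_conv)
qed

lemma drop_add_none [simp]: "drop_none (add_none r p) = p"
  by (simp add: drop_none_def add_none_def vec_eq_iff)

lemma add_none_None [simp]: "add_none r p $ None = r"
  by (simp add: add_none_def)

lemma add_drop_none: "add_none (y $ None) (drop_none y) = y"
  by (simp add: drop_none_def add_none_def vec_eq_iff split: option.split)

lemma add_none_eq: "add_none r p = r *\<^sub>R add_none 1 0 + add_none 0 p"
  by (simp add: add_none_def vec_eq_iff split: option.split)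

lemma bounded_linear_drop_none: "bounded_linear drop_none"
  by (simp add: linear_conv_bounded_linear[symmetric]) (rule linearI; simp add: drop_none_def vec_eq_iff)

lemma bounded_linear_add_none: "bounded_linear (add_none 0)"
  by (simp add: linear_conv_bounded_linear[symmetric])
    (rule linearI; simp add: add_none_def vec_eq_iff split: option.split)

section \<open>Endpoints at infinity\<close>

text \<open>For a future null vector, its point on the sphere at infinity.\<close>

definition null_dir :: "'n::finite mink \<Rightarrow> real ^ ('n option)" where
  "null_dir y = inverse (snd y) *\<^sub>R fst y"

abbreviation null_plus :: "'n::finite mink \<times> 'n mink \<Rightarrow> 'n mink" where
  "null_plus z \<equiv> fst z + snd z"

abbreviation null_minus :: "'n::finite mink \<times> 'n mink \<Rightarrow> 'n mink" where
  "null_minus z \<equiv> fst z - snd z"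

lemma null_facts:
  assumes "z \<in> T1H"
  shows "snd (null_plus z) > 0" "snd (null_minus z) > 0" "lor (null_plus z) (null_plus z) = 0"
    "lor (null_minus z) (null_minus z) = 0" "lor (null_plus z) (null_minus z) = -2"
  using T1H_time_bound[OF assms] assms lor_commute[of "snd z" "fst z"]
  by (auto simp: T1H_iff lor_simps)

text \<open>Both null vectors are only rescaled along the flow, so their directions depend on the
  geodesic alone.\<close>

lemma null_flow:
  "null_plus (flow t z) = exp t *\<^sub>R null_plus z" "null_minus (flow t z) = exp (- t) *\<^sub>R null_minus z"
  by (simp_all add: flow_def scaleR_add_left scaleR_diff_left algebra_simps flip: cosh_plus_sinh cosh_minus_sinh)

lemma null_dir_unit:
  assumes "lor y y = 0" "snd y > 0"
  shows "null_dir y \<bullet> null_dir y = 1"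
  using assms by (simp add: null_dir_def lor_def field_simps)

lemma null_dir_scale: "r > 0 \<Longrightarrow> null_dir (r *\<^sub>R y) = null_dir y"
  by (simp add: null_dir_def)

lemma null_dir_eqD:
  assumes "null_dir y = null_dir y'" "snd y > 0" "snd y' > 0"
  shows "y' = (snd y' / snd y) *\<^sub>R y"
proof -
  have "snd y' *\<^sub>R null_dir y' = fst y'" using assms(3) by (simp add: null_dir_def)
  then have "fst y' = (snd y' / snd y) *\<^sub>R fst y"
    unfolding assms(1)[symmetric] by (simp add: null_dir_def divide_inverse)
  then show ?thesis using assms(2) by (simp add: prod_eq_iff)
qed

lemma half_sum_diff:
  fixes A B :: "'v::real_vector"
  shows "(r / 2) *\<^sub>R (A + B) + (r / 2) *\<^sub>R (A - B) = r *\<^sub>R A"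
    "(r / 2) *\<^sub>R (A + B) - (r / 2) *\<^sub>R (A - B) = r *\<^sub>R B"
proof -
  have "(r / 2) *\<^sub>R (A + B) + (r / 2) *\<^sub>R (A - B) = (r / 2) *\<^sub>R A + (r / 2) *\<^sub>R A"
    "(r / 2) *\<^sub>R (A + B) - (r / 2) *\<^sub>R (A - B) = (r / 2) *\<^sub>R B + (r / 2) *\<^sub>R B"
    by (simp_all add: scaleR_add_right scaleR_diff_right)
  then show "(r / 2) *\<^sub>R (A + B) + (r / 2) *\<^sub>R (A - B) = r *\<^sub>R A"
    "(r / 2) *\<^sub>R (A + B) - (r / 2) *\<^sub>R (A - B) = r *\<^sub>R B"
    by (simp_all flip: scaleR_add_left)
qed

text \<open>A geodesic is determined by its endpoints on the sphere at infinity, the directions of the null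
  vectors \<open>x + v\<close> and \<open>x - v\<close>. After rotations, both are parametrised as graphs over a ball.\<close>

locale geodesic_chart =
  fixes Rp Rm :: "real ^ ('n::finite option) \<Rightarrow> real ^ ('n option)"
  assumes Rp: "orthogonal_transformation Rp" and Rm: "orthogonal_transformation Rm"
begin

text \<open>Both rotated endpoints lie in the open hemisphere around the pole
  \<open>None\<close>.\<close>

definition good :: "'n mink \<times> 'n mink \<Rightarrow> bool" where
  "good z \<longleftrightarrow> Rp (fst (null_plus z)) $ None > 0 \<and> Rm (fst (null_minus z)) $ None > 0"

definition coords :: "'n mink \<times> 'n mink \<Rightarrow> (real ^ 'n) \<times> (real ^ 'n)" where
  "coords z = (drop_none (Rp (null_dir (null_plus z))), drop_none (Rm (null_dir (null_minus z))))"

definition chart_dom :: "'n geodesic set" where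
  "chart_dom = geo_proj ` {z \<in> T1H. good z}"

definition chart_map :: "'n geodesic \<Rightarrow> (real ^ 'n) \<times> (real ^ 'n)" where
  "chart_map \<gamma> = coords (SOME z. z \<in> \<gamma>)"

definition Sp :: "real ^ 'n \<Rightarrow> real ^ ('n option)" where "Sp p = inv Rp (sphere_lift p)"

definition Sm :: "real ^ 'n \<Rightarrow> real ^ ('n option)" where "Sm p = inv Rm (sphere_lift p)"

text \<open>For unit vectors the last condition says that the two endpoints are distinct.\<close>

definition W :: "((real ^ 'n) \<times> (real ^ 'n)) set" where
  "W = {b. fst b \<bullet> fst b < 1 \<and> snd b \<bullet> snd b < 1 \<and> Sp (fst b) \<bullet> Sm (snd b) < 1}"

text \<open>The common scale for which the null vectors over the two endpoints have Lorentz product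
  -2, as x + v and x - v must have. Equal scales single out one point on the geodesic.\<close>

definition scl :: "(real ^ 'n) \<times> (real ^ 'n) \<Rightarrow> real" where
  "scl b = sqrt (2 / (1 - Sp (fst b) \<bullet> Sm (snd b)))"

definition sect :: "(real ^ 'n) \<times> (real ^ 'n) \<Rightarrow> 'n mink \<times> 'n mink" where
  "sect b = ((scl b / 2) *\<^sub>R ((Sp (fst b), 1) + (Sm (snd b), 1)),
             (scl b / 2) *\<^sub>R ((Sp (fst b), 1) - (Sm (snd b), 1)))"

lemma linear_R: "linear Rp" "linear Rm" "linear (inv Rp)" "linear (inv Rm)"
  using Rp Rm orthogonal_transformation_inv orthogonal_transformation_linear by blast+

lemma bounded_linear_R: "bounded_linear Rp" "bounded_linear Rm" "bounded_linear (inv Rp)" "bounded_linear (inv Rm)"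
  using linear_R linear_conv_bounded_linear by blast+

lemma inner_R: "Rp x \<bullet> Rp y = x \<bullet> y" "Rm x \<bullet> Rm y = x \<bullet> y" "inv Rp x \<bullet> inv Rp y = x \<bullet> y" "inv Rm x \<bullet> inv Rm y = x \<bullet> y"
  using Rp Rm orthogonal_transformation_inv[OF Rp] orthogonal_transformation_inv[OF Rm]
  by (simp_all add: orthogonal_transformation_def)

lemma inv_R: "inv Rp (Rp x) = x" "inv Rm (Rm x) = x" "Rp (inv Rp x) = x" "Rm (inv Rm x) = x"
  using orthogonal_transformation_bij[OF Rp] orthogonal_transformation_bij[OF Rm]
  by (simp_all add: bij_is_inj bij_is_surj surj_f_inv_f)

lemma good_flow: "good (flow t z) \<longleftrightarrow> good z"
  unfolding good_def null_flow
  by (simp add: linear_cmul[OF linear_R(1)] linear_cmul[OF linear_R(2)] zero_less_mult_iff del: fst_add fst_diff)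

lemma coords_flow: "coords (flow t z) = coords z"
  unfolding coords_def null_flow by (simp add: null_dir_scale)

lemma chart_map_proj: "chart_map (geo_proj z) = coords z"
proof -
  have "(SOME z'. z' \<in> geo_proj z) \<in> geo_proj z" by (rule someI, rule geo_proj_self)
  then obtain t where "(SOME z'. z' \<in> geo_proj z) = flow t z" by (auto simp: geo_proj_def)
  then show ?thesis by (simp add: chart_map_def coords_flow)
qed

lemma chart_dom_iff:
  assumes "z \<in> T1H"
  shows "geo_proj z \<in> chart_dom \<longleftrightarrow> good z"
proof
  assume "geo_proj z \<in> chart_dom"
  then obtain z' where z': "good z'" "geo_proj z = geo_proj z'" by (auto simp: chart_dom_def)
  then obtain t where "z' = flow t z" using geo_proj_eqD by blast
  then show "good z" using z'(1) by (simp add: good_flow)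
qed (use assms in \<open>auto simp: chart_dom_def\<close>)

lemma sphere_lift_drop:
  fixes y :: "real ^ ('n option)"
  assumes "y \<bullet> y = 1" "y $ None > 0"
  shows "sphere_lift (drop_none y) = y" "drop_none y \<bullet> drop_none y < 1"
proof -
  have 1: "drop_none y \<bullet> drop_none y = 1 - (y $ None)\<^sup>2"
    using assms(1) inner_option[of y y] by (simp add: power2_eq_square)
  then have "sqrt (1 - drop_none y \<bullet> drop_none y) = y $ None" using assms(2) by simp
  then show "sphere_lift (drop_none y) = y" by (simp add: add_drop_none)
  show "drop_none y \<bullet> drop_none y < 1" using 1 assms(2) by simp
qed

lemma coords_in_W:
  assumes z: "z \<in> T1H" "good z"
  shows "coords z \<in> W" "Sp (fst (coords z)) = null_dir (null_plus z)" "Sm (snd (coords z)) = null_dir (null_minus z)"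
proof -
  note n = null_facts[OF z(1)]
  let ?p = "Rp (null_dir (null_plus z))" and ?m = "Rm (null_dir (null_minus z))"
  have u: "?p \<bullet> ?p = 1" "?m \<bullet> ?m = 1"
    using null_dir_unit[OF n(3,1)] null_dir_unit[OF n(4,2)] by (simp_all only: inner_R)
  have "?p $ None = inverse (snd (null_plus z)) * Rp (fst (null_plus z)) $ None"
    "?m $ None = inverse (snd (null_minus z)) * Rm (fst (null_minus z)) $ None"
    unfolding null_dir_def linear_cmul[OF linear_R(1)] linear_cmul[OF linear_R(2)] by simp_all
  then have pos: "?p $ None > 0" "?m $ None > 0"
    using z(2) n(1,2) unfolding good_def by (auto simp del: fst_add fst_diff snd_add snd_diff)
  show S: "Sp (fst (coords z)) = null_dir (null_plus z)" "Sm (snd (coords z)) = null_dir (null_minus z)"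
    by (simp_all add: Sp_def Sm_def coords_def sphere_lift_drop(1)[OF u(1) pos(1)] sphere_lift_drop(1)[OF u(2) pos(2)] inv_R)
  define P M where "P = null_plus z" and "M = null_minus z"
  have n': "snd P > 0" "snd M > 0" "fst P \<bullet> fst M = snd P * snd M - 2"
    using n unfolding P_def M_def lor_def by linarith+
  \<comment> \<open>The product -2 of the null vectors makes this 1 - 2 / (P_t M_t), where t marks
    the positive time coordinates.\<close>
  have "null_dir P \<bullet> null_dir M = (snd P * snd M - 2) / (snd P * snd M)"
    by (simp add: null_dir_def n'(3) field_simps)
  also have "\<dots> < 1" using n'(1,2) by (simp add: divide_less_eq)
  finally have "Sp (fst (coords z)) \<bullet> Sm (snd (coords z)) < 1" unfolding S P_def M_def .
  then show "coords z \<in> W"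
    using sphere_lift_drop(2)[OF u(1) pos(1)] sphere_lift_drop(2)[OF u(2) pos(2)]
    by (simp add: W_def coords_def)
qed

lemma S_unit: "p \<bullet> p < 1 \<Longrightarrow> Sp p \<bullet> Sp p = 1" "p \<bullet> p < 1 \<Longrightarrow> Sm p \<bullet> Sm p = 1"
  by (simp_all add: Sp_def Sm_def inner_R inner_option[of "add_none _ _"])

lemma sect_facts:
  assumes b: "b \<in> W"
  shows "sect b \<in> T1H" "good (sect b)" "coords (sect b) = b"
proof -
  have bW: "fst b \<bullet> fst b < 1" "snd b \<bullet> snd b < 1" "Sp (fst b) \<bullet> Sm (snd b) < 1" using b by (auto simp: W_def)
  have sc: "scl b > 0" "scl b * scl b * (Sp (fst b) \<bullet> Sm (snd b) - 1) = -2"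
    using bW(3) by (auto simp: scl_def field_simps)
  have P: "null_plus (sect b) = scl b *\<^sub>R (Sp (fst b), 1)" "null_minus (sect b) = scl b *\<^sub>R (Sm (snd b), 1)"
    unfolding sect_def fst_conv snd_conv by (rule half_sum_diff)+
  have l: "lor (Sp (fst b), 1) (Sp (fst b), 1) = 0" "lor (Sm (snd b), 1) (Sm (snd b), 1) = 0"
    "lor (Sp (fst b), 1) (Sm (snd b), 1) = Sp (fst b) \<bullet> Sm (snd b) - 1"
    "lor (Sm (snd b), 1) (Sp (fst b), 1) = Sp (fst b) \<bullet> Sm (snd b) - 1"
    using S_unit bW by (simp_all add: lor_def inner_commute)
  have q: "(scl b / 2) * (scl b / 2) * (2 * (Sp (fst b) \<bullet> Sm (snd b) - 1)) = -1"
    using sc(2) by (simp add: field_simps)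
  have "lor (fst (sect b)) (fst (sect b)) = (scl b / 2) * (scl b / 2) * (2 * (Sp (fst b) \<bullet> Sm (snd b) - 1))"
    unfolding sect_def fst_conv lor.scaleR_left lor.scaleR_right lor.add_left lor.add_right l by simp
  moreover have "lor (snd (sect b)) (snd (sect b)) = - ((scl b / 2) * (scl b / 2) * (2 * (Sp (fst b) \<bullet> Sm (snd b) - 1)))"
    unfolding sect_def snd_conv lor.scaleR_left lor.scaleR_right lor.diff_left lor.diff_right l by (simp add: field_simps)
  moreover have "lor (fst (sect b)) (snd (sect b)) = 0"
    unfolding sect_def fst_conv snd_conv lor.scaleR_left lor.scaleR_right lor.diff_right lor.add_left l by simp
  ultimately show "sect b \<in> T1H" using q sc(1) by (simp add: T1H_iff) (simp add: sect_def)
  show "good (sect b)"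
    unfolding good_def P using sc(1) bW
    by (simp add: linear_cmul[OF linear_R(1)] linear_cmul[OF linear_R(2)] Sp_def Sm_def inv_R)
  show "coords (sect b) = b"
    unfolding coords_def P null_dir_scale[OF sc(1)] by (simp add: null_dir_def Sp_def Sm_def inv_R)
qed

text \<open>Equal endpoints mean that x + v and x - v are rescaled by positive factors k and m.
  Their product -2 forces k m = 1, which is the effect of the flow for time ln k.\<close>

lemma coords_inj:
  assumes z: "z \<in> T1H" "good z" and z': "z' \<in> T1H" "good z'" and eq: "coords z = coords z'"
  shows "geo_proj z = geo_proj z'"
proof -
  note n = null_facts[OF z(1)] and n' = null_facts[OF z'(1)]
  define k where "k = snd (null_plus z') / snd (null_plus z)"
  define m where "m = snd (null_minus z') / snd (null_minus z)"
  have k: "null_plus z' = k *\<^sub>R null_plus z" unfolding k_def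
    by (rule null_dir_eqD) (use n n' eq coords_in_W(2)[OF z] coords_in_W(2)[OF z'] in auto)
  have m: "null_minus z' = m *\<^sub>R null_minus z" unfolding m_def
    by (rule null_dir_eqD) (use n n' eq coords_in_W(3)[OF z] coords_in_W(3)[OF z'] in auto)
  have k0: "k > 0" unfolding k_def using n(1) n'(1) by (rule divide_pos_pos[rotated])
  have "-2 = k * m * lor (null_plus z) (null_minus z)"
    using n'(5) unfolding k m lor.scaleR_left lor.scaleR_right by (simp add: mult_ac)
  then have "k * m = 1" unfolding n(5) by simp
  then have m': "m = exp (- ln k)" using k0 by (simp add: exp_minus field_simps)
  have "null_plus z' = null_plus (flow (ln k) z)" "null_minus z' = null_minus (flow (ln k) z)"
    unfolding null_flow k m m' using k0 by simp_all
  then have "fst z' + snd z' + (fst z' - snd z') = fst (flow (ln k) z) + snd (flow (ln k) z) + (fst (flow (ln k) z) - snd (flow (ln k) z))"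
    "fst z' + snd z' - (fst z' - snd z') = fst (flow (ln k) z) + snd (flow (ln k) z) - (fst (flow (ln k) z) - snd (flow (ln k) z))"
    by (simp_all only:)
  then have "2 *\<^sub>R fst z' = 2 *\<^sub>R fst (flow (ln k) z)" "2 *\<^sub>R snd z' = 2 *\<^sub>R snd (flow (ln k) z)"
    by (simp_all add: scaleR_2)
  then have "z' = flow (ln k) z" by (simp add: prod_eq_iff)
  then show ?thesis by (simp add: geo_proj_flow)
qed

lemma smooth_sphere_lift: "smooth_on (sphere_lift :: real ^ 'n \<Rightarrow> _) {p. p \<bullet> p < 1}"
proof -
  have op: "open {p :: real ^ 'n. p \<bullet> p < 1}" by (intro open_Collect_less continuous_intros)
  have "smooth_on (\<lambda>p :: real ^ 'n. sqrt (1 - p \<bullet> p) *\<^sub>R add_none 1 0 + add_none 0 p) {p. p \<bullet> p < 1}"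
    by (rule smooth_on_add[OF smooth_on_scaleR[OF smooth_on_sqrt[OF smooth_on_diff[OF smooth_on_const
            smooth_on_inner[OF smooth_on_id smooth_on_id op] op] op] smooth_on_const op]
          smooth_on_bounded_linear[OF bounded_linear_add_none] op]) simp
  then show ?thesis by (simp add: add_none_eq[of "sqrt _"])
qed

lemma smooth_S: "smooth_on Sp {p. p \<bullet> p < 1}" "smooth_on Sm {p. p \<bullet> p < 1}"
proof -
  have op: "open {p :: real ^ 'n. p \<bullet> p < 1}" by (intro open_Collect_less continuous_intros)
  show "smooth_on Sp {p. p \<bullet> p < 1}" "smooth_on Sm {p. p \<bullet> p < 1}"
    unfolding Sp_def[abs_def] Sm_def[abs_def]
    by (rule smooth_on_linear_comp[OF bounded_linear_R(3) smooth_sphere_lift op], rule smooth_on_linear_comp[OF bounded_linear_R(4) smooth_sphere_lift op])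
qed

lemma open_ball2: "open {b :: (real ^ 'n) \<times> (real ^ 'n). fst b \<bullet> fst b < 1 \<and> snd b \<bullet> snd b < 1}"
  by (intro open_Collect_conj open_Collect_less continuous_intros)

lemma smooth_S2:
  "smooth_on (\<lambda>b. Sp (fst b)) {b :: (real ^ 'n) \<times> (real ^ 'n). fst b \<bullet> fst b < 1 \<and> snd b \<bullet> snd b < 1}"
  "smooth_on (\<lambda>b. Sm (snd b)) {b :: (real ^ 'n) \<times> (real ^ 'n). fst b \<bullet> fst b < 1 \<and> snd b \<bullet> snd b < 1}"
proof -
  show "smooth_on (\<lambda>b. Sp (fst b)) {b :: (real ^ 'n) \<times> (real ^ 'n). fst b \<bullet> fst b < 1 \<and> snd b \<bullet> snd b < 1}"
    by (rule smooth_on_compose[where f = fst and g = Sp, OF smooth_on_bounded_linear[OF bounded_linear_fst] smooth_S(1) open_ball2]) auto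
  show "smooth_on (\<lambda>b. Sm (snd b)) {b :: (real ^ 'n) \<times> (real ^ 'n). fst b \<bullet> fst b < 1 \<and> snd b \<bullet> snd b < 1}"
    by (rule smooth_on_compose[where f = snd and g = Sm, OF smooth_on_bounded_linear[OF bounded_linear_snd] smooth_S(2) open_ball2]) auto
qed

lemma open_W: "open W"
proof -
  let ?B = "{b :: (real ^ 'n) \<times> (real ^ 'n). fst b \<bullet> fst b < 1 \<and> snd b \<bullet> snd b < 1}"
  have "continuous_on ?B (\<lambda>b. Sp (fst b) \<bullet> Sm (snd b))"
    by (intro continuous_on_inner smooth_on_continuous smooth_S2)
  then have "open (?B \<inter> (\<lambda>b. Sp (fst b) \<bullet> Sm (snd b)) -` {..<1})"
    by (rule continuous_open_preimage[OF _ open_ball2]) simp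
  moreover have "W = ?B \<inter> (\<lambda>b. Sp (fst b) \<bullet> Sm (snd b)) -` {..<1}" by (auto simp: W_def)
  ultimately show ?thesis by simp
qed

lemma smooth_sect: "smooth_on sect W"
proof -
  have S: "smooth_on (\<lambda>b. Sp (fst b)) W" "smooth_on (\<lambda>b. Sm (snd b)) W"
    by (rule smooth_on_subset[OF smooth_S2(1)] smooth_on_subset[OF smooth_S2(2)]; force simp: W_def)+
  have one: "smooth_on (\<lambda>b. 1 - Sp (fst b) \<bullet> Sm (snd b)) W"
    by (rule smooth_on_diff[OF smooth_on_const smooth_on_inner[OF S open_W] open_W])
  have "smooth_on (\<lambda>b. 2 / (1 - Sp (fst b) \<bullet> Sm (snd b))) W"
    by (rule smooth_on_divide[OF smooth_on_const one open_W]) (auto simp: W_def)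
  then have "smooth_on scl W" unfolding scl_def[abs_def]
    by (rule smooth_on_sqrt[OF _ open_W]) (auto simp: W_def)
  then have "smooth_on (\<lambda>b. (1 / 2) *\<^sub>R scl b) W"
    by (rule smooth_on_linear_comp[OF bounded_linear_scaleR_right _ open_W])
  then have sc: "smooth_on (\<lambda>b. scl b / 2) W" by simp
  note P = smooth_on_Pair[OF S(1) smooth_on_const[of "1 :: real"] open_W]
    smooth_on_Pair[OF S(2) smooth_on_const[of "1 :: real"] open_W]
  show ?thesis unfolding sect_def[abs_def]
    by (rule smooth_on_Pair[OF smooth_on_scaleR[OF sc smooth_on_add[OF P open_W] open_W]
          smooth_on_scaleR[OF sc smooth_on_diff[OF P open_W] open_W] open_W])
qed

lemma smooth_coords: "smooth_on coords {z. snd (null_plus z) > 0 \<and> snd (null_minus z) > 0}"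
  (is "smooth_on _ ?O")
proof -
  have op: "open ?O" by (intro open_Collect_conj open_Collect_less continuous_intros)
  have P: "smooth_on (\<lambda>z :: 'n mink \<times> 'n mink. null_plus z) ?O"
    by (rule smooth_on_bounded_linear[OF bounded_linear_add[OF bounded_linear_fst bounded_linear_snd]])
  have M: "smooth_on (\<lambda>z :: 'n mink \<times> 'n mink. null_minus z) ?O"
    by (rule smooth_on_bounded_linear[OF bounded_linear_sub[OF bounded_linear_fst bounded_linear_snd]])
  have "smooth_on (\<lambda>z :: 'n mink \<times> 'n mink. null_dir (null_plus z)) ?O"
    unfolding null_dir_def
    by (rule smooth_on_scaleR[OF smooth_on_inverse[OF smooth_on_snd[OF P op] op] smooth_on_fst[OF P op] op]) auto
  moreover have "smooth_on (\<lambda>z :: 'n mink \<times> 'n mink. null_dir (null_minus z)) ?O"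
    unfolding null_dir_def
    by (rule smooth_on_scaleR[OF smooth_on_inverse[OF smooth_on_snd[OF M op] op] smooth_on_fst[OF M op] op]) auto
  ultimately show ?thesis unfolding coords_def[abs_def]
    by (intro smooth_on_Pair op smooth_on_linear_comp[OF bounded_linear_drop_none _ op]
        smooth_on_linear_comp[OF bounded_linear_R(1) _ op] smooth_on_linear_comp[OF bounded_linear_R(2) _ op])
qed

lemma open_good: "open {z. good z}"
proof -
  have "continuous_on UNIV (\<lambda>z :: 'n mink \<times> 'n mink. Rp (fst (null_plus z)) $ None)"
    "continuous_on UNIV (\<lambda>z :: 'n mink \<times> 'n mink. Rm (fst (null_minus z)) $ None)"
    by (intro continuous_intros bounded_linear.continuous_on[OF bounded_linear_R(1)] bounded_linear.continuous_on[OF bounded_linear_R(2)])+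
  then show ?thesis unfolding good_def
    by (intro open_Collect_conj open_Collect_less continuous_on_const) auto
qed

lemma chart_in_atlas: "(chart_dom, chart_map) \<in> geo_atlas"
proof -
  have pre: "T1H \<inter> geo_proj -` chart_dom = T1H \<inter> {z. good z}"
    using chart_dom_iff by blast
  have img: "chart_map ` chart_dom = W"
  proof (intro equalityI subsetI)
    show "y \<in> W" if "y \<in> chart_map ` chart_dom" for y
      using that coords_in_W(1) by (auto simp: chart_dom_def chart_map_proj)
    fix b assume b: "b \<in> W"
    then have "geo_proj (sect b) \<in> chart_dom" "chart_map (geo_proj (sect b)) = b"
      using sect_facts[OF b] by (auto simp: chart_dom_def chart_map_proj)
    then show "b \<in> chart_map ` chart_dom" by (metis image_eqI)
  qed
  have inj: "inj_on chart_map chart_dom"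
  proof (rule inj_onI)
    fix \<gamma> \<gamma>' assume "\<gamma> \<in> chart_dom" "\<gamma>' \<in> chart_dom" and eq: "chart_map \<gamma> = chart_map \<gamma>'"
    then obtain z z' where z: "z \<in> T1H" "good z" "\<gamma> = geo_proj z" "z' \<in> T1H" "good z'" "\<gamma>' = geo_proj z'"
      by (auto simp: chart_dom_def)
    have "coords z = coords z'" using eq unfolding z chart_map_proj .
    from coords_inj[OF z(1,2,4,5) this] show "\<gamma> = \<gamma>'" unfolding z .
  qed
  have op: "openin (top_of_set T1H) (T1H \<inter> geo_proj -` chart_dom)"
    unfolding pre using open_good by (auto simp: openin_open)
  have sm: "smooth_within (chart_map \<circ> geo_proj) (T1H \<inter> geo_proj -` chart_dom)"
    unfolding smooth_within_def
  proof (intro ballI exI conjI)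
    let ?O = "{z :: 'n mink \<times> 'n mink. snd (null_plus z) > 0 \<and> snd (null_minus z) > 0}"
    show "open ?O" by (intro open_Collect_conj open_Collect_less continuous_intros)
    show "smooth_on coords ?O" by (rule smooth_coords)
    show "z \<in> ?O" if "z \<in> T1H \<inter> geo_proj -` chart_dom" for z using null_facts(1,2)[of z] that by simp
  qed (simp add: chart_map_proj)
  have sec: "\<exists>N s. open N \<and> a \<in> N \<and> N \<subseteq> chart_map ` chart_dom \<and> smooth_on s N \<and>
      (\<forall>b\<in>N. s b \<in> T1H \<and> geo_proj (s b) \<in> chart_dom \<and> chart_map (geo_proj (s b)) = b)"
    if "a \<in> chart_map ` chart_dom" for a
  proof (intro exI[of _ W] exI[of _ sect] conjI ballI)
    show "open W" "smooth_on sect W" by (rule open_W smooth_sect)+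
    show "a \<in> W" "W \<subseteq> chart_map ` chart_dom" using that img by auto
    fix b assume b: "b \<in> W"
    show "sect b \<in> T1H" "geo_proj (sect b) \<in> chart_dom" "chart_map (geo_proj (sect b)) = b"
      using sect_facts[OF b] by (simp_all add: chart_dom_iff chart_map_proj)
  qed
  have dom: "chart_dom \<subseteq> geo_proj ` T1H" by (auto simp: chart_dom_def)
  have opW: "open (chart_map ` chart_dom)" unfolding img by (rule open_W)
  show ?thesis
    unfolding geo_atlas_def mem_Collect_eq prod.case
    by (rule conjI[OF dom conjI[OF inj conjI[OF opW conjI[OF op conjI[OF sm ballI[OF sec]]]]]])
qed

end

text \<open>Rotations that carry the two endpoints of a given geodesic to the pole provide a chart
  around it. Over a geodesic without a chart the tangent space would be trivial.\<close>

lemma carrier_geo: "carrier geo_atlas = geo_proj ` T1H"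
proof (intro equalityI subsetI)
  fix \<gamma> :: "'n::finite geodesic" assume "\<gamma> \<in> geo_proj ` T1H"
  then obtain z where z: "z \<in> T1H" "\<gamma> = geo_proj z" by blast
  note n = null_facts[OF z(1)]
  have "norm (null_dir (null_plus z)) = norm (axis None 1 :: real ^ ('n option))"
    "norm (null_dir (null_minus z)) = norm (axis None 1 :: real ^ ('n option))"
    using null_dir_unit[OF n(3,1)] null_dir_unit[OF n(4,2)] by (simp_all add: norm_eq_sqrt_inner)
  then obtain Rp Rm :: "real ^ ('n option) \<Rightarrow> real ^ ('n option)" where
    R: "orthogonal_transformation Rp" "Rp (null_dir (null_plus z)) = axis None 1"
      "orthogonal_transformation Rm" "Rm (null_dir (null_minus z)) = axis None 1"
    using orthogonal_transformation_exists by metis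
  interpret geodesic_chart Rp Rm by unfold_locales (rule R)+
  have "fst y = snd y *\<^sub>R null_dir y" if "snd y > 0" for y :: "'n mink"
    using that by (simp add: null_dir_def)
  from this[OF n(1)] this[OF n(2)]
  have "Rp (fst (null_plus z)) = snd (null_plus z) *\<^sub>R axis None 1"
    "Rm (fst (null_minus z)) = snd (null_minus z) *\<^sub>R axis None 1"
    using linear_cmul[OF linear_R(1)] linear_cmul[OF linear_R(2)] R by (metis, metis)
  then have "good z" using n(1,2) unfolding good_def by (simp add: axis_def)
  then have "\<gamma> \<in> chart_dom" using z by (auto simp: chart_dom_def)
  then show "\<gamma> \<in> carrier geo_atlas" using chart_in_atlas by (force simp: carrier_def)
qed (auto simp: carrier_def geo_atlas_def)

section \<open>Horizontal lifts and the metric on the space of geodesics\<close>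

lemma para_J_0: "para_J 0 = 0"
  by (simp add: para_J_def zero_prod_def)

lemma geo_proj_carrier: "z \<in> T1H \<Longrightarrow> geo_proj z \<in> carrier geo_atlas"
  by (simp add: carrier_geo)

text \<open>With a section s and a chart extension \<Phi>, the map
  \<open>k = s \<circ> \<Phi>\<close> moves each point to the section along its orbit. If \<xi>
  projects to 0, then k has derivative 0 along \<xi>. Differentiating the expression of y through
  its orbit coordinates leaves only products of \<xi> with x and v, which vanish for horizontal
  \<xi>.\<close>

lemma d_geo_proj_inj:
  assumes z: "z \<in> T1H" and \<xi>: "\<xi> \<in> chi_perp z" and 0: "d_geo_proj z \<xi> = 0"
  shows "\<xi> = 0"
proof -
  obtain c where c: "c \<in> geo_atlas" "geo_proj z \<in> fst c"
    using geo_proj_carrier[OF z] by (auto simp: carrier_def)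
  obtain N s where N: "open N" "snd c (geo_proj z) \<in> N" "N \<subseteq> snd c ` fst c" "smooth_on s N"
    "\<And>b. b \<in> N \<Longrightarrow> s b \<in> T1H" "\<And>b. b \<in> N \<Longrightarrow> geo_proj (s b) = chart_inv c b"
    "s (snd c (geo_proj z)) = z" "\<And>u. FD s (snd c (geo_proj z)) u \<in> chi_perp z"
    by (rule geo_section[OF c z]) blast
  obtain M \<Phi> where \<Phi>: "open M" "z \<in> M" "smooth_on \<Phi> M"
    "\<And>y. y \<in> M \<Longrightarrow> y \<in> T1H \<Longrightarrow> geo_proj y \<in> fst c \<and> \<Phi> y = snd c (geo_proj y)"
    by (rule geo_chart_extension[OF c(1) z c(2)]) blast
  have \<Phi>z: "\<Phi> z = snd c (geo_proj z)" using \<Phi>(4)[OF \<Phi>(2) z] by simp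
  have tan: "T1H_tangent z \<xi>" using \<xi> by (simp add: chi_perp_conv[OF z])
  have "d_geo_proj z \<xi> c = FD \<Phi> z \<xi>"
    by (rule d_geo_proj_apply[OF c z tan geo_chart_derivative[OF \<Phi>(1-3) z]]) (use \<Phi>(4) in auto)
  then have \<Phi>0: "FD \<Phi> z \<xi> = 0" using 0 by (simp add: zero_fun_def)
  define k where "k y = s (\<Phi> y)" for y
  have kz: "k z = z" by (simp add: k_def \<Phi>z N(7))
  have Ds: "(s has_derivative FD s (\<Phi> z)) (at (\<Phi> z))"
    unfolding \<Phi>z by (rule FD_has_derivative[OF smooth_on_differentiable[OF N(4,2)]])
  define K where "K u = FD s (\<Phi> z) (FD \<Phi> z u)" for u
  have k: "(k has_derivative K) (at z)"
    unfolding k_def[abs_def] K_def[abs_def]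
    by (rule has_derivative_compose[OF FD_has_derivative[OF smooth_on_differentiable[OF \<Phi>(3,2)]] Ds])
  have K0: "K \<xi> = 0" unfolding K_def \<Phi>0 using linear_0[OF has_derivative_linear[OF Ds]] .
  \<comment> \<open>On \<open>T1H\<close> near z this is the identity: the coefficients are cosh and
    sinh of the flow time from \<open>k y\<close> to y.\<close>
  define F where "F y = (- lor (fst y) (fst (k y))) *\<^sub>R k y + lor (fst y) (snd (k y)) *\<^sub>R para_J (k y)" for y
  define F' where "F' u = ((- lor (fst z) (fst (k z))) *\<^sub>R K u + (- (lor (fst z) (fst (K u)) + lor (fst u) (fst (k z)))) *\<^sub>R k z) +
      (lor (fst z) (snd (k z)) *\<^sub>R para_J (K u) + (lor (fst z) (snd (K u)) + lor (fst u) (snd (k z))) *\<^sub>R para_J (k z))" for u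
  have "(F has_derivative F') (at z)"
    unfolding F_def[abs_def] F'_def[abs_def]
    by (intro has_derivative_add has_derivative_scaleR has_derivative_minus k has_derivative_ident
        lor.FDERIV has_derivative_fst has_derivative_snd bounded_linear.has_derivative[OF bounded_linear_para_J])
  then have F: "(F has_derivative F') (at z within T1H)" by (rule has_derivative_at_withinI)
  define O' where "O' = M \<inter> \<Phi> -` N"
  have O: "open O'" "z \<in> O'"
    using continuous_open_preimage[OF smooth_on_continuous[OF \<Phi>(3)] \<Phi>(1) N(1)] \<Phi>(2) N(2) \<Phi>z by (auto simp: O'_def)
  have Fy: "F y = y" if y: "y \<in> O'" "y \<in> T1H" for y
  proof -
    have y': "\<Phi> y \<in> N" "\<Phi> y = snd c (geo_proj y)" "geo_proj y \<in> fst c" using y \<Phi>(4)[of y] by (auto simp: O'_def)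
    then have "geo_proj (k y) = geo_proj y"
      using N(6)[OF y'(1)] geo.chart_inv_eq[OF c(1) y'(3)] by (simp add: k_def)
    from orbit_coordinates[OF _ this] N(5)[OF y'(1)] show ?thesis by (simp add: F_def k_def)
  qed
  obtain e where e: "e > 0" "\<And>y. dist y z < e \<Longrightarrow> y \<in> O'" using O by (auto simp: open_dist)
  have "((\<lambda>y. y) has_derivative F') (at z within T1H)"
    by (rule has_derivative_transform_within[OF F e(1) z]) (use e(2) Fy in auto)
  from T1H_derivative_unique[OF z tan this has_derivative_ident] have "F' \<xi> = \<xi>" .
  moreover have "lor (fst \<xi>) (fst z) = 0" "lor (fst \<xi>) (snd z) = 0"
    using \<xi> lor_commute[of "fst \<xi>"] by (auto simp: chi_perp_iff[OF z] hv_space_def)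
  ultimately show ?thesis
    by (simp add: F'_def K0 kz lor_simps para_J_0)
qed

lemma chi_perp_tangent: "z \<in> T1H \<Longrightarrow> \<xi> \<in> chi_perp z \<Longrightarrow> T1H_tangent z \<xi>"
  by (simp add: chi_perp_conv)

lemma chi_perp_diff: "z \<in> T1H \<Longrightarrow> \<xi> \<in> chi_perp z \<Longrightarrow> \<eta> \<in> chi_perp z \<Longrightarrow> \<xi> - \<eta> \<in> chi_perp z"
  by (simp add: chi_perp_iff hv_space_def lor_simps)

lemma d_geo_proj_diff:
  assumes z: "z \<in> T1H" and \<xi>: "T1H_tangent z \<xi>" "T1H_tangent z \<eta>"
  shows "d_geo_proj z (\<xi> - \<eta>) = d_geo_proj z \<xi> - d_geo_proj z \<eta>"
  using d_geo_proj_add[OF z \<xi>(1) T1H_tangent_scale[OF \<xi>(2), of "-1"]] d_geo_proj_scale[OF z \<xi>(2), of "-1"]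
  by simp

lemma d_geo_proj_injD:
  assumes "z \<in> T1H" "\<xi> \<in> chi_perp z" "\<eta> \<in> chi_perp z" "d_geo_proj z \<xi> = d_geo_proj z \<eta>"
  shows "\<xi> = \<eta>"
  using d_geo_proj_inj[OF assms(1) chi_perp_diff[OF assms(1-3)]]
    d_geo_proj_diff[OF assms(1) chi_perp_tangent[OF assms(1,2)] chi_perp_tangent[OF assms(1,3)]] assms(4) by simp

lemma horizontal_lift_eq:
  assumes "z \<in> T1H" "\<xi> \<in> chi_perp z"
  shows "horizontal_lift z (d_geo_proj z \<xi>) = \<xi>"
  unfolding horizontal_lift_def using assms d_geo_proj_injD[OF assms(1)] by (intro the_equality) auto

lemma geo_proj_some: "\<exists>t. (SOME z'. z' \<in> geo_proj z) = flow t z"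
proof -
  have "(SOME z'. z' \<in> geo_proj z) \<in> geo_proj z" by (rule someI, rule geo_proj_self)
  then show ?thesis by (auto simp: geo_proj_def)
qed

text \<open>The representative chosen in \<open>geo_metric\<close> lies on the flow line of z.
  Horizontal lifts at it arise by the flow, which preserves \<open>split_form\<close>.\<close>

lemma geo_metric_horizontal:
  assumes z: "z \<in> T1H" and \<xi>: "\<xi> \<in> chi_perp z" and \<eta>: "\<eta> \<in> chi_perp z"
  shows "geo_metric (geo_proj z) (d_geo_proj z \<xi>) (d_geo_proj z \<eta>) = split_form \<xi> \<eta>"
proof -
  obtain t where t: "(SOME z'. z' \<in> geo_proj z) = flow t z" using geo_proj_some by blast
  have lift: "horizontal_lift (flow t z) (d_geo_proj z \<xi>) = flow t \<xi>" if "\<xi> \<in> chi_perp z" for \<xi>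
    using horizontal_lift_eq[OF flow_T1H[OF z] chi_perp_flow[OF z that], of t]
      d_geo_proj_flow[OF z chi_perp_tangent[OF z that]] by simp
  show ?thesis
    unfolding geo_metric_def Let_def t lift[OF \<xi>] lift[OF \<eta>]
      para_sasaki_chi_perp[OF flow_T1H[OF z] chi_perp_flow[OF z \<xi>] chi_perp_flow[OF z \<eta>]]
    by (rule split_form_flow)
qed

lemma geo_J_horizontal:
  assumes z: "z \<in> T1H" and \<xi>: "\<xi> \<in> chi_perp z"
  shows "geo_J (geo_proj z) (d_geo_proj z \<xi>) = d_geo_proj z (para_J \<xi>)"
proof -
  obtain t where t: "(SOME z'. z' \<in> geo_proj z) = flow t z" using geo_proj_some by blast
  have lift: "horizontal_lift (flow t z) (d_geo_proj z \<xi>) = flow t \<xi>"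
    using horizontal_lift_eq[OF flow_T1H[OF z] chi_perp_flow[OF z \<xi>], of t]
      d_geo_proj_flow[OF z chi_perp_tangent[OF z \<xi>]] by simp
  show ?thesis
    unfolding geo_J_def Let_def t lift para_J_flow
    by (rule d_geo_proj_flow[OF z chi_perp_tangent[OF z chi_perp_para_J[OF z \<xi>]]])
qed

text \<open>Subtracting the \<open>chi\<close>-component makes a vector horizontal without changing
  its projection. The coefficient arises as -2 - 2 + 2: each cross term with \<open>chi\<close>
  contributes -2, the square of \<open>chi\<close> contributes 2.\<close>

lemma geo_metric_tangent:
  assumes z: "z \<in> T1H" and \<xi>: "T1H_tangent z \<xi>" and \<eta>: "T1H_tangent z \<eta>"
  shows "geo_metric (geo_proj z) (d_geo_proj z \<xi>) (d_geo_proj z \<eta>) =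
    split_form \<xi> \<eta> - 2 * (lor (fst \<xi>) (snd z) * lor (fst \<eta>) (snd z))"
proof -
  have Z: "lor (snd z) (snd z) = 1" "lor (fst z) (fst z) = -1" using z by (auto simp: T1H_iff)
  have hor: "\<xi> - lor (fst \<xi>) (snd z) *\<^sub>R chi z \<in> chi_perp z \<and>
      d_geo_proj z (\<xi> - lor (fst \<xi>) (snd z) *\<^sub>R chi z) = d_geo_proj z \<xi>" if \<xi>: "T1H_tangent z \<xi>" for \<xi>
  proof
    let ?a = "lor (fst \<xi>) (snd z)"
    note c = T1H_tangent_scale[OF T1H_tangent_chi[OF z], of ?a]
    have "T1H_tangent z (\<xi> - ?a *\<^sub>R chi z)"
      using T1H_tangent_add[OF \<xi> T1H_tangent_scale[OF c, of "-1"]] by simp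
    then show "\<xi> - ?a *\<^sub>R chi z \<in> chi_perp z"
      using Z by (simp add: chi_perp_conv[OF z] lor_simps chi_def lor_commute[of "snd z" "fst \<xi>"])
    show "d_geo_proj z (\<xi> - ?a *\<^sub>R chi z) = d_geo_proj z \<xi>"
      using d_geo_proj_diff[OF z \<xi> c] d_geo_proj_scale[OF z T1H_tangent_chi[OF z], of ?a] d_geo_proj_chi[OF z] by simp
  qed
  have chi: "split_form (chi z) \<eta> = 2 * lor (fst \<eta>) (snd z)" if "T1H_tangent z \<eta>" for \<eta>
    using that lor_commute[of "fst \<eta>" "snd z"] by (simp add: split_form_def chi_def T1H_tangent_def)
  have cc: "split_form (chi z) (chi z) = 2" using Z by (simp add: split_form_def chi_def)
  have "geo_metric (geo_proj z) (d_geo_proj z \<xi>) (d_geo_proj z \<eta>) =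
      split_form (\<xi> - lor (fst \<xi>) (snd z) *\<^sub>R chi z) (\<eta> - lor (fst \<eta>) (snd z) *\<^sub>R chi z)"
    using geo_metric_horizontal[OF z conjunct1[OF hor[OF \<xi>]] conjunct1[OF hor[OF \<eta>]]] hor[OF \<xi>] hor[OF \<eta>] by simp
  also have "\<dots> = split_form \<xi> \<eta> - lor (fst \<eta>) (snd z) * split_form (chi z) \<xi> -
      lor (fst \<xi>) (snd z) * split_form (chi z) \<eta> + lor (fst \<xi>) (snd z) * lor (fst \<eta>) (snd z) * split_form (chi z) (chi z)"
    by (simp add: split_form.diff_left split_form.diff_right split_form.scaleR_left split_form.scaleR_right
        split_form_commute[of \<xi> "chi z"] algebra_simps)
  finally show ?thesis unfolding chi[OF \<xi>] chi[OF \<eta>] cc by simp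
qed

text \<open>A section followed by the projection is the identity in coordinates, so its derivative
  along u projects to the tangent vector with coordinates u.\<close>

lemma section_tvec:
  assumes d: "d \<in> geo_atlas" and N: "open N" "N \<subseteq> snd d ` fst d" and s: "smooth_on s N"
    and T: "\<And>b. b \<in> N \<Longrightarrow> s b \<in> T1H" and p: "\<And>b. b \<in> N \<Longrightarrow> geo_proj (s b) = chart_inv d b" and b: "b \<in> N"
  shows "tvec_of geo_atlas (chart_inv d b) d u = d_geo_proj (s b) (FD s b u)"
proof -
  have q: "chart_inv d b \<in> fst d" "geo_proj (s b) \<in> fst d"
    using geo.chart_inv_in[OF subsetD[OF N(2) b]] p[OF b] by simp_all
  have tan: "T1H_tangent (s b) (FD s b u)"
    by (rule T1H_tangent_FD[OF N(1) b smooth_on_differentiable[OF s b] T])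
  have "FD (\<lambda>b. snd d (geo_proj (s b))) b u = FD (\<lambda>b. b) b u"
  proof (rule fun_cong[OF FD_cong[OF N(1) b]])
    show "snd d (geo_proj (s y)) = y" if "y \<in> N" for y
      unfolding p[OF that] by (rule geo.chart_eq_inv[OF subsetD[OF N(2) that]])
  qed
  then have "d_geo_proj (s b) (FD s b u) d = u"
    using geo_proj_section(2)[OF d N(1) b s T q(2), of u] by simp
  then show ?thesis
    by (intro geo.tangent_eqI[OF geo.tvec_of_in[OF d q(1)] _ d q(1)])
      (use d_geo_proj_tangent[OF T[OF b] tan] p[OF b] geo.tvec_of_same[OF d q(1)] in auto)
qed

lemma geo_jet:
  fixes DD :: "('n::finite geodesic, (real ^ 'n) \<times> (real ^ 'n)) conn"
  assumes lc: "levi_civita geo_atlas geo_metric DD" and z: "z \<in> T1H"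
    and d: "d = chart_at geo_atlas (geo_proj z)" and y0: "y0 = snd d (geo_proj z)"
    and N: "open N" "y0 \<in> N" "N \<subseteq> snd d ` fst d" and s: "smooth_on s N"
    and T: "\<And>b. b \<in> N \<Longrightarrow> s b \<in> T1H" and p: "\<And>b. b \<in> N \<Longrightarrow> geo_proj (s b) = chart_inv d b"
    and sy: "s y0 = z" and hor: "\<And>u. FD s y0 u \<in> chi_perp z"
  shows "lc_jet geo_atlas geo_metric DD (geo_proj z) s split_form N d y0"
proof
  have dg: "d \<in> geo_atlas" "geo_proj z \<in> fst d" unfolding d using geo.chart_at[OF geo_proj_carrier[OF z]] by auto
  have inv_y0: "chart_inv d y0 = geo_proj z" unfolding y0 by (rule geo.chart_inv_eq[OF dg])
  note tv = section_tvec[OF dg(1) N(1,3) s T p]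
  have tv0: "tvec_of geo_atlas (geo_proj z) d u = d_geo_proj z (FD s y0 u)" for u
    using tv[OF _ _ N(2), of u] by (simp add: sy inv_y0)
  show at: "geo_metric (geo_proj z) (tvec_of geo_atlas (geo_proj z) d u) (tvec_of geo_atlas (geo_proj z) d w) =
      split_form (FD s y0 u) (FD s y0 w)" for u w
    unfolding tv0 by (rule geo_metric_horizontal[OF z hor hor])
  have coord: "X = tvec_of geo_atlas (geo_proj z) d (X d)" if "X \<in> tangent_space geo_atlas (geo_proj z)" for X
    by (rule geo.tvec_of_coord[OF that dg, symmetric])
  show "geo_metric (geo_proj z) X Y = geo_metric (geo_proj z) Y X"
    if "X \<in> tangent_space geo_atlas (geo_proj z)" "Y \<in> tangent_space geo_atlas (geo_proj z)" for X Y
    by (subst (1 2) coord[OF that(1)], subst (1 2) coord[OF that(2)]) (simp only: at split_form_commute)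
  have linF: "linear (FD s y0)" by (rule FD_linear[OF smooth_on_differentiable[OF s N(2)]])
  show "geo_metric (geo_proj z) (X + Y) Z = geo_metric (geo_proj z) X Z + geo_metric (geo_proj z) Y Z"
    if X: "X \<in> tangent_space geo_atlas (geo_proj z)" and Y: "Y \<in> tangent_space geo_atlas (geo_proj z)"
      and Z: "Z \<in> tangent_space geo_atlas (geo_proj z)" for X Y Z
  proof -
    have XY: "X + Y \<in> tangent_space geo_atlas (geo_proj z)"
      by (rule subspace_add[OF geo.tangent_subspace X Y])
    have g: "geo_metric (geo_proj z) X Z = split_form (FD s y0 (X d)) (FD s y0 (Z d))"
      if "X \<in> tangent_space geo_atlas (geo_proj z)" for X
      using at[of "X d" "Z d"] coord[OF that] coord[OF Z] by simp
    show ?thesis unfolding g[OF XY] g[OF X] g[OF Y]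
      by (simp add: plus_fun_def linear_add[OF linF] split_form.add_left)
  qed
  show "((\<lambda>y. geo_metric (chart_inv d y) (tvec_of geo_atlas (chart_inv d y) d u) (tvec_of geo_atlas (chart_inv d y) d w))
      has_derivative (\<lambda>k. split_form (FD2 s y0 k u) (FD s y0 w) + split_form (FD s y0 u) (FD2 s y0 k w))) (at y0)" for u w
  proof -
    let ?a = "\<lambda>u y. lor (fst (FD s y u)) (snd (s y))"
    have D: "((\<lambda>y. FD s y u) has_derivative (\<lambda>k. FD2 s y0 k u)) (at y0)" for u
      by (rule FD_has_derivative[OF smooth_on_differentiable[OF smooth_on_FD[OF s] N(2)]])
    have Ds: "(s has_derivative FD s y0) (at y0)" by (rule FD_has_derivative[OF smooth_on_differentiable[OF s N(2)]])
    have a0: "?a u y0 = 0" for u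
      using hor[of u] lor_commute[of "fst (FD s y0 u)"] by (simp add: sy chi_perp_conv[OF z])
    define a' where "a' u h = lor (fst (FD s y0 u)) (snd (FD s y0 h)) + lor (fst (FD2 s y0 h u)) (snd (s y0))" for u h
    have a': "(?a u has_derivative a' u) (at y0)" for u
      unfolding a'_def[abs_def] by (rule lor.FDERIV[OF has_derivative_fst[OF D] has_derivative_snd[OF Ds]])
    \<comment> \<open>Both factors of the correction term vanish at \<open>y0\<close>, so it
      contributes nothing to the derivative.\<close>
    have "((\<lambda>y. split_form (FD s y u) (FD s y w) - 2 * (?a u y * ?a w y)) has_derivative
        (\<lambda>k. (split_form (FD s y0 u) (FD2 s y0 k w) + split_form (FD2 s y0 k u) (FD s y0 w)) -
          2 * (?a u y0 * a' w k + a' u k * ?a w y0))) (at y0)"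
      by (intro has_derivative_diff split_form.FDERIV D has_derivative_mult_right has_derivative_mult a')
    then have "((\<lambda>y. split_form (FD s y u) (FD s y w) - 2 * (?a u y * ?a w y)) has_derivative
        (\<lambda>k. split_form (FD2 s y0 k u) (FD s y0 w) + split_form (FD s y0 u) (FD2 s y0 k w))) (at y0)"
      by (simp add: a0 add.commute)
    then show ?thesis
    proof (rule has_derivative_transform_within_open[OF _ N(1,2)])
      fix y assume y: "y \<in> N"
      have tan: "T1H_tangent (s y) (FD s y u)" for u
        by (rule T1H_tangent_FD[OF N(1) y smooth_on_differentiable[OF s y] T])
      have "geo_metric (geo_proj (s y)) (d_geo_proj (s y) (FD s y u)) (d_geo_proj (s y) (FD s y w)) =
          split_form (FD s y u) (FD s y w) - 2 * (?a u y * ?a w y)"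
        by (rule geo_metric_tangent[OF T[OF y] tan tan])
      then show "split_form (FD s y u) (FD s y w) - 2 * (?a u y * ?a w y) =
          geo_metric (chart_inv d y) (tvec_of geo_atlas (chart_inv d y) d u) (tvec_of geo_atlas (chart_inv d y) d w)"
        using tv[OF _ _ y, of u] tv[OF _ _ y, of w] p[OF y] by simp
    qed
  qed
qed (use assms geo_proj_carrier[OF z] bounded_bilinear_split_form split_form_commute in auto)

section \<open>Second derivatives\<close>

lemma FD2_linear_comp:
  assumes h: "bounded_linear h" and f: "smooth_on f S" and S: "open S" "x \<in> S"
  shows "FD2 (\<lambda>x. h (f x)) x u w = h (FD2 f x u w)"
proof -
  have 1: "FD (\<lambda>x. h (g x)) y v = h (FD g y v)" if "smooth_on g S" "y \<in> S" for g y v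
    using FD_eq[OF bounded_linear.has_derivative[OF h FD_has_derivative[OF smooth_on_differentiable[OF that]]]] by simp
  have "FD2 (\<lambda>x. h (f x)) x u w = FD (\<lambda>y. h (FD f y w)) x u"
    by (rule fun_cong[OF FD_cong[OF S]]) (rule 1[OF f])
  then show ?thesis by (simp add: 1[OF smooth_on_FD[OF f] S(2)])
qed

lemma FD_add:
  assumes "f differentiable at x" "g differentiable at x"
  shows "FD (\<lambda>x. f x + g x) x u = FD f x u + FD g x u"
  using FD_eq[OF has_derivative_add[OF FD_has_derivative[OF assms(1)] FD_has_derivative[OF assms(2)]]] by simp

lemma FD2_mult:
  fixes f g :: "'a::real_normed_vector \<Rightarrow> real"
  assumes f: "smooth_on f S" and g: "smooth_on g S" and S: "open S" "x \<in> S"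
  shows "FD2 (\<lambda>x. f x * g x) x u w =
    (f x * FD2 g x u w + FD f x u * FD g x w) + (FD f x w * FD g x u + FD2 f x u w * g x)"
proof -
  note d = smooth_on_differentiable
  have "FD2 (\<lambda>x. f x * g x) x u w = FD (\<lambda>y. f y * FD g y w + FD f y w * g y) x u"
    by (rule fun_cong[OF FD_cong[OF S]]) (rule FD_bilinear[OF bounded_bilinear_mult d[OF f] d[OF g]])
  also have "\<dots> = FD (\<lambda>y. f y * FD g y w) x u + FD (\<lambda>y. FD f y w * g y) x u"
    by (rule FD_add[OF d[OF smooth_on_mult[OF f smooth_on_FD[OF g] S(1)] S(2)]
          d[OF smooth_on_mult[OF smooth_on_FD[OF f] g S(1)] S(2)]])
  also have "FD (\<lambda>y. f y * FD g y w) x u = f x * FD2 g x u w + FD f x u * FD g x w"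
    by (rule FD_bilinear[OF bounded_bilinear_mult d[OF f S(2)] d[OF smooth_on_FD[OF g] S(2)]])
  also have "FD (\<lambda>y. FD f y w * g y) x u = FD f x w * FD g x u + FD2 f x u w * g x"
    by (rule FD_bilinear[OF bounded_bilinear_mult d[OF smooth_on_FD[OF f] S(2)] d[OF g S(2)]])
  finally show ?thesis .
qed

lemma FD2_add:
  assumes f: "smooth_on f S" and g: "smooth_on g S" and S: "open S" "x \<in> S"
  shows "FD2 (\<lambda>x. f x + g x) x u w = FD2 f x u w + FD2 g x u w"
proof -
  note d = smooth_on_differentiable
  have "FD2 (\<lambda>x. f x + g x) x u w = FD (\<lambda>y. FD f y w + FD g y w) x u"
    by (rule fun_cong[OF FD_cong[OF S]]) (rule FD_add[OF d[OF f] d[OF g]])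
  also have "\<dots> = FD2 f x u w + FD2 g x u w"
    by (rule FD_add[OF d[OF smooth_on_FD[OF f] S(2)] d[OF smooth_on_FD[OF g] S(2)]])
  finally show ?thesis .
qed

text \<open>A derivative is linear in its direction, which is the first slot; symmetry transfers
  this to the second.\<close>

lemma bounded_bilinear_FD2:
  fixes f :: "'a::euclidean_space \<Rightarrow> 'b::euclidean_space"
  assumes f: "smooth_on f S" and S: "open S" "x \<in> S"
  shows "bounded_bilinear (FD2 f x)"
proof -
  note d = smooth_on_differentiable
  have l1: "linear (\<lambda>u. FD2 f x u w)" for w
    by (rule FD_linear[OF d[OF smooth_on_FD[OF f] S(2)]])
  have "(\<lambda>w. FD2 f x u w) = (\<lambda>w. FD2 f x w u)" for u
    using FD2_sym[OF f S] by blast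
  then have "linear (\<lambda>w. FD2 f x u w)" for u using l1 by simp
  then have "bilinear (FD2 f x)" using l1 by (simp add: bilinear_def)
  then show ?thesis by (simp add: bilinear_conv_bounded_bilinear)
qed

text \<open>Moving a lift along the flow, by a time whose value and derivative vanish at \<open>a\<close>, does not
  change the pairing of its second derivative with horizontal vectors.\<close>

lemma FD2_reparametrized:
  fixes k \<zeta> :: "'e::euclidean_space \<Rightarrow> 'n::finite mink \<times> 'n mink"
  assumes M: "open M" "a \<in> M" and k: "smooth_on k M" and \<zeta>: "smooth_on \<zeta> M" and C: "smooth_on C M" and S: "smooth_on S M"
    and eq: "\<And>b. b \<in> M \<Longrightarrow> k b = C b *\<^sub>R \<zeta> b + S b *\<^sub>R para_J (\<zeta> b)"
    and 0: "C a = 1" "S a = 0" "\<And>u. FD C a u = 0" "\<And>u. FD S a u = 0"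
    and \<eta>: "split_form (\<zeta> a) \<eta> = 0" "split_form (para_J (\<zeta> a)) \<eta> = 0"
  shows "split_form (FD2 k a u w) \<eta> = split_form (FD2 \<zeta> a u w) \<eta>"
proof -
  let ?h = "\<lambda>\<xi>. split_form \<xi> \<eta>"
  have h: "bounded_linear ?h" by (rule split_form.bounded_linear_left)
  have hJ: "bounded_linear (\<lambda>\<xi>. ?h (para_J \<xi>))"
    by (rule bounded_linear_compose[OF h bounded_linear_para_J])
  have p: "smooth_on (\<lambda>b. ?h (\<zeta> b)) M" by (rule smooth_on_linear_comp[OF h \<zeta> M(1)])
  have r: "smooth_on (\<lambda>b. ?h (para_J (\<zeta> b))) M" by (rule smooth_on_linear_comp[OF hJ \<zeta> M(1)])
  have "?h (FD2 k a u w) = FD2 (\<lambda>b. ?h (k b)) a u w"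
    by (rule FD2_linear_comp[OF h k M, symmetric])
  also have "\<dots> = FD2 (\<lambda>b. C b * ?h (\<zeta> b) + S b * ?h (para_J (\<zeta> b))) a u w"
  proof (rule fun_cong[OF FD_cong[OF M]])
    fix y assume y: "y \<in> M"
    show "FD (\<lambda>b. ?h (k b)) y w = FD (\<lambda>b. C b * ?h (\<zeta> b) + S b * ?h (para_J (\<zeta> b))) y w"
      by (rule fun_cong[OF FD_cong[OF M(1) y]]) (simp add: eq split_form.add_left split_form.scaleR_left)
  qed
  also have "\<dots> = FD2 (\<lambda>b. C b * ?h (\<zeta> b)) a u w + FD2 (\<lambda>b. S b * ?h (para_J (\<zeta> b))) a u w"
    by (rule FD2_add[OF smooth_on_mult[OF C p M(1)] smooth_on_mult[OF S r M(1)] M])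
  also have "\<dots> = FD2 (\<lambda>b. ?h (\<zeta> b)) a u w"
    unfolding FD2_mult[OF C p M] FD2_mult[OF S r M] by (simp add: 0 \<eta>)
  also have "\<dots> = ?h (FD2 \<zeta> a u w)" by (rule FD2_linear_comp[OF h \<zeta> M])
  finally show ?thesis .
qed

section \<open>The Gauss map\<close>

lemma chi_perp_0: "z \<in> T1H \<Longrightarrow> 0 \<in> chi_perp z"
  by (simp add: chi_perp_iff hv_space_def lor_simps)

lemma chi_perp_add: "z \<in> T1H \<Longrightarrow> \<xi> \<in> chi_perp z \<Longrightarrow> \<eta> \<in> chi_perp z \<Longrightarrow> \<xi> + \<eta> \<in> chi_perp z"
  by (simp add: chi_perp_iff hv_space_def lor_simps)

lemma chi_perp_scale: "z \<in> T1H \<Longrightarrow> \<xi> \<in> chi_perp z \<Longrightarrow> r *\<^sub>R \<xi> \<in> chi_perp z"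
  by (simp add: chi_perp_iff hv_space_def lor_simps)

lemma d_geo_proj_sum:
  assumes z: "z \<in> T1H" and \<xi>: "\<And>i. i \<in> I \<Longrightarrow> \<xi> i \<in> chi_perp z" and I: "finite I"
  shows "(\<Sum>i\<in>I. \<xi> i) \<in> chi_perp z \<and> d_geo_proj z (\<Sum>i\<in>I. \<xi> i) = (\<Sum>i\<in>I. d_geo_proj z (\<xi> i))"
  using I \<xi>
proof (induction I)
  case empty
  have "d_geo_proj z (0 *\<^sub>R 0) = 0 *\<^sub>R d_geo_proj z 0"
    by (rule d_geo_proj_scale[OF z chi_perp_tangent[OF z chi_perp_0[OF z]]])
  then show ?case by (simp add: chi_perp_0[OF z])
next
  case (insert i I)
  then have IH: "sum \<xi> I \<in> chi_perp z" "d_geo_proj z (sum \<xi> I) = (\<Sum>i\<in>I. d_geo_proj z (\<xi> i))"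
    and i: "\<xi> i \<in> chi_perp z" by auto
  show ?case
    using chi_perp_add[OF z i IH(1)] d_geo_proj_add[OF z chi_perp_tangent[OF z i] chi_perp_tangent[OF z IH(1)]]
      insert.hyps IH(2) by simp
qed

locale gauss_map_point = small_hypersurface_chart A \<sigma> \<nu> D c U
  for A :: "('a, real ^ 'n::finite) chart set" and \<sigma> :: "'a \<Rightarrow> 'n mink" and \<nu> :: "'a \<Rightarrow> 'n hyp_tvec"
    and D :: "('n mink, real ^ ('n option)) conn" and c :: "('a, real ^ 'n) chart" and U :: "(real ^ 'n) set" +
  fixes DD :: "('n geodesic, (real ^ 'n) \<times> (real ^ 'n)) conn" and q :: 'a and a0 :: "real ^ 'n"
    and e :: "'n \<Rightarrow> real ^ 'n" and l :: "'n \<Rightarrow> real"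
  assumes lc_geo: "levi_civita geo_atlas geo_metric DD"
    and q: "q \<in> fst c" and a0: "a0 = snd c q" and e: "eigenframe a0 e l"
begin

sublocale geo_pair: atlas_pair A geo_atlas ..

abbreviation G where "G \<equiv> gauss_map \<sigma> \<nu>"

definition zeta :: "real ^ 'n \<Rightarrow> 'n mink \<times> 'n mink" where
  "zeta a = (sg c a, nu c a)"

abbreviation z where "z \<equiv> zeta a0"

abbreviation dz where "dz \<equiv> FD zeta a0"

lemma a0U: "a0 \<in> U"
  using q by (simp add: a0 U_def)

lemma zeta_T1H: "a \<in> U \<Longrightarrow> zeta a \<in> T1H"
  using point_facts[of a] sg_in[OF c] by (simp add: zeta_def T1H_def U_def)

lemma z_T1H: "z \<in> T1H"
  by (rule zeta_T1H[OF a0U])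

lemma zeta_smooth: "smooth_on zeta U"
  unfolding zeta_def[abs_def] by (rule smooth_on_Pair[OF smooth U])

lemma FD_zeta: "a \<in> U \<Longrightarrow> FD zeta a u = (FD (sg c) a u, FD (nu c) a u)"
  using FD_eq[OF has_derivative_Pair[OF FD_has_derivative[OF differentiable_lifts(1)] FD_has_derivative[OF differentiable_lifts(2)]]]
  by (simp add: zeta_def[abs_def])

lemma FD2_zeta: "a \<in> U \<Longrightarrow> FD2 zeta a u w = (FD2 (sg c) a u w, FD2 (nu c) a u w)"
proof -
  assume a: "a \<in> U"
  have "FD2 zeta a u w = FD (\<lambda>y. (FD (sg c) y w, FD (nu c) y w)) a u"
    by (rule fun_cong[OF FD_cong[OF U a]]) (rule FD_zeta)
  then show ?thesis
    using FD_eq[OF has_derivative_Pair[OF D2_has_derivative[OF a]]] by simp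
qed

lemma dz_linear: "linear dz"
  by (rule FD_linear[OF smooth_on_differentiable[OF zeta_smooth a0U]])

lemma dz_bounded_linear: "bounded_linear dz"
  by (rule FD_bounded_linear[OF smooth_on_differentiable[OF zeta_smooth a0U]])

text \<open>The \<open>chi\<close>-component of the derivative is the product of \<nu> with a
  tangent vector of the hypersurface.\<close>

lemma FD_zeta_horizontal: "a \<in> U \<Longrightarrow> FD zeta a u \<in> chi_perp (zeta a)"
  using point_facts(4,5)[of a u] nu_facts(1,2)[of a u]
  by (simp add: chi_perp_iff[OF zeta_T1H] hv_space_def FD_zeta) (simp add: zeta_def)

lemma dz_horizontal: "dz u \<in> chi_perp z"
  by (rule FD_zeta_horizontal[OF a0U])

lemma J_dz_horizontal: "para_J (dz u) \<in> chi_perp z"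
  by (rule chi_perp_para_J[OF z_T1H dz_horizontal])

lemma gauss_zeta: "G (chart_inv c a) = geo_proj (zeta a)"
  by (simp add: gauss_map_def zeta_def sg_def nu_def)

lemma Gq: "G q = geo_proj z"
  using gauss_zeta[of a0] c q by (simp add: a0)

text \<open>The symmetry of the second fundamental form again: the Gauss map is Lagrangian, and
  \<open>para_J\<close> maps its tangent vectors to normal vectors.\<close>

lemma lagrangian: "split_form (dz u) (para_J (dz w)) = 0"
  using nu_facts(3)[OF a0U, of u w] lor_commute[of "FD (nu c) a0 u"]
  by (simp add: split_form_def FD_zeta[OF a0U])

lemma split_form_cubic: "split_form (FD2 zeta a0 u w) (para_J (dz k)) = cubic a0 u w k"
  by (simp add: split_form_def FD_zeta[OF a0U] FD2_zeta[OF a0U] cubic_def)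

lemma gauss_rep:
  assumes d: "d \<in> geo_atlas" and a: "a \<in> U" "geo_proj (zeta a) \<in> fst d"
  obtains M where "a \<in> M" "M \<subseteq> U" "smooth_rep c d G M"
proof -
  obtain M where M: "open M" "a \<in> M" "M \<subseteq> U" "\<forall>b\<in>M. geo_proj (zeta b) \<in> fst d"
    "smooth_on (\<lambda>b. snd d (geo_proj (zeta b))) M"
    using geo_proj_section(1)[OF d U a(1) zeta_smooth zeta_T1H a(2)] by blast
  have "smooth_rep c d G M"
    unfolding smooth_rep_def gauss_zeta using M U_def by simp
  then show ?thesis using that M(2,3) by blast
qed

lemma differential_gauss:
  assumes q': "q' \<in> fst c" and X: "X \<in> tangent_space A q'"
  shows "differential A geo_atlas G q' X = d_geo_proj (zeta (snd c q')) (FD zeta (snd c q') (X c))"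
proof -
  have a: "snd c q' \<in> U" using q' by (simp add: U_def)
  have Gq': "G q' = geo_proj (zeta (snd c q'))" using gauss_zeta[of "snd c q'"] c q' by simp
  obtain d where d: "d \<in> geo_atlas" "geo_proj (zeta (snd c q')) \<in> fst d"
    using geo_proj_carrier[OF zeta_T1H[OF a]] by (auto simp: carrier_def)
  obtain M where M: "snd c q' \<in> M" "M \<subseteq> U" "smooth_rep c d G M"
    by (rule gauss_rep[OF d(1) a d(2)])
  note D = geo_pair.differential_in[OF c q' d(1) X M(3,1)]
  have "differential A geo_atlas G q' X d = d_geo_proj (zeta (snd c q')) (FD zeta (snd c q') (X c)) d"
    unfolding D(2) gauss_zeta
    by (rule geo_proj_section(2)[OF d(1) U a zeta_smooth zeta_T1H d(2)])
  moreover have "d_geo_proj (zeta (snd c q')) (FD zeta (snd c q') (X c)) \<in> tangent_space geo_atlas (G q')"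
    unfolding Gq' by (rule d_geo_proj_tangent[OF zeta_T1H[OF a] chi_perp_tangent[OF zeta_T1H[OF a] FD_zeta_horizontal[OF a]]])
  ultimately show ?thesis
    using geo.tangent_eqI[OF D(1) _ d(1)] d(2) Gq' by simp
qed

text \<open>The projection is onto on horizontal vectors, because the section of
  \<open>geo_section\<close> has horizontal derivatives at z and its projection realises every
  coordinate vector.\<close>

lemma tangent_space_lift:
  assumes "Z \<in> tangent_space geo_atlas (geo_proj z)"
  obtains \<xi> where "\<xi> \<in> chi_perp z" "Z = d_geo_proj z \<xi>"
proof -
  obtain d where d: "d \<in> geo_atlas" "geo_proj z \<in> fst d"
    using geo_proj_carrier[OF z_T1H] by (auto simp: carrier_def)
  obtain N s where N: "open N" "snd d (geo_proj z) \<in> N" "N \<subseteq> snd d ` fst d" "smooth_on s N"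
    "\<And>b. b \<in> N \<Longrightarrow> s b \<in> T1H" "\<And>b. b \<in> N \<Longrightarrow> geo_proj (s b) = chart_inv d b"
    "s (snd d (geo_proj z)) = z" "\<And>u. FD s (snd d (geo_proj z)) u \<in> chi_perp z"
    by (rule geo_section[OF d z_T1H]) blast
  have "tvec_of geo_atlas (chart_inv d (snd d (geo_proj z))) d (Z d) =
      d_geo_proj (s (snd d (geo_proj z))) (FD s (snd d (geo_proj z)) (Z d))"
    by (rule section_tvec[OF d(1) N(1,3,4) _ _ N(2)]) (rule N(5,6), assumption)+
  then have "Z = d_geo_proj z (FD s (snd d (geo_proj z)) (Z d))"
    using geo.tvec_of_coord[OF assms d] geo.chart_inv_eq[OF d] N(7) by simp
  then show ?thesis using that N(8) by blast
qed

section \<open>Second fundamental form of the Gauss map\<close>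

text \<open>\<open>cov_along_metric\<close> differentiates the Gauss map lifted by the section s,
  that is, \<open>k = s \<circ> g\<close>. Since k and \<open>zeta\<close> project to the same
  geodesics, they differ by a flow time. Both have horizontal derivatives at \<open>a0\<close>, so
  this time vanishes there to first order, and k may be replaced by \<open>zeta\<close> in pairings
  with horizontal vectors. The last term comes from differentiating the field E and is tangent to
  the Gauss map.\<close>

lemma cov_along_gauss:
  assumes W: "openin (mfd_topology A) W" "q \<in> W" and E: "smooth_vector_field A W E" and \<eta>: "\<eta> \<in> chi_perp z"
  shows "cov_along A geo_atlas DD G (\<lambda>r. differential A geo_atlas G r (E r)) q (E q) \<in> tangent_space geo_atlas (geo_proj z)"
    and "geo_metric (geo_proj z) (cov_along A geo_atlas DD G (\<lambda>r. differential A geo_atlas G r (E r)) q (E q)) (d_geo_proj z \<eta>) =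
      split_form (FD2 zeta a0 (E q c) (E q c)) \<eta> +
      split_form (dz (FD (\<lambda>a. E (chart_inv c a) c) a0 (E q c))) \<eta>"
proof -
  define d where "d = chart_at geo_atlas (geo_proj z)"
  have d: "d \<in> geo_atlas" "geo_proj z \<in> fst d" unfolding d_def using geo.chart_at[OF geo_proj_carrier[OF z_T1H]] by auto
  define y0 where "y0 = snd d (geo_proj z)"
  obtain N s where N: "open N" "y0 \<in> N" "N \<subseteq> snd d ` fst d" "smooth_on s N"
    and s: "\<And>b. b \<in> N \<Longrightarrow> s b \<in> T1H" "\<And>b. b \<in> N \<Longrightarrow> geo_proj (s b) = chart_inv d b"
    "s y0 = z" "\<And>u. FD s y0 u \<in> chi_perp z"
    unfolding y0_def by (rule geo_section[OF d z_T1H]) blast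
  obtain M where M: "a0 \<in> M" "M \<subseteq> U" "smooth_rep c d G M"
    by (rule gauss_rep[OF d(1) a0U d(2)])
  interpret J: lc_jet geo_atlas geo_metric DD "geo_proj z" s split_form N d y0
    by (rule geo_jet[OF lc_geo z_T1H d_def y0_def N s])
  interpret J: lc_jet_along A geo_atlas geo_metric DD "geo_proj z" s split_form N d y0 G c q M
    by unfold_locales (use c q Gq M a0 in auto)
  let ?Y = "\<lambda>r. differential A geo_atlas G r (E r)"
  define g where "g a = snd d (G (chart_inv c a))" for a
  define h where "h a = E (chart_inv c a) c" for a
  define V where "V = snd c ` (W \<inter> fst c)"
  have Msm: "open M" "smooth_on g M" using M(3) by (simp_all add: smooth_rep_def g_def[abs_def])
  have V: "open V" "a0 \<in> V" "smooth_on h V"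
    using W q E c by (auto simp: V_def a0 A.openin_mfd h_def[abs_def] smooth_vector_field_def)
  have Vp: "chart_inv c a \<in> W" "chart_inv c a \<in> fst c" "snd c (chart_inv c a) = a" if "a \<in> V" for a
    using that c by (auto simp: V_def)
  have g0: "g a0 = y0" using c q Gq by (simp add: g_def a0 y0_def)
  have h0: "h a0 = E q c" using c q by (simp add: h_def a0)
  have Eq: "E q \<in> tangent_space A q" using E W(2) by (simp add: smooth_vector_field_def)
  define O' where "O' = (M \<inter> g -` N) \<inter> V"
  have O: "open O'" "a0 \<in> O'" "O' \<subseteq> M" "O' \<subseteq> V" "g ` O' \<subseteq> N"
    using continuous_open_preimage[OF smooth_on_continuous[OF Msm(2)] Msm(1) N(1)] V M(1) N(2) g0
    by (auto simp: O'_def)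
  have OU: "O' \<subseteq> U" using O(3) M(2) by blast
  have gO: "smooth_on g O'" and hO: "smooth_on h O'" and zO: "smooth_on zeta O'"
    by (rule smooth_on_subset[OF Msm(2) O(3)], rule smooth_on_subset[OF V(3) O(4)], rule smooth_on_subset[OF zeta_smooth OU])
  have Yd: "?Y (chart_inv c a) d = FD g a (h a)" if a: "a \<in> O'" for a
  proof -
    have aV: "a \<in> V" using a O(4) by auto
    have aM: "snd c (chart_inv c a) \<in> M" using Vp(3)[OF aV] O(3) a by auto
    have "E (chart_inv c a) \<in> tangent_space A (chart_inv c a)"
      using E Vp(1)[OF aV] by (simp add: smooth_vector_field_def)
    from geo_pair.differential_in(2)[OF c Vp(2)[OF aV] d(1) this M(3) aM]
    show ?thesis by (simp add: Vp(3)[OF aV] g_def[abs_def] h_def)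
  qed
  have "smooth_on (\<lambda>a. FD g a (h a)) O'" by (rule smooth_on_FD_apply[OF gO hO O(1)])
  then have "smooth_on (\<lambda>a. ?Y (chart_inv c a) d) O'"
    by (rule smooth_on_cong[OF O(1), rotated]) (rule Yd[symmetric])
  then have Ydiff: "(\<lambda>a. ?Y (chart_inv c a) d) differentiable at (snd c q)"
    using smooth_on_differentiable O(2) a0 by blast
  show "cov_along A geo_atlas DD G ?Y q (E q) \<in> tangent_space geo_atlas (geo_proj z)"
    by (rule J.cov_along_in[where Y = ?Y, OF Eq Ydiff])
  define k where "k a = s (g a)" for a
  have kO: "smooth_on k O'" unfolding k_def[abs_def]
    by (rule smooth_on_compose[OF gO N(4) O(1) O(5)])
  have FDk: "FD k a u = FD s (g a) (FD g a u)" if a: "a \<in> O'" for a u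
  proof -
    have "g a \<in> N" using O(5) a by auto
    have "(k has_derivative (\<lambda>u. FD s (g a) (FD g a u))) (at a)" unfolding k_def[abs_def]
      by (rule has_derivative_compose[OF FD_has_derivative[OF smooth_on_differentiable[OF gO a]]
            FD_has_derivative[OF smooth_on_differentiable[OF N(4) \<open>g a \<in> N\<close>]]])
    then show ?thesis by (simp add: FD_eq)
  qed
  have inv_y0: "chart_inv d y0 = geo_proj z" unfolding y0_def by (rule geo.chart_inv_eq[OF d])
  have tv: "tvec_of geo_atlas (geo_proj z) d u = d_geo_proj z (FD s y0 u)" for u
    using section_tvec[OF d(1) N(1,3,4) s(1,2) N(2), of u] by (simp add: inv_y0 s(3))
  \<comment> \<open>Both sides are horizontal and project to the differential of the Gauss
    map.\<close>
  have dk: "FD k a0 u = dz u" for u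
  proof (rule d_geo_proj_injD[OF z_T1H _ dz_horizontal])
    show "FD k a0 u \<in> chi_perp z" unfolding FDk[OF O(2)] g0 by (rule s(4))
    have uc: "tvec_of A q c u \<in> tangent_space A q" "tvec_of A q c u c = u"
      by (rule A.tvec_of_in[OF c q], rule A.tvec_of_same[OF c q])
    have aM: "snd c q \<in> M" using M(1) a0 by simp
    have "d_geo_proj z (FD k a0 u) = tvec_of geo_atlas (geo_proj z) d (FD g a0 u)"
      unfolding FDk[OF O(2)] g0 tv ..
    also have "\<dots> = differential A geo_atlas G q (tvec_of A q c u)"
      using geo_pair.differential_chart[OF c q d(1) uc(1) M(3) aM] by (simp add: uc(2) Gq g_def[abs_def] a0)
    also have "\<dots> = d_geo_proj z (dz u)"
      using differential_gauss[OF q uc(1)] by (simp add: uc(2) a0)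
    finally show "d_geo_proj z (FD k a0 u) = d_geo_proj z (dz u)" .
  qed
  have ks: "k a \<in> T1H" "geo_proj (zeta a) = geo_proj (k a)" if a: "a \<in> O'" for a
  proof -
    have ga: "g a \<in> N" using O(5) a by auto
    show "k a \<in> T1H" unfolding k_def by (rule s(1)[OF ga])
    have "G (chart_inv c a) \<in> fst d" using M(3) O(3) a by (auto simp: smooth_rep_def)
    then show "geo_proj (zeta a) = geo_proj (k a)"
      unfolding k_def s(2)[OF ga] using geo.chart_inv_eq[OF d(1)] by (simp add: g_def gauss_zeta)
  qed
  have k0: "k a0 = z" by (simp add: k_def g0 s(3))
  have Z: "lor (fst z) (fst z) = -1" "lor (fst z) (snd z) = 0" using z_T1H by (auto simp: T1H_iff)
  \<comment> \<open>The coefficients are cosh and sinh of the flow time from \<open>zeta\<close> to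
    k. Their first derivatives at \<open>a0\<close> are products of z with horizontal vectors, hence
    zero.\<close>
  have second: "split_form (FD2 k a0 u w) \<eta> = split_form (FD2 zeta a0 u w) \<eta>" for u w
  proof (rule FD2_reparametrized[OF O(1,2) kO zO])
    let ?C = "\<lambda>a. lor (fst (k a)) (fst (zeta a))" and ?S = "\<lambda>a. lor (fst (k a)) (snd (zeta a))"
    have sk: "smooth_on (\<lambda>a. fst (k a)) O'" and s1: "smooth_on (\<lambda>a. fst (zeta a)) O'" and s2: "smooth_on (\<lambda>a. snd (zeta a)) O'"
      by (rule smooth_on_fst[OF kO O(1)], rule smooth_on_fst[OF zO O(1)], rule smooth_on_snd[OF zO O(1)])
    show "smooth_on (\<lambda>a. - ?C a) O'"
      by (rule smooth_on_minus[OF smooth_on_bilinear[OF bounded_bilinear_lor sk s1 O(1)] O(1)])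
    show "smooth_on ?S O'" by (rule smooth_on_bilinear[OF bounded_bilinear_lor sk s2 O(1)])
    show "k b = (- ?C b) *\<^sub>R zeta b + ?S b *\<^sub>R para_J (zeta b)" if "b \<in> O'" for b
      using orbit_coordinates[OF zeta_T1H ks(2)[OF that]] OU that by blast
    show "- ?C a0 = 1" "?S a0 = 0" by (simp_all add: k0 Z)
    have Dk: "((\<lambda>a. fst (k a)) has_derivative (\<lambda>u. fst (dz u))) (at a0)"
      using has_derivative_fst[OF FD_has_derivative[OF smooth_on_differentiable[OF kO O(2)]]] by (simp add: dk)
    have D1: "((\<lambda>a. fst (zeta a)) has_derivative (\<lambda>u. fst (dz u))) (at a0)"
      and D2: "((\<lambda>a. snd (zeta a)) has_derivative (\<lambda>u. snd (dz u))) (at a0)"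
      by (rule has_derivative_fst has_derivative_snd, rule FD_has_derivative[OF smooth_on_differentiable[OF zeta_smooth a0U]])+
    have hor: "lor (fst z) (fst (dz u)) = 0" "lor (fst (dz u)) (fst z) = 0" "lor (fst z) (snd (dz u)) = 0" "lor (fst (dz u)) (snd z) = 0" for u
      using dz_horizontal[of u] lor_commute[of "fst (dz u)"] by (auto simp: chi_perp_iff[OF z_T1H] hv_space_def)
    show "FD (\<lambda>a. - ?C a) a0 u = 0" for u
      using FD_eq[OF has_derivative_minus[OF lor.FDERIV[OF Dk D1]]] by (simp add: k0 hor)
    show "FD ?S a0 u = 0" for u
      using FD_eq[OF lor.FDERIV[OF Dk D2]] by (simp add: k0 hor)
    show "split_form z \<eta> = 0" "split_form (para_J z) \<eta> = 0"
      using \<eta> by (simp_all add: split_form_def chi_perp_iff[OF z_T1H] hv_space_def)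
  qed
  have Zt: "d_geo_proj z \<eta> \<in> tangent_space geo_atlas (geo_proj z)"
    by (rule d_geo_proj_tangent[OF z_T1H chi_perp_tangent[OF z_T1H \<eta>]])
  \<comment> \<open>At \<open>y0\<close> the derivative of the section is the horizontal lift,
    written in coordinates.\<close>
  have lift: "FD s y0 (d_geo_proj z \<eta> d) = \<eta>"
    by (rule d_geo_proj_injD[OF z_T1H s(4) \<eta>]) (simp only: tv[symmetric] geo.tvec_of_coord[OF Zt d])
  have "FD (\<lambda>a. FD s (snd d (G (chart_inv c a))) (?Y (chart_inv c a) d)) a0 = FD (\<lambda>a. FD k a (h a)) a0"
    by (rule FD_cong[OF O(1,2)]) (simp add: Yd FDk g_def)
  moreover have "FD (\<lambda>a. FD k a (h a)) a0 (E q c) = FD2 k a0 (E q c) (E q c) + FD k a0 (FD h a0 (E q c))"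
    using FD_eq[OF FD_FD_apply[OF kO differentiable_ident O(2) O(1) smooth_on_differentiable[OF hO O(2)]]] by (simp add: h0)
  ultimately show "geo_metric (geo_proj z) (cov_along A geo_atlas DD G ?Y q (E q)) (d_geo_proj z \<eta>) =
      split_form (FD2 zeta a0 (E q c) (E q c)) \<eta> + split_form (dz (FD (\<lambda>a. E (chart_inv c a) c) a0 (E q c))) \<eta>"
    using J.cov_along_metric[where Y = ?Y, OF Eq Zt Ydiff] second dk
    by (simp add: lift split_form.add_left h_def[abs_def] flip: a0)
qed

section \<open>The metric induced by the Gauss map\<close>

abbreviation induced :: "real ^ 'n \<Rightarrow> real ^ 'n \<Rightarrow> real" where
  "induced u w \<equiv> split_form (dz u) (dz w)"

text \<open>In the induced metric \<open>e i\<close> has squared length 1 - \<lambda>^2: the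
  horizontal part contributes 1, the vertical part -\<lambda>^2. Small principal curvatures make
  this positive.\<close>

definition unit_frame :: "'n \<Rightarrow> real ^ 'n" where
  "unit_frame i = (1 / sqrt (1 - (l i)\<^sup>2)) *\<^sub>R e i"

lemma l_square: "(l i)\<^sup>2 < 1"
  using eigenvalue_bounds[OF a0U e, of i] by (simp add: abs_square_less_1 abs_less_iff)

lemma bounded_bilinear_induced: "bounded_bilinear induced"
  by (rule bounded_bilinear.comp[OF bounded_bilinear_split_form dz_bounded_linear dz_bounded_linear])

lemma induced_eigenframe: "induced (e i) (e j) = (if i = j then 1 - (l i)\<^sup>2 else 0)"
  using orthonormal_frame_first_form[OF e, of i j]
  by (simp add: split_form_def FD_zeta[OF a0U] eigenframe_nu[OF e] lor_simps power2_eq_square)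

lemma unit_frame_orthonormal: "orthonormal_frame induced unit_frame"
proof -
  interpret b: bounded_bilinear induced by (rule bounded_bilinear_induced)
  have "induced (unit_frame i) (unit_frame j) = (if i = j then 1 else 0)" for i j
  proof -
    have p: "sqrt (1 - (l i)\<^sup>2) * sqrt (1 - (l i)\<^sup>2) = 1 - (l i)\<^sup>2" "1 - (l i)\<^sup>2 > 0"
      using l_square[of i] by auto
    have "induced (unit_frame i) (unit_frame j) =
        (1 / sqrt (1 - (l i)\<^sup>2)) * ((1 / sqrt (1 - (l j)\<^sup>2)) * induced (e i) (e j))"
      unfolding unit_frame_def b.scaleR_left b.scaleR_right by simp
    also have "\<dots> = (if i = j then 1 else 0)"
      using p unfolding induced_eigenframe by (auto simp: field_simps)
    finally show ?thesis .
  qed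
  then show ?thesis by (simp add: orthonormal_frame_def)
qed

text \<open>Let x and y be the components of the two halves of \<xi> along D\<sigma>(e i). The
  pairings give x = -\<lambda> y and y = -\<lambda> x, and \<lambda>^2 < 1 leaves only x = y = 0. So
  a normal vector is determined by its pairings with \<open>para_J (dz u)\<close>.\<close>

lemma horizontal_nondegenerate:
  assumes \<xi>: "\<xi> \<in> chi_perp z" and t: "\<And>u. split_form \<xi> (dz u) = 0" and n: "\<And>u. split_form \<xi> (para_J (dz u)) = 0"
  shows "\<xi> = 0"
proof -
  have h: "lor (sg c a0) (fst \<xi>) = 0" "lor (nu c a0) (fst \<xi>) = 0" "lor (sg c a0) (snd \<xi>) = 0" "lor (nu c a0) (snd \<xi>) = 0"
    using \<xi>[unfolded chi_perp_iff[OF z_T1H] hv_space_def] by (simp_all add: zeta_def)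
  have "lor (FD (sg c) a0 (e i)) (fst \<xi>) = 0 \<and> lor (FD (sg c) a0 (e i)) (snd \<xi>) = 0" for i
  proof -
    let ?x = "lor (FD (sg c) a0 (e i)) (fst \<xi>)" and ?y = "lor (FD (sg c) a0 (e i)) (snd \<xi>)"
    have 1: "?x = - l i * ?y"
      using t[of "e i"] lor_commute[of "fst \<xi>"] lor_commute[of "snd \<xi>"]
      by (simp add: split_form_def FD_zeta[OF a0U] eigenframe_nu[OF e] lor_simps)
    have 2: "?y = - l i * ?x"
      using n[of "e i"] lor_commute[of "fst \<xi>"] lor_commute[of "snd \<xi>"]
      by (simp add: split_form_def FD_zeta[OF a0U] eigenframe_nu[OF e] lor_simps)
    have "?x * (1 - (l i)\<^sup>2) = 0" using 1 2 by (simp add: power2_eq_square algebra_simps)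
    then have "?x = 0" using l_square[of i] by auto
    then show ?thesis using 2 by simp
  qed
  then have "fst \<xi> = 0" "snd \<xi> = 0"
    using tangent_zero[OF a0U _ h(1,2)] tangent_zero[OF a0U _ h(3,4)] e unfolding eigenframe_def by blast+
  then show ?thesis by (simp add: prod_eq_iff)
qed

lemma induced_zero: "(\<And>u. induced w u = 0) \<Longrightarrow> w = 0"
  using orthonormal_frame_expand[OF bounded_bilinear_induced unit_frame_orthonormal, of w]
    split_form_commute[of _ "dz w"] by simp

lemma differential_gauss_q:
  "X \<in> tangent_space A q \<Longrightarrow> differential A geo_atlas G q X = d_geo_proj z (dz (X c))"
  using differential_gauss[OF q] by (simp add: a0)

text \<open>The tangential part is the orthogonal projection computed in \<open>unit_frame\<close>.
  By \<open>lagrangian\<close> it pairs to zero with \<open>para_J (dz u)\<close>, so these pairings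
  survive. Nondegeneracy of the induced metric gives uniqueness in the definite description.\<close>

lemma normal_part_gauss:
  assumes \<zeta>: "\<zeta> \<in> chi_perp z"
  obtains \<xi> where "\<xi> \<in> chi_perp z" "normal_part A geo_atlas geo_metric G q (d_geo_proj z \<zeta>) = d_geo_proj z \<xi>"
    "\<And>u. split_form \<xi> (dz u) = 0" "\<And>u. split_form \<xi> (para_J (dz u)) = split_form \<zeta> (para_J (dz u))"
proof -
  interpret b: bounded_bilinear induced by (rule bounded_bilinear_induced)
  define w where "w = (\<Sum>i\<in>UNIV. split_form \<zeta> (dz (unit_frame i)) *\<^sub>R unit_frame i)"
  define \<xi> where "\<xi> = \<zeta> - dz w"
  have \<xi>: "\<xi> \<in> chi_perp z" unfolding \<xi>_def by (rule chi_perp_diff[OF z_T1H \<zeta> dz_horizontal])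
  have tang: "split_form \<xi> (dz u) = 0" for u
  proof -
    have "induced w u = (\<Sum>i\<in>UNIV. split_form \<zeta> (dz (unit_frame i)) * induced (unit_frame i) u)"
      unfolding w_def by (simp add: b.sum_left b.scaleR_left)
    also have "\<dots> = split_form \<zeta> (dz (\<Sum>i\<in>UNIV. induced (unit_frame i) u *\<^sub>R unit_frame i))"
      by (simp add: linear_sum[OF dz_linear] linear_cmul[OF dz_linear] split_form.sum_right split_form.scaleR_right mult.commute)
    also have "\<dots> = split_form \<zeta> (dz u)"
      using orthonormal_frame_expand[OF bounded_bilinear_induced unit_frame_orthonormal, of u] by simp
    finally show ?thesis by (simp add: \<xi>_def split_form.diff_left)
  qed
  have norm: "split_form \<xi> (para_J (dz u)) = split_form \<zeta> (para_J (dz u))" for u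
    by (simp add: \<xi>_def split_form.diff_left lagrangian)
  have tan: "T1H_tangent z (dz u)" for u by (rule chi_perp_tangent[OF z_T1H dz_horizontal])
  have "normal_part A geo_atlas geo_metric G q (d_geo_proj z \<zeta>) = d_geo_proj z \<xi>"
    unfolding normal_part_def Gq
  proof (rule the_equality, intro conjI ballI)
    show "d_geo_proj z \<xi> \<in> tangent_space geo_atlas (geo_proj z)"
      by (rule d_geo_proj_tangent[OF z_T1H chi_perp_tangent[OF z_T1H \<xi>]])
    show "geo_metric (geo_proj z) (d_geo_proj z \<xi>) (differential A geo_atlas G q X) = 0" if "X \<in> tangent_space A q" for X
      by (simp add: differential_gauss_q[OF that] geo_metric_horizontal[OF z_T1H \<xi> dz_horizontal] tang)
    have w': "tvec_of A q c w \<in> tangent_space A q" "tvec_of A q c w c = w"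
      by (rule A.tvec_of_in[OF c q], rule A.tvec_of_same[OF c q])
    have "d_geo_proj z \<zeta> - d_geo_proj z \<xi> = d_geo_proj z (\<zeta> - \<xi>)"
      by (rule d_geo_proj_diff[OF z_T1H chi_perp_tangent[OF z_T1H \<zeta>] chi_perp_tangent[OF z_T1H \<xi>], symmetric])
    then have "d_geo_proj z \<zeta> - d_geo_proj z \<xi> = differential A geo_atlas G q (tvec_of A q c w)"
      by (simp add: differential_gauss_q[OF w'(1)] w'(2) \<xi>_def)
    then show "\<exists>X\<in>tangent_space A q. d_geo_proj z \<zeta> - d_geo_proj z \<xi> = differential A geo_atlas G q X"
      using w'(1) by blast
  next
    fix N assume N: "N \<in> tangent_space geo_atlas (geo_proj z) \<and>
        (\<forall>X\<in>tangent_space A q. geo_metric (geo_proj z) N (differential A geo_atlas G q X) = 0) \<and>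
        (\<exists>X\<in>tangent_space A q. d_geo_proj z \<zeta> - N = differential A geo_atlas G q X)"
    then obtain X where X: "X \<in> tangent_space A q" "d_geo_proj z \<zeta> - N = d_geo_proj z (dz (X c))"
      using differential_gauss_q by metis
    have "N = d_geo_proj z \<zeta> - d_geo_proj z (dz (X c))" using X(2) by (simp add: algebra_simps)
    also have "\<dots> = d_geo_proj z (\<zeta> - dz (X c))"
      by (rule d_geo_proj_diff[OF z_T1H chi_perp_tangent[OF z_T1H \<zeta>] tan, symmetric])
    finally have NX: "N = d_geo_proj z (\<zeta> - dz (X c))" .
    have "induced (w - X c) u = 0" for u
    proof -
      have u: "tvec_of A q c u \<in> tangent_space A q" "tvec_of A q c u c = u"
        by (rule A.tvec_of_in[OF c q], rule A.tvec_of_same[OF c q])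
      have "geo_metric (geo_proj z) N (differential A geo_atlas G q (tvec_of A q c u)) = 0" using N u(1) by blast
      then have "split_form (\<zeta> - dz (X c)) (dz u) = 0"
        using geo_metric_horizontal[OF z_T1H chi_perp_diff[OF z_T1H \<zeta> dz_horizontal] dz_horizontal, of "X c" u]
        by (simp add: NX differential_gauss_q[OF u(1)] u(2))
      then show ?thesis
        using tang[of u] by (simp add: \<xi>_def split_form.diff_left linear_diff[OF dz_linear])
    qed
    from induced_zero[OF this] have "X c = w" by simp
    then show "N = d_geo_proj z \<xi>" by (simp add: NX \<xi>_def)
  qed
  then show ?thesis using that \<xi> tang norm by blast
qed

section \<open>Traces and the mean curvature vector\<close>

text \<open>The term with the derivative of E is tangent to the Gauss map and pairs to zero with
  \<open>para_J (dz u)\<close>. Only the cubic form remains, so the value depends on E through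
  \<open>E q\<close> alone.\<close>

lemma second_ff_gauss:
  assumes W: "openin (mfd_topology A) W" "q \<in> W" and E: "smooth_vector_field A W E"
  obtains \<xi> where "\<xi> \<in> chi_perp z" "second_ff A geo_atlas geo_metric DD G E E q = d_geo_proj z \<xi>"
    "\<And>u. split_form \<xi> (dz u) = 0" "\<And>u. split_form \<xi> (para_J (dz u)) = cubic a0 (E q c) (E q c) u"
proof -
  let ?C = "cov_along A geo_atlas DD G (\<lambda>r. differential A geo_atlas G r (E r)) q (E q)"
  obtain \<zeta> where \<zeta>: "\<zeta> \<in> chi_perp z" "?C = d_geo_proj z \<zeta>"
    by (rule tangent_space_lift[OF cov_along_gauss(1)[OF W E dz_horizontal]])
  have pair: "split_form \<zeta> (para_J (dz u)) = cubic a0 (E q c) (E q c) u" for u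
    using cov_along_gauss(2)[OF W E J_dz_horizontal, of u]
    by (simp add: \<zeta>(2) geo_metric_horizontal[OF z_T1H \<zeta>(1) J_dz_horizontal] split_form_cubic lagrangian)
  show ?thesis
  proof (rule normal_part_gauss[OF \<zeta>(1)])
    fix \<xi> assume "\<xi> \<in> chi_perp z" "normal_part A geo_atlas geo_metric G q (d_geo_proj z \<zeta>) = d_geo_proj z \<xi>"
      "\<And>u. split_form \<xi> (dz u) = 0" "\<And>u. split_form \<xi> (para_J (dz u)) = split_form \<zeta> (para_J (dz u))"
    then show thesis using that[of \<xi>] pair \<zeta>(2) by (simp add: second_ff_def)
  qed
qed

lemma bounded_bilinear_cubic: "bounded_bilinear (\<lambda>u w. cubic a0 u w k)"
proof -
  have 1: "bounded_bilinear (FD2 zeta a0)" by (rule bounded_bilinear_FD2[OF zeta_smooth U a0U])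
  interpret b: bounded_bilinear "FD2 zeta a0" by (rule 1)
  have "bilinear (\<lambda>u w. cubic a0 u w k)"
    unfolding split_form_cubic[symmetric] bilinear_def
    by (auto intro!: linearI simp: b.add_left b.add_right b.scaleR_left b.scaleR_right
        split_form.add_left split_form.scaleR_left)
  then show ?thesis by (simp add: bilinear_conv_bounded_bilinear)
qed

lemma trace_second_ff:
  fixes E :: "'n \<Rightarrow> 'a \<Rightarrow> ('a, real ^ 'n) tvec"
  assumes W: "openin (mfd_topology A) W" "q \<in> W" and E: "\<And>i. smooth_vector_field A W (E i)"
    and on: "\<And>i j. pullback_metric A geo_atlas geo_metric G q (E i q) (E j q) = (if i = j then 1 else 0)"
  obtains \<xi> where "\<xi> \<in> chi_perp z" "(\<Sum>i\<in>UNIV. second_ff A geo_atlas geo_metric DD G (E i) (E i) q) = d_geo_proj z \<xi>"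
    "\<And>u. split_form \<xi> (dz u) = 0"
    "\<And>u. split_form \<xi> (para_J (dz u)) = (\<Sum>i\<in>UNIV. cubic a0 (unit_frame i) (unit_frame i) u)"
proof -
  have Et: "E i q \<in> tangent_space A q" for i using E[of i] W(2) by (simp add: smooth_vector_field_def)
  have frame: "orthonormal_frame induced (\<lambda>i. E i q c)"
    unfolding orthonormal_frame_def
  proof (intro allI)
    fix i j
    show "induced (E i q c) (E j q c) = (if i = j then 1 else 0)"
      using on[of i j] by (simp add: pullback_metric_def Gq differential_gauss_q[OF Et]
          geo_metric_horizontal[OF z_T1H dz_horizontal dz_horizontal])
  qed
  have "\<exists>\<xi>. \<xi> \<in> chi_perp z \<and> second_ff A geo_atlas geo_metric DD G (E i) (E i) q = d_geo_proj z \<xi> \<and>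
      (\<forall>u. split_form \<xi> (dz u) = 0) \<and> (\<forall>u. split_form \<xi> (para_J (dz u)) = cubic a0 (E i q c) (E i q c) u)" for i
    by (rule second_ff_gauss[OF W E[of i]]) blast
  then obtain \<xi> where \<xi>: "\<And>i. \<xi> i \<in> chi_perp z"
    "\<And>i. second_ff A geo_atlas geo_metric DD G (E i) (E i) q = d_geo_proj z (\<xi> i)"
    "\<And>i u. split_form (\<xi> i) (dz u) = 0" "\<And>i u. split_form (\<xi> i) (para_J (dz u)) = cubic a0 (E i q c) (E i q c) u"
    by metis
  have s: "(\<Sum>i\<in>UNIV. \<xi> i) \<in> chi_perp z" "d_geo_proj z (\<Sum>i\<in>UNIV. \<xi> i) = (\<Sum>i\<in>UNIV. d_geo_proj z (\<xi> i))"
    using d_geo_proj_sum[OF z_T1H, where \<xi> = \<xi> and I = UNIV] \<xi>(1) by simp_all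
  have "(\<Sum>i\<in>UNIV. cubic a0 (E i q c) (E i q c) u) = (\<Sum>i\<in>UNIV. cubic a0 (unit_frame i) (unit_frame i) u)" for u
    by (rule orthonormal_trace[OF bounded_bilinear_induced split_form_commute unit_frame_orthonormal frame bounded_bilinear_cubic])
  then show ?thesis
    by (intro that[OF s(1)]) (simp_all add: s(2) \<xi>(2,3,4) split_form.sum_left)
qed

text \<open>The description in \<open>mean_curvature\<close> quantifies over all fields orthonormal
  at q. Coordinate fields through \<open>unit_frame\<close> are an instance, which gives uniqueness;
  by \<open>horizontal_nondegenerate\<close> every other choice has the same sum, which gives
  existence.\<close>

lemma mean_curvature_gauss:
  obtains \<xi> where "\<xi> \<in> chi_perp z" "mean_curvature A geo_atlas geo_metric DD G q = d_geo_proj z \<xi>"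
    "\<And>u. split_form \<xi> (para_J (dz u)) = (1 / real CARD('n)) * (\<Sum>i\<in>UNIV. cubic a0 (unit_frame i) (unit_frame i) u)"
proof -
  define F where "F i = (\<lambda>r. tvec_of A r c (unit_frame i))" for i
  have F: "openin (mfd_topology A) (fst c)" "smooth_vector_field A (fst c) (F i)" for i
    unfolding F_def by (rule A.openin_chart[OF c], rule A.smooth_vector_field_const[OF c])
  have Fq: "F i q \<in> tangent_space A q" "F i q c = unit_frame i" for i
    unfolding F_def by (rule A.tvec_of_in[OF c q], rule A.tvec_of_same[OF c q])
  have on: "pullback_metric A geo_atlas geo_metric G q (F i q) (F j q) = (if i = j then 1 else 0)" for i j
    using unit_frame_orthonormal
    by (simp add: pullback_metric_def Gq differential_gauss_q[OF Fq(1)] Fq(2) orthonormal_frame_def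
        geo_metric_horizontal[OF z_T1H dz_horizontal dz_horizontal])
  obtain \<xi> where \<xi>: "\<xi> \<in> chi_perp z" "(\<Sum>i\<in>UNIV. second_ff A geo_atlas geo_metric DD G (F i) (F i) q) = d_geo_proj z \<xi>"
    "\<And>u. split_form \<xi> (dz u) = 0"
    "\<And>u. split_form \<xi> (para_J (dz u)) = (\<Sum>i\<in>UNIV. cubic a0 (unit_frame i) (unit_frame i) u)"
    by (rule trace_second_ff[OF F(1) q F(2) on]) blast
  have "mean_curvature A geo_atlas geo_metric DD G q = (1 / real CARD('n)) *\<^sub>R d_geo_proj z \<xi>"
    unfolding mean_curvature_def
  proof (rule the_equality, intro allI impI)
    fix W and E :: "'n \<Rightarrow> 'a \<Rightarrow> ('a, real ^ 'n) tvec"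
    assume WE: "openin (mfd_topology A) W \<and> q \<in> W \<and> (\<forall>i. smooth_vector_field A W (E i)) \<and>
        (\<forall>i j. pullback_metric A geo_atlas geo_metric G q (E i q) (E j q) = (if i = j then 1 else 0))"
    obtain \<eta> where \<eta>: "\<eta> \<in> chi_perp z" "(\<Sum>i\<in>UNIV. second_ff A geo_atlas geo_metric DD G (E i) (E i) q) = d_geo_proj z \<eta>"
      "\<And>u. split_form \<eta> (dz u) = 0"
      "\<And>u. split_form \<eta> (para_J (dz u)) = (\<Sum>i\<in>UNIV. cubic a0 (unit_frame i) (unit_frame i) u)"
      by (rule trace_second_ff[of W E]) (use WE in blast)+
    have "\<xi> - \<eta> = 0"
      by (rule horizontal_nondegenerate[OF chi_perp_diff[OF z_T1H \<xi>(1) \<eta>(1)]])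
        (simp_all add: split_form.diff_left \<xi>(3,4) \<eta>(3,4))
    then show "(1 / real CARD('n)) *\<^sub>R d_geo_proj z \<xi> =
        (1 / real CARD('n)) *\<^sub>R (\<Sum>i\<in>UNIV. second_ff A geo_atlas geo_metric DD G (E i) (E i) q)"
      by (simp add: \<eta>(2))
  next
    fix H' assume H': "\<forall>W. \<forall>E :: 'n \<Rightarrow> 'a \<Rightarrow> ('a, real ^ 'n) tvec.
        openin (mfd_topology A) W \<and> q \<in> W \<and> (\<forall>i. smooth_vector_field A W (E i)) \<and>
        (\<forall>i j. pullback_metric A geo_atlas geo_metric G q (E i q) (E j q) = (if i = j then 1 else 0)) \<longrightarrow>
        H' = (1 / real CARD('n)) *\<^sub>R (\<Sum>i\<in>UNIV. second_ff A geo_atlas geo_metric DD G (E i) (E i) q)"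
    have "H' = (1 / real CARD('n)) *\<^sub>R (\<Sum>i\<in>UNIV. second_ff A geo_atlas geo_metric DD G (F i) (F i) q)"
      using F q on by (intro H'[rule_format, of "fst c" F]) simp
    then show "H' = (1 / real CARD('n)) *\<^sub>R d_geo_proj z \<xi>" by (simp only: \<xi>(2))
  qed
  also have "\<dots> = d_geo_proj z ((1 / real CARD('n)) *\<^sub>R \<xi>)"
    by (rule d_geo_proj_scale[OF z_T1H chi_perp_tangent[OF z_T1H \<xi>(1)], symmetric])
  finally show ?thesis
    by (rule that[OF chi_perp_scale[OF z_T1H \<xi>(1)]]) (simp only: split_form.scaleR_left \<xi>(4) real_scaleR_def)
qed

text \<open>Rescaling \<open>unit_frame\<close> back to the eigenframe puts the weights 1 / (1 -
  \<lambda>^2) into the trace, which then is the derivative of \<open>f_sigma\<close> found from the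
  Gram determinants.\<close>

lemma Omega_mean_curvature:
  assumes V: "V \<in> tangent_space A q"
  shows "geo_Omega (G q) (mean_curvature A geo_atlas geo_metric DD G q) (differential A geo_atlas G q V) =
    dderiv A (f_sigma A D \<sigma> \<nu>) q V"
proof -
  obtain \<xi> where \<xi>: "\<xi> \<in> chi_perp z" "mean_curvature A geo_atlas geo_metric DD G q = d_geo_proj z \<xi>"
    "\<And>u. split_form \<xi> (para_J (dz u)) = (1 / real CARD('n)) * (\<Sum>i\<in>UNIV. cubic a0 (unit_frame i) (unit_frame i) u)"
    by (rule mean_curvature_gauss) blast
  have "geo_Omega (G q) (mean_curvature A geo_atlas geo_metric DD G q) (differential A geo_atlas G q V) =
      split_form \<xi> (para_J (dz (V c)))"
    by (simp only: geo_Omega_def Gq \<xi>(2) differential_gauss_q[OF V] geo_J_horizontal[OF z_T1H dz_horizontal]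
        geo_metric_horizontal[OF z_T1H \<xi>(1) J_dz_horizontal])
  moreover have "cubic a0 (unit_frame i) (unit_frame i) u = cubic a0 (e i) (e i) u / (1 - (l i)\<^sup>2)" for i u
  proof -
    interpret b: bounded_bilinear "\<lambda>u w. cubic a0 u w k" for k by (rule bounded_bilinear_cubic)
    have "sqrt (1 - (l i)\<^sup>2) * sqrt (1 - (l i)\<^sup>2) = 1 - (l i)\<^sup>2" using l_square[of i] by simp
    then show ?thesis unfolding unit_frame_def b.scaleR_left b.scaleR_right by simp
  qed
  moreover have "dderiv A (f_sigma A D \<sigma> \<nu>) q V =
      (1 / real CARD('n)) * (\<Sum>i\<in>UNIV. cubic a0 (e i) (e i) (V c) / (1 - (l i)\<^sup>2))"
  proof -
    have D: "((\<lambda>x. f_sigma A D \<sigma> \<nu> (chart_inv c x)) has_derivative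
        (\<lambda>k. (1 / real CARD('n)) * (\<Sum>i\<in>UNIV. cubic a0 (e i) (e i) k / (1 - (l i)\<^sup>2)))) (at (snd c q))"
      using f_sigma_has_derivative[OF a0U e] by (simp only: a0)
    then have "(\<lambda>x. f_sigma A D \<sigma> \<nu> (chart_inv c x)) differentiable at (snd c q)"
      by (auto simp: differentiable_def)
    from A.dderiv_chart[OF c q V this] show ?thesis unfolding FD_eq[OF D] .
  qed
  ultimately show ?thesis using \<xi>(3) by simp
qed

end

theorem proposition6p5:
  fixes A :: "('a, real ^ 'n::finite) chart set"
    and \<sigma> :: "'a \<Rightarrow> 'n mink"
    and \<nu> :: "'a \<Rightarrow> 'n hyp_tvec"
    and D :: "('n mink, real ^ ('n option)) conn"
    and DD :: "('n geodesic, (real ^ 'n) \<times> (real ^ 'n)) conn"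
  assumes "oriented_manifold A"
    and "levi_civita hyp_atlas hyp_metric D"
    and "levi_civita geo_atlas geo_metric DD"
    and "smooth_embedding A hyp_atlas \<sigma>"
    and "unit_normal_field A \<sigma> \<nu>"
    and "small_principal_curvatures A D \<sigma> \<nu>"
  defines "G \<equiv> gauss_map \<sigma> \<nu>"
  defines "H \<equiv> mean_curvature A geo_atlas geo_metric DD G"
  shows "\<forall>q\<in>carrier A. \<forall>V\<in>tangent_space A q.
           geo_Omega (G q) (H q) (differential A geo_atlas G q V) = dderiv A (f_sigma A D \<sigma> \<nu>) q V"
proof (intro ballI)
  fix q V assume q: "q \<in> carrier A" and V: "V \<in> tangent_space A q"
  obtain c where chart: "c \<in> A" "q \<in> fst c" using q by (auto simp: carrier_def)
  have "smooth_manifold A" using assms(1) by (simp add: oriented_manifold_def)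
  then interpret small_hypersurface_chart A \<sigma> \<nu> D c "snd c ` fst c"
    using assms(2,4-6) chart by unfold_locales simp_all
  have "snd c q \<in> snd c ` fst c" by (rule imageI[OF chart(2)])
  \<comment> \<open>The equation is pointwise, so the chart and the eigenframe may depend on
    q.\<close>
  then obtain e l where "eigenframe (snd c q) e l" using eigenframe_exists by blast
  then interpret gauss_map_point A \<sigma> \<nu> D c "snd c ` fst c" DD q "snd c q" e l
    using assms(3) chart by unfold_locales simp_all
  show "geo_Omega (G q) (H q) (differential A geo_atlas G q V) = dderiv A (f_sigma A D \<sigma> \<nu>) q V"
    unfolding H_def G_def by (rule Omega_mean_curvature[OF V])
qed

end
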